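(* Let $P=\mathit{vc}^k(\Delta^n)$ be a truncation polytope with $n\ge 3$; it has $m=n+k+1$ facets. Then the bigraded Betti numbers of $P$ are given by $$\beta^{-i,2(i+1)}(P)=i\binom{k+1}{i+1},$$ $$\beta^{-i,2(i+n-1)}(P)=(k+1-i)\binom{k+1}{k+2-i},$$ $$\beta^{-i,2j}(P)=0\quad\text{for } i+1<j<i+n-1.$$ The other bigraded Betti numbers are also zero, except for $$\beta^{0,0}(P)=\beta^{-(m-n),2m}(P)=1.$$
   Context: Truncation polytopes: for a simple $n$-polytope $P$ and a vertex $v$ of $P$, choose a hyperplane $H$ separating $v$ from the other vertices of $P$, and let $H_{\le}$ be the closed halfspace bounded by $H$ not containing $v$. The simple polytope $P\cap H_{\le}$ is called a vertex cut of $P$, denoted $\mathit{vc}(P)$. $\mathit{vc}^k(P)$ denotes any polytope obtained from $P$ by iterating the vertex cut operation $k$ times (with any choices of cut vertices). A truncation polytope is a polytope $\mathit{vc}^k(\Delta^n)$, $k\ge0$, where $\Delta^n$ is an $n$-simplex. Bigraded Betti numbers: fix a field $\mathbf k$. For a simple polytope $P$ with facets $F_1,\dots,F_m$, let $K_P$ be the simplicial complex on $[m]=\{1,\dots,m\}$ whose simplices are the subsets $\{i_1,\dots,i_r\}$ with $F_{i_1}\cap\dots\cap F_{i_r}\neq\varnothing$. The face ring is $\mathbf k[K_P]=\mathbf k[v_1,\dots,v_m]/\mathcal I$, $\deg v_i=2$, where $\mathcal I$ is generated by the square-free monomials $v_{i_1}\cdots v_{i_r}$ with $\{i_1,\dots,i_r\}$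 not a simplex of $K_P$. Set $\beta^{-i,2j}(P)=\dim_{\mathbf k}\operatorname{Tor}^{-i,2j}_{\mathbf k[v_1,\dots,v_m]}(\mathbf k[K_P],\mathbf k)$, $0\le i,j\le m$, where $\operatorname{Tor}^{-i,2j}$ is the part of $\operatorname{Tor}_i$ of internal degree $2j$. Binomial coefficients $\binom{a}{b}$ with $b>a$ are zero.
   Formalization: The second formula is asserted only for i ≤ k+1; at i = k+2 (where j = m) it would literally give −1, which is not a dimension, and that Betti number is instead stated to be zero. *)

theory Defs
  imports
    "HOL-Analysis.Polytope"
    "HOL-Algebra.QuotRing"
    "HOL-Library.Poly_Mapping"
begin

definition simple_polytope :: "'a::euclidean_space set \<Rightarrow> bool" where
  "simple_polytope P \<longleftrightarrow> polytope P \<and>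
     (\<forall>v. v extreme_point_of P \<longrightarrow> int (card {G. G facet_of P \<and> v \<in> G}) = aff_dim P)"

text \<open>The cutting hyperplane is \<open>{x. a \<bullet> x = b}\<close>; it misses all vertices of \<open>P\<close>.\<close>

definition vertex_cut :: "'a::euclidean_space set \<Rightarrow> 'a set \<Rightarrow> bool" where
  "vertex_cut P Q \<longleftrightarrow> simple_polytope P \<and>
     (\<exists>v a b. v extreme_point_of P \<and> a \<noteq> 0 \<and> a \<bullet> v > b \<and>
        (\<forall>w. w extreme_point_of P \<and> w \<noteq> v \<longrightarrow> a \<bullet> w < b) \<and>
        Q = P \<inter> {x. a \<bullet> x \<le> b})"

definition is_truncation_polytope :: "nat \<Rightarrow> nat \<Rightarrow> 'a::euclidean_space set \<Rightarrow> bool" where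
  "is_truncation_polytope n k P \<longleftrightarrow>
     (\<exists>\<Delta>. (int n) simplex \<Delta> \<and> (vertex_cut ^^ k) \<Delta> P)"

text \<open>Here the facets of \<open>P\<close> are enumerated as \<open>F 1, \<dots>, F m\<close>. The intersection over the empty
  index set is \<open>P\<close>, so the empty simplex belongs to the complex.\<close>

definition facet_complex :: "'a set \<Rightarrow> nat \<Rightarrow> (nat \<Rightarrow> 'a set) \<Rightarrow> nat set set" where
  "facet_complex P m F = {I. I \<subseteq> {1..m} \<and> P \<inter> (\<Inter>i\<in>I. F i) \<noteq> {}}"

text \<open>A monomial is its exponent vector, a polynomial is a finitely supported function from
  monomials to coefficients. The type has a variable for every natural number;
  \<open>poly_ring m\<close> is the subring of polynomials in the variables \<open>v_1, \<dots>, v_m\<close>.\<close>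

type_synonym 'k mpoly = "(nat \<Rightarrow>\<^sub>0 nat) \<Rightarrow>\<^sub>0 'k"

definition poly_ring :: "nat \<Rightarrow> 'k::field mpoly ring" where
  "poly_ring m = \<lparr>carrier = {p. \<forall>t\<in>Poly_Mapping.keys p. Poly_Mapping.keys t \<subseteq> {1..m}},
     mult = (*), one = 1, zero = 0, add = (+)\<rparr>"

definition sqfree_monomial :: "nat set \<Rightarrow> 'k::field mpoly" where
  "sqfree_monomial I = Poly_Mapping.single (\<Sum>i\<in>I. Poly_Mapping.single i 1) 1"

definition face_ideal :: "nat \<Rightarrow> nat set set \<Rightarrow> 'k::field mpoly set" where
  "face_ideal m K = genideal (poly_ring m) {sqfree_monomial I |I. I \<subseteq> {1..m} \<and> I \<notin> K}"

text \<open>Internal degree, with every variable in degree 2.\<close>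

definition mon_degree :: "(nat \<Rightarrow>\<^sub>0 nat) \<Rightarrow> nat" where
  "mon_degree t = 2 * (\<Sum>i\<in>Poly_Mapping.keys t. Poly_Mapping.lookup t i)"

definition pm_scale :: "'r::comm_ring_1 \<Rightarrow> (nat \<Rightarrow>\<^sub>0 'r) \<Rightarrow> (nat \<Rightarrow>\<^sub>0 'r)" where
  "pm_scale c x = Poly_Mapping.map ((*) c) x"

lemma lookup_pm_scale: "Poly_Mapping.lookup (pm_scale c x) b = c * Poly_Mapping.lookup x b"
  by (simp add: pm_scale_def Poly_Mapping.map.rep_eq when_def)

interpretation pm: vector_space "pm_scale :: 'k::field \<Rightarrow> (nat \<Rightarrow>\<^sub>0 'k) \<Rightarrow> (nat \<Rightarrow>\<^sub>0 'k)"
  by unfold_locales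
    (auto intro!: poly_mapping_eqI simp: lookup_pm_scale lookup_add algebra_simps)

text \<open>The linear map sending the basis element \<open>b\<close> to \<open>D b\<close>.\<close>

definition lin_ext :: "(nat \<Rightarrow> (nat \<Rightarrow>\<^sub>0 'r)) \<Rightarrow> (nat \<Rightarrow>\<^sub>0 'r::comm_ring_1) \<Rightarrow> (nat \<Rightarrow>\<^sub>0 'r)" where
  "lin_ext D x = (\<Sum>b\<in>Poly_Mapping.keys x. pm_scale (Poly_Mapping.lookup x b) (D b))"

text \<open>Data of an augmented complex \<open>\<dots> \<rightarrow> F 1 \<rightarrow> F 0 \<rightarrow> S/J \<rightarrow> 0\<close> of graded free modules over the
  polynomial ring \<open>S\<close>: \<open>F i\<close> has basis \<open>gens i\<close>, the basis element \<open>b\<close> has internal degree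
  \<open>gdeg i b\<close> and, for \<open>i \<ge> 1\<close>, its image in \<open>F (i - 1)\<close> is \<open>bd i b\<close> (\<open>bd 0\<close> is not used);
  \<open>aug b\<close> represents the image in \<open>S/J\<close> of the basis element \<open>b\<close> of \<open>F 0\<close>.\<close>

record (overloaded) 'k free_cplx =
  gens :: "nat \<Rightarrow> nat set"
  gdeg :: "nat \<Rightarrow> nat \<Rightarrow> nat"
  bd :: "nat \<Rightarrow> nat \<Rightarrow> (nat \<Rightarrow>\<^sub>0 'k mpoly)"
  aug :: "nat \<Rightarrow> 'k mpoly"

definition free_mod :: "nat \<Rightarrow> nat set \<Rightarrow> (nat \<Rightarrow>\<^sub>0 'k::field mpoly) set" where
  "free_mod m B = {x. Poly_Mapping.keys x \<subseteq> B \<and>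
     (\<forall>b. Poly_Mapping.lookup x b \<in> carrier (poly_ring m))}"

definition aug_map :: "nat \<Rightarrow> 'k::field mpoly set \<Rightarrow> (nat \<Rightarrow> 'k mpoly) \<Rightarrow>
    (nat \<Rightarrow>\<^sub>0 'k mpoly) \<Rightarrow> 'k mpoly set" where
  "aug_map m J e x =
     J +>\<^bsub>poly_ring m\<^esub> (\<Sum>b\<in>Poly_Mapping.keys x. Poly_Mapping.lookup x b * e b)"

text \<open>The maps are homogeneous of internal degree 0. Each \<open>F i\<close> has finitely many basis elements
  in each degree, so its graded pieces are finite-dimensional.\<close>

definition graded_free_resolution ::
    "nat \<Rightarrow> 'k::field mpoly set \<Rightarrow> 'k free_cplx \<Rightarrow> bool" where
  "graded_free_resolution m J R \<longleftrightarrow>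
     (\<forall>i d. finite {b \<in> gens R i. gdeg R i b = d}) \<and>
     (\<forall>b\<in>gens R 0. aug R b \<in> carrier (poly_ring m) \<and>
        (\<forall>t\<in>Poly_Mapping.keys (aug R b). mon_degree t = gdeg R 0 b)) \<and>
     (\<forall>i. \<forall>b\<in>gens R (Suc i). bd R (Suc i) b \<in> free_mod m (gens R i) \<and>
        (\<forall>c. \<forall>t\<in>Poly_Mapping.keys (Poly_Mapping.lookup (bd R (Suc i) b) c).
           mon_degree t + gdeg R i c = gdeg R (Suc i) b)) \<and>
     aug_map m J (aug R) ` free_mod m (gens R 0) = carrier (poly_ring m Quot J) \<and>
     {x \<in> free_mod m (gens R 0). aug_map m J (aug R) x = \<zero>\<^bsub>poly_ring m Quot J\<^esub>} =
       lin_ext (bd R 1) ` free_mod m (gens R 1) \<and>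
     (\<forall>i. {x \<in> free_mod m (gens R (Suc i)). lin_ext (bd R (Suc i)) x = 0} =
       lin_ext (bd R (Suc (Suc i))) ` free_mod m (gens R (Suc (Suc i))))"

text \<open>The field is an \<open>S\<close>-module via \<open>v_i \<mapsto> 0\<close>. Tensoring \<open>F i\<close> with it gives the vector space
  with basis \<open>gens i\<close>, and the matrix of the tensored differential consists of the constant
  coefficients (coefficients at the monomial \<open>0\<close>) of the entries of \<open>bd i\<close>.\<close>

definition bd_tensor :: "'k::field free_cplx \<Rightarrow> nat \<Rightarrow> nat \<Rightarrow> (nat \<Rightarrow>\<^sub>0 'k)" where
  "bd_tensor R i b = Poly_Mapping.map (\<lambda>p. Poly_Mapping.lookup p 0) (bd R i b)"

definition tensor_piece :: "'k::field free_cplx \<Rightarrow> nat \<Rightarrow> nat \<Rightarrow> (nat \<Rightarrow>\<^sub>0 'k) set" where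
  "tensor_piece R i d = {x. Poly_Mapping.keys x \<subseteq> {b \<in> gens R i. gdeg R i b = d}}"

definition tor_cycles :: "'k::field free_cplx \<Rightarrow> nat \<Rightarrow> nat \<Rightarrow> (nat \<Rightarrow>\<^sub>0 'k) set" where
  "tor_cycles R i d =
     {x \<in> tensor_piece R i d. i = 0 \<or> lin_ext (bd_tensor R i) x = 0}"

definition tor_boundaries :: "'k::field free_cplx \<Rightarrow> nat \<Rightarrow> nat \<Rightarrow> (nat \<Rightarrow>\<^sub>0 'k) set" where
  "tor_boundaries R i d = lin_ext (bd_tensor R (Suc i)) ` tensor_piece R (Suc i) d"

text \<open>The dimension of the part of \<open>Tor_i(S/J, k)\<close> of internal degree \<open>d\<close>, computed from a chosen
  resolution of \<open>S/J\<close>. For a resolution, the boundaries form a subspace of the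
  finite-dimensional space of cycles, so the difference is the dimension of the quotient.\<close>

definition tor_dim :: "nat \<Rightarrow> 'k::field mpoly set \<Rightarrow> nat \<Rightarrow> nat \<Rightarrow> nat" where
  "tor_dim m J i d = (let R = (SOME R. graded_free_resolution m J R)
     in pm.dim (tor_cycles R i d) - pm.dim (tor_boundaries R i d))"

text \<open>\<open>betti TYPE('k) P m F i j\<close> is the bigraded Betti number with superscript \<open>(-i, 2j)\<close>; the face
  ring is \<open>poly_ring m Quot face_ideal m (facet_complex P m F)\<close>.\<close>

definition betti :: "'k::field itself \<Rightarrow> 'a set \<Rightarrow> nat \<Rightarrow> (nat \<Rightarrow> 'a set) \<Rightarrow> nat \<Rightarrow> nat \<Rightarrow> nat" where
  "betti _ P m F i j =
     tor_dim m (face_ideal m (facet_complex P m F) :: 'k mpoly set) i (2 * j)"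

end

theory Submission
  imports Defs "HOL-Library.Function_Algebras"
begin

text \<open>
  Computing \<open>Tor\<close> from a free resolution of the face ring agrees with computing it from the Koszul
  complex, since both are the edges of one double complex with exact rows and columns. The part of
  the Koszul complex of multidegree \<open>u\<close> is the cochain complex of a simplicial complex, which is a
  cone unless \<open>u\<close> is square-free. This gives Hochster's formula: the Betti number \<open>(-i, 2j)\<close> is the
  sum, over the sets \<open>J\<close> of \<open>j\<close> vertices, of the dimensions of the reduced cohomology in degree
  \<open>j - i - 1\<close> of the full subcomplexes on \<open>J\<close>.

  A vertex cut of the polytope is a stellar subdivision of the nerve of its facets at a maximal
  simplex \<open>\<sigma>\<close>, so this nerve is a stacked sphere. Let \<open>w\<close> be the new vertex and \<open>J\<close> a set of old vertices.
  The full subcomplex on \<open>J\<close> changes only if \<open>\<sigma> \<subseteq> J\<close>: it loses \<open>\<sigma>\<close>, and as a proper full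
  subcomplex of a sphere has no top cohomology, this creates a class one degree below the top. The full
  subcomplex on \<open>insert w J\<close> for nonempty \<open>J\<close> has the cohomology of the old one on \<open>J\<close>, plus a new
  component if \<open>J\<close> misses \<open>\<sigma>\<close>. Summing over \<open>J\<close> gives a recursion in the number of cuts that is solved
  by Pascal's rule.
\<close>

section \<open>Dimensions in a double complex\<close>

text \<open>\<open>tor_dim\<close> takes its resolution from \<open>SOME\<close>, so only the
  defining property of that resolution is available. The comparison with the Koszul complex is
  therefore carried out for an arbitrary resolution, and one is constructed only to know that the
  choice succeeds. Homology is never formed as a quotient: all modules are subspaces of a few large
  function spaces, a Betti number is an integer difference of two dimensions, and exact sequences
  become rank-nullity counts. Adding one simplex then leaves a single unknown bit \<open>e\<close>,
  which is settled by the fact that cohomology dimensions are not negative.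

  That bit shapes the combinatorial induction. Removing the cut facet creates a class below the top
  because proper full subcomplexes have no top cohomology; on the old vertex set the latter follows
  from the acyclicity of the sphere without the cut facet, so both are carried in one induction. The
  bound 3 on \<open>n\<close> separates degree 1, where components are counted, from degree
  \<open>n - 1\<close>, where removed facets are counted; the second count is the first one read at
  the complementary number of vertices.\<close>

definition fin_span :: "('a::field \<Rightarrow> 'b::ab_group_add \<Rightarrow> 'b) \<Rightarrow> 'b set \<Rightarrow> bool" where
  "fin_span s V \<longleftrightarrow> (\<exists>B. finite B \<and> V \<subseteq> module.span s B)"

text \<open>The finite spanning set of \<open>fin_span\<close> may lie outside the set that it
  bounds, so the property passes to arbitrary subsets at once.\<close>

lemma fin_span_mono: "fin_span s V \<Longrightarrow> W \<subseteq> V \<Longrightarrow> fin_span s W"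
  unfolding fin_span_def by blast

lemma fin_span_basis:
  assumes "vector_space s" "module.subspace s V" "fin_span s V"
  obtains B where "B \<subseteq> V" "\<not> module.dependent s B" "module.span s B = V" "finite B"
    "card B = vector_space.dim s V"
proof -
  interpret vs: vector_space s by fact
  obtain B where B: "B \<subseteq> V" "vs.independent B" "V \<subseteq> vs.span B" "card B = vs.dim V"
    using vs.basis_exists by metis
  obtain S where S: "finite S" "V \<subseteq> vs.span S" using assms(3) fin_span_def by metis
  have "finite B" using vs.independent_span_bound[of S B] S B by auto
  moreover have "vs.span B = V" using B assms(2) vs.span_minimal by blast
  ultimately show ?thesis using that B by blast
qed

text \<open>A basis \<open>B\<close> of the kernel is extended to a basis \<open>C\<close> of
  \<open>V\<close>. The map kills \<open>B\<close> and is injective on the span of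
  \<open>C - B\<close>, so the images of \<open>C - B\<close> form a basis of the image. The version
  is relative to a subspace \<open>V\<close> because all modules below are subspaces of one
  type.\<close>

lemma rank_nullity:
  assumes "Vector_Spaces.linear s1 s2 f"
    and V: "module.subspace s1 V" "fin_span s1 V"
  shows "vector_space.dim s2 (f ` V) + vector_space.dim s1 {x\<in>V. f x = 0} = vector_space.dim s1 V"
proof -
  interpret Vector_Spaces.linear s1 s2 f by fact
  let ?K = "{x\<in>V. f x = 0}"
  have K: "vs1.subspace ?K"
    using V(1) by (auto simp: vs1.subspace_def add scale)
  have "fin_span s1 ?K" by (rule fin_span_mono[OF V(2)]) auto
  then obtain B where B: "B \<subseteq> ?K" "vs1.independent B" "vs1.span B = ?K" "finite B" "card B = vs1.dim ?K"
    by (rule fin_span_basis[OF vs1.vector_space_axioms K])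
  obtain C where C: "B \<subseteq> C" "C \<subseteq> V" "vs1.independent C" "V \<subseteq> vs1.span C"
    by (rule vs1.maximal_independent_subset_extend[of B V]) (use B in auto)
  obtain S where S: "finite S" "V \<subseteq> vs1.span S" using V(2) fin_span_def by metis
  have fC: "finite C" using vs1.independent_span_bound[of S C] S C by auto
  have spC: "vs1.span C = V" by (rule antisym[OF vs1.span_minimal[OF C(2) V(1)] C(4)])
  have dV: "vs1.dim V = card C" by (rule vs1.basis_card_eq_dim[OF C(2,4,3), symmetric])
  let ?D = "C - B"
  have D0: "x = 0" if xD: "x \<in> vs1.span ?D" and fx: "f x = 0" for x
  proof -
    have "x \<in> V" using xD vs1.span_mono[of ?D C] spC by auto
    then have "x \<in> vs1.span B" using B fx by auto
    obtain u where u: "x = (\<Sum>v\<in>?D. s1 (u v) v)"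
      using xD fC by (auto simp: vs1.span_finite)
    obtain w where w: "x = (\<Sum>v\<in>B. s1 (w v) v)"
      using \<open>x \<in> vs1.span B\<close> B(4) by (auto simp: vs1.span_finite)
    \<comment> \<open>The expansions of \<open>x\<close> over \<open>B\<close> and over
      \<open>C - B\<close> are subtracted, which gives a linear relation over the independent set
      \<open>C\<close>.\<close>
    have "(\<Sum>v\<in>C. s1 (if v \<in> B then - w v else u v) v) = (\<Sum>v\<in>B. s1 (- w v) v) + (\<Sum>v\<in>?D. s1 (u v) v)"
      using fC C(1) by (subst sum.subset_diff[of B C]) (auto intro!: arg_cong2[where f="(+)"] sum.cong simp: add.commute)
    also have "\<dots> = 0" using u w by (simp add: sum_negf)
    finally have "\<forall>v\<in>C. (if v \<in> B then - w v else u v) = 0"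
      using vs1.independentD[OF C(3) fC subset_refl, of "\<lambda>v. if v \<in> B then - w v else u v"] by blast
    then have "\<forall>v\<in>?D. u v = 0" by auto
    then show ?thesis using u by simp
  qed
  have inj: "inj_on f (vs1.span ?D)"
  proof (rule inj_onI)
    fix x y assume "x \<in> vs1.span ?D" "y \<in> vs1.span ?D" "f x = f y"
    then have "x - y = 0" using D0[of "x - y"] vs1.span_diff by (simp add: diff)
    then show "x = y" by simp
  qed
  have indD: "vs1.independent ?D" by (rule vs1.independent_mono[OF C(3)]) auto
  have indf: "vs2.independent (f ` ?D)"
    by (rule independent_injective_image[OF indD inj])
  have fB: "f b = 0" if "b \<in> B" for b using B(1) that by blast
  have "f ` V = vs2.span (f ` C)" using spC span_image by metis
  also have "\<dots> = vs2.span (f ` ?D)"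
    unfolding vs2.span_eq
  proof
    show "f ` C \<subseteq> vs2.span (f ` ?D)"
      using fB by (auto intro: vs2.span_base vs2.span_zero) (metis DiffI fB imageI vs2.span_base vs2.span_zero)
    show "f ` ?D \<subseteq> vs2.span (f ` C)" by (auto intro: vs2.span_base)
  qed
  finally have "vs2.dim (f ` V) = card (f ` ?D)"
    using vs2.dim_span_eq_card_independent[OF indf] by simp
  also have "\<dots> = card ?D"
    by (rule card_image, rule inj_on_subset[OF inj], rule vs1.span_superset)
  also have "\<dots> = card C - card B" using C(1) fC by (simp add: card_Diff_subset B(4))
  finally show ?thesis using dV B(5) card_mono[OF fC C(1)] by simp
qed

lemma fin_span_image:
  assumes "Vector_Spaces.linear s1 s2 f" "fin_span s1 V"
  shows "fin_span s2 (f ` V)"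
proof -
  interpret Vector_Spaces.linear s1 s2 f by fact
  obtain B where "finite B" "V \<subseteq> vs1.span B" using assms(2) fin_span_def by metis
  then have "finite (f ` B)" "f ` V \<subseteq> vs2.span (f ` B)" using span_image by (auto simp: subset_iff)
  then show ?thesis unfolding fin_span_def by blast
qed

lemma dim_inj_image:
  assumes lin: "Vector_Spaces.linear s1 s2 f"
    and V: "module.subspace s1 V" "fin_span s1 V"
    and inj: "\<And>x. x \<in> V \<Longrightarrow> f x = 0 \<Longrightarrow> x = 0"
  shows "vector_space.dim s2 (f ` V) = vector_space.dim s1 V"
proof -
  interpret Vector_Spaces.linear s1 s2 f by fact
  have "{x\<in>V. f x = 0} = {0}" using inj V(1) vs1.subspace_0 by auto
  moreover have "vs1.dim {0} = 0" using vs1.dim_le_card[of "{0}" "{}"] by simp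
  ultimately show ?thesis using rank_nullity[OF lin V] by simp
qed

text \<open>Both pairs of dimensions differ by
  \<open>dim ker (d1 d2) - dim ker d1 - dim ker d2 + dim (ker d1 \<inter> ker d2)\<close>, which is symmetric.\<close>

lemma double_complex_step:
  fixes s :: "'k::field \<Rightarrow> 'v::ab_group_add \<Rightarrow> 'v"
  assumes d1: "Vector_Spaces.linear s s d1" and d2: "Vector_Spaces.linear s s d2"
    and e1: "Vector_Spaces.linear s s e1" and e2: "Vector_Spaces.linear s s e2"
    and A: "module.subspace s A" "fin_span s A"
    and comm: "\<And>x. x \<in> A \<Longrightarrow> e1 (d2 x) = e2 (d1 x)"
  shows "vector_space.dim s {y \<in> d2 ` A. e1 y = 0} + vector_space.dim s (d1 ` {x\<in>A. d2 x = 0})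
    = vector_space.dim s {y \<in> d1 ` A. e2 y = 0} + vector_space.dim s (d2 ` {x\<in>A. d1 x = 0})"
proof -
  interpret d1: Vector_Spaces.linear s s d1 by fact
  interpret d2: Vector_Spaces.linear s s d2 by fact
  interpret e1: Vector_Spaces.linear s s e1 by fact
  interpret e2: Vector_Spaces.linear s s e2 by fact
  let ?X = "{x\<in>A. e1 (d2 x) = 0}" and ?K1 = "{x\<in>A. d1 x = 0}" and ?K2 = "{x\<in>A. d2 x = 0}"
  let ?K = "{x\<in>A. d1 x = 0 \<and> d2 x = 0}"
  have sub: "d1.vs1.subspace ?X" "d1.vs1.subspace ?K1" "d1.vs1.subspace ?K2"
    using A(1) by (auto simp: d1.vs1.subspace_def d1.add d2.add e1.add d1.scale d2.scale e1.scale)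
  have fin: "fin_span s ?X" "fin_span s ?K1" "fin_span s ?K2"
    using fin_span_mono[OF A(2)] by auto
  have i1: "{y \<in> d2 ` A. e1 y = 0} = d2 ` ?X" by auto
  have i2: "{y \<in> d1 ` A. e2 y = 0} = d1 ` ?X" using comm by auto
  have k2: "{x\<in>?X. d2 x = 0} = ?K2" by auto
  have k1: "{x\<in>?X. d1 x = 0} = ?K1" using comm by auto
  have kk: "{x\<in>?K1. d2 x = 0} = ?K" "{x\<in>?K2. d1 x = 0} = ?K" by auto
  show ?thesis
    using rank_nullity[OF d2 sub(1) fin(1)] rank_nullity[OF d1 sub(1) fin(1)]
      rank_nullity[OF d2 sub(2) fin(2)] rank_nullity[OF d1 sub(3) fin(3)]
    unfolding i1 i2 k1 k2 kk by linarith
qed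

text \<open>A differential carries the indices of its target, hence \<open>p - 1\<close> for the one
  that leaves position \<open>p\<close>. At \<open>p = 0\<close> there is nowhere to go and every
  element is a cycle.\<close>

definition row_cycles :: "(nat \<Rightarrow> nat \<Rightarrow> 'v set) \<Rightarrow> (nat \<Rightarrow> nat \<Rightarrow> 'v \<Rightarrow> 'v::zero) \<Rightarrow> nat \<Rightarrow> nat \<Rightarrow> 'v set" where
  "row_cycles C d p q = (if p = 0 then C p q else {x \<in> C p q. d (p - 1) q x = 0})"

definition col_cycles :: "(nat \<Rightarrow> nat \<Rightarrow> 'v set) \<Rightarrow> (nat \<Rightarrow> nat \<Rightarrow> 'v \<Rightarrow> 'v::zero) \<Rightarrow> nat \<Rightarrow> nat \<Rightarrow> 'v set" where
  "col_cycles C d p q = (if q = 0 then C p q else {x \<in> C p q. d p (q - 1) x = 0})"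

text \<open>\<open>W p q\<close> counts the elements that are cycles in both directions, modulo the
  image of the composite differential. Exactness away from the edges and
  \<open>double_complex_step\<close> make it constant along antidiagonals. On row 0 the column
  condition is void and the columns are onto, so \<open>W n 0\<close> is the homology dimension of
  the bottom row; likewise \<open>W 0 n\<close> for column 0.\<close>

lemma double_complex_edges:
  fixes s :: "'k::field \<Rightarrow> 'v::ab_group_add \<Rightarrow> 'v" and C :: "nat \<Rightarrow> nat \<Rightarrow> 'v set"
  assumes d1: "\<And>p q. Vector_Spaces.linear s s (d1 p q)" and d2: "\<And>p q. Vector_Spaces.linear s s (d2 p q)"
    and C: "\<And>p q. module.subspace s (C p q)" "\<And>p q. fin_span s (C p q)"
    and comm: "\<And>p q x. x \<in> C (Suc p) (Suc q) \<Longrightarrow> d1 p q (d2 (Suc p) q x) = d2 p q (d1 p (Suc q) x)"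
    and rows: "\<And>p q. q > 0 \<Longrightarrow> d1 p q ` C (Suc p) q = row_cycles C d1 p q"
    and cols: "\<And>p q. p > 0 \<Longrightarrow> d2 p q ` C p (Suc q) = col_cycles C d2 p q"
  shows "int (vector_space.dim s (row_cycles C d1 n 0)) - int (vector_space.dim s (d1 n 0 ` C (Suc n) 0))
    = int (vector_space.dim s (col_cycles C d2 0 n)) - int (vector_space.dim s (d2 0 n ` C 0 (Suc n)))"
proof -
  interpret d0: Vector_Spaces.linear s s "d1 0 0" by fact
  define W where "W p q = int (d0.vs1.dim (row_cycles C d1 p q \<inter> col_cycles C d2 p q))
    - int (d0.vs1.dim (d1 p q ` d2 (Suc p) q ` C (Suc p) (Suc q)))" for p q
  have step: "W (Suc p) q = W p (Suc q)" for p q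
  proof -
    let ?A = "C (Suc p) (Suc q)"
    have "row_cycles C d1 (Suc p) q \<inter> col_cycles C d2 (Suc p) q = {y \<in> d2 (Suc p) q ` ?A. d1 p q y = 0}"
      using cols[of "Suc p" q] by (auto simp: row_cycles_def col_cycles_def split: if_splits)
    moreover have "row_cycles C d1 p (Suc q) \<inter> col_cycles C d2 p (Suc q) = {y \<in> d1 p (Suc q) ` ?A. d2 p q y = 0}"
      using rows[of "Suc q" p] by (auto simp: row_cycles_def col_cycles_def split: if_splits)
    \<comment> \<open>Commuting the two differentials puts the row boundary first, and exactness of
      row \<open>Suc q\<close> turns it into a row kernel.\<close>
    moreover have "d1 (Suc p) q ` d2 (Suc (Suc p)) q ` C (Suc (Suc p)) (Suc q) = d2 (Suc p) q ` {x\<in>?A. d1 p (Suc q) x = 0}"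
    proof -
      have "d1 (Suc p) q ` d2 (Suc (Suc p)) q ` C (Suc (Suc p)) (Suc q) =
         d2 (Suc p) q ` d1 (Suc p) (Suc q) ` C (Suc (Suc p)) (Suc q)"
        unfolding image_image using comm by (intro image_cong) auto
      then show ?thesis using rows[of "Suc q" "Suc p"] by (simp add: row_cycles_def)
    qed
    moreover have "d1 p (Suc q) ` d2 (Suc p) (Suc q) ` C (Suc p) (Suc (Suc q)) = d1 p (Suc q) ` {x\<in>?A. d2 (Suc p) q x = 0}"
      using cols[of "Suc p" "Suc q"] by (simp add: col_cycles_def)
    moreover have "d0.vs1.dim {y \<in> d2 (Suc p) q ` ?A. d1 p q y = 0} + d0.vs1.dim (d1 p (Suc q) ` {x\<in>?A. d2 (Suc p) q x = 0})
      = d0.vs1.dim {y \<in> d1 p (Suc q) ` ?A. d2 p q y = 0} + d0.vs1.dim (d2 (Suc p) q ` {x\<in>?A. d1 p (Suc q) x = 0})"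
      by (rule double_complex_step[OF d1 d2 d1 d2 C]) (rule comm)
    ultimately show ?thesis
      unfolding W_def by presburger
  qed
  have "W (n - l) l = W n 0" if "l \<le> n" for l
    using that
  proof (induction l)
    case (Suc l)
    then have "W (n - l) l = W (n - Suc l) (Suc l)" using step[of "n - Suc l" l] by (simp add: Suc_diff_Suc)
    then show ?case using Suc by simp
  qed simp
  from this[of n] have "W 0 n = W n 0" by simp
  moreover have "W n 0 = int (d0.vs1.dim (row_cycles C d1 n 0)) - int (d0.vs1.dim (d1 n 0 ` C (Suc n) 0))"
  proof -
    have "row_cycles C d1 n 0 \<inter> col_cycles C d2 n 0 = row_cycles C d1 n 0" by (auto simp: row_cycles_def col_cycles_def split: if_splits)
    moreover have "d2 (Suc n) 0 ` C (Suc n) (Suc 0) = C (Suc n) 0" using cols[of "Suc n" 0] by (simp add: col_cycles_def)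
    ultimately show ?thesis by (simp add: W_def)
  qed
  moreover have "W 0 n = int (d0.vs1.dim (col_cycles C d2 0 n)) - int (d0.vs1.dim (d2 0 n ` C 0 (Suc n)))"
  proof -
    have "row_cycles C d1 0 n \<inter> col_cycles C d2 0 n = col_cycles C d2 0 n" by (auto simp: row_cycles_def col_cycles_def split: if_splits)
    moreover have "d1 0 n ` d2 (Suc 0) n ` C (Suc 0) (Suc n) = d2 0 n ` d1 0 (Suc n) ` C (Suc 0) (Suc n)"
      unfolding image_image using comm by (intro image_cong) auto
    moreover have "d1 0 (Suc n) ` C (Suc 0) (Suc n) = C 0 (Suc n)" using rows[of "Suc n" 0] by (simp add: row_cycles_def)
    ultimately show ?thesis by (simp add: W_def)
  qed
  ultimately show ?thesis by simp
qed

section \<open>Cohomology of simplicial complexes\<close>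

definition fscale :: "'k::field \<Rightarrow> ('i \<Rightarrow> 'k) \<Rightarrow> 'i \<Rightarrow> 'k" where
  "fscale c f = (\<lambda>i. c * f i)"

interpretation fv: vector_space "fscale :: 'k::field \<Rightarrow> ('i \<Rightarrow> 'k) \<Rightarrow> 'i \<Rightarrow> 'k"
  by unfold_locales (auto simp: fscale_def fun_eq_iff algebra_simps)

lemma fscale_apply [simp]: "fscale c f i = c * f i"
  by (simp add: fscale_def)

lemma fin_span_subset: "finite B \<Longrightarrow> V \<subseteq> module.span s B \<Longrightarrow> fin_span s V"
  unfolding fin_span_def by blast

text \<open>Cochains are functions on the whole type, restricted by their support. Cochains of
  different families thus lie in one vector space and can be compared and subtracted.\<close>

definition fsupp :: "'i set \<Rightarrow> ('i \<Rightarrow> 'k::field) set" where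
  "fsupp S = {f. \<forall>i. i \<notin> S \<longrightarrow> f i = 0}"

lemma subspace_fsupp: "fv.subspace (fsupp S)"
  by (auto simp: fv.subspace_def fsupp_def)

lemma sum_fun_apply: "(\<Sum>i\<in>S. f i) x = (\<Sum>i\<in>S. f i x)"
  by (induction S rule: infinite_finite_induct) auto

lemma fsupp_basis:
  assumes "finite S"
  defines "B \<equiv> (\<lambda>i j. if i = j then 1 else 0 :: 'k::field) ` S"
  shows "B \<subseteq> fsupp S" "fsupp S \<subseteq> fv.span B" "fv.independent B" "card B = card S"
proof -
  let ?d = "\<lambda>i j. if i = j then 1 else 0 :: 'k"
  have inj: "inj_on ?d S" by (auto simp: inj_on_def fun_eq_iff)
  show "B \<subseteq> fsupp S" by (auto simp: B_def fsupp_def)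
  show "card B = card S" unfolding B_def by (rule card_image[OF inj])
  have ev: "(\<Sum>i\<in>S. fscale (u i) (?d i)) j = (if j \<in> S then u j else 0)" for u j
  proof -
    have "(\<Sum>i\<in>S. fscale (u i) (?d i)) j = (\<Sum>i\<in>S. if i = j then u i else 0)"
      unfolding sum_fun_apply by (rule sum.cong) auto
    then show ?thesis using assms(1) by simp
  qed
  show "fsupp S \<subseteq> fv.span B"
  proof
    fix f :: "'a \<Rightarrow> 'k" assume "f \<in> fsupp S"
    then have "f = (\<Sum>i\<in>S. fscale (f i) (?d i))"
      using ev[of f] by (intro ext) (auto simp: fsupp_def)
    then show "f \<in> fv.span B"
      by (metis (no_types, lifting) B_def fv.span_base fv.span_scale fv.span_sum imageI)
  qed
  show "fv.independent B"
  proof (rule fv.independent_if_scalars_zero)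
    show "finite B" using assms by simp
    fix u x assume z: "(\<Sum>x\<in>B. fscale (u x) x) = 0" and "x \<in> B"
    then obtain i where i: "i \<in> S" "x = ?d i" by (auto simp: B_def)
    have "(\<Sum>i\<in>S. fscale (u (?d i)) (?d i)) = 0"
      using z inj by (simp add: B_def sum.reindex)
    then have "(\<Sum>i\<in>S. fscale (u (?d i)) (?d i)) i = 0" by simp
    then show "u x = 0" unfolding ev using i by simp
  qed
qed

lemma dim_fsupp: "finite S \<Longrightarrow> fv.dim (fsupp S :: ('i \<Rightarrow> 'k::field) set) = card S"
  using fsupp_basis[of S, where 'k='k] by (intro fv.dim_unique) auto

lemma fin_span_fsupp: "finite S \<Longrightarrow> fin_span fscale (fsupp S)"
  using fsupp_basis(2)[of S] by (rule_tac fin_span_subset) auto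

text \<open>The incidence sign: the exponent counts the elements that \<open>l\<close> passes on its
  way to its place in increasing order. The inequality is strict, so the sign is the same whether or
  not \<open>l\<close> belongs to \<open>A\<close>.\<close>

definition sgn_ins :: "nat \<Rightarrow> nat set \<Rightarrow> 'k::field" where
  "sgn_ins l A = (-1) ^ card {a \<in> A. a < l}"

lemma sgn_ins_square [simp]: "sgn_ins l A * sgn_ins l A = (1 :: 'k::field)"
  by (simp add: sgn_ins_def flip: power_mult_distrib)

lemma sgn_ins_insert:
  assumes "finite A" "r \<notin> A"
  shows "sgn_ins l (insert r A) = (if r < l then - sgn_ins l A else sgn_ins l A :: 'k::field)"
proof -
  have "{a \<in> insert r A. a < l} = (if r < l then insert r {a\<in>A. a < l} else {a\<in>A. a < l})" by auto
  then show ?thesis using assms by (simp add: sgn_ins_def)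
qed

text \<open>Exactly one of \<open>l < r\<close> and \<open>r < l\<close> holds, so inserting the
  other element first changes exactly one of the two signs. This antisymmetry makes both the
  coboundary and the Koszul differential square to zero.\<close>

lemma sgn_ins_swap:
  assumes "finite A" "l \<notin> A" "r \<notin> A" "l \<noteq> r"
  shows "sgn_ins l A * sgn_ins r (insert l A) = - (sgn_ins r A * sgn_ins l (insert r A) :: 'k::field)"
  using assms by (auto simp: sgn_ins_insert)

text \<open>The truncated coboundary makes sense for any family of sets, in particular for a difference
  of two complexes. The degree of a set is its cardinality, so \<open>hcoh\<close> in degree \<open>c\<close> is the reduced
  cohomology in degree \<open>c - 1\<close>.\<close>

definition cob :: "nat set set \<Rightarrow> (nat set \<Rightarrow> 'k::field) \<Rightarrow> nat set \<Rightarrow> 'k" where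
  "cob \<Phi> f \<tau> = (if \<tau> \<in> \<Phi> then \<Sum>l\<in>\<tau>. sgn_ins l (\<tau> - {l}) * f (\<tau> - {l}) else 0)"

definition layer :: "nat set set \<Rightarrow> nat \<Rightarrow> nat set set" where
  "layer \<Phi> c = {\<tau> \<in> \<Phi>. card \<tau> = c}"

definition cocycles :: "nat set set \<Rightarrow> nat \<Rightarrow> (nat set \<Rightarrow> 'k::field) set" where
  "cocycles \<Phi> c = {f \<in> fsupp (layer \<Phi> c). cob \<Phi> f = 0}"

definition coboundaries :: "nat set set \<Rightarrow> nat \<Rightarrow> (nat set \<Rightarrow> 'k::field) set" where
  "coboundaries \<Phi> c = (if c = 0 then {0} else cob \<Phi> ` fsupp (layer \<Phi> (c - 1)))"

text \<open>An integer difference in place of a quotient dimension, so that long exact sequences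
  turn into additions. That it is not negative holds for complexes (\<open>hcoh_nonneg\<close>) and
  drives several arguments below.\<close>

definition hcoh :: "'k::field itself \<Rightarrow> nat set set \<Rightarrow> nat \<Rightarrow> int" where
  "hcoh _ \<Phi> c = int (fv.dim (cocycles \<Phi> c :: (nat set \<Rightarrow> 'k) set))
     - int (fv.dim (coboundaries \<Phi> c :: (nat set \<Rightarrow> 'k) set))"

definition cplx :: "nat set set \<Rightarrow> bool" where
  "cplx \<Phi> \<longleftrightarrow> finite \<Phi> \<and> (\<forall>\<tau>\<in>\<Phi>. finite \<tau> \<and> Pow \<tau> \<subseteq> \<Phi>)"

lemma cob_add: "cob \<Phi> (f + g) = cob \<Phi> f + cob \<Phi> g"
  by (auto simp: cob_def fun_eq_iff distrib_left sum.distrib)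

lemma cob_scale: "cob \<Phi> (fscale c f) = fscale c (cob \<Phi> f)"
  by (auto simp: cob_def fun_eq_iff sum_distrib_left intro!: sum.cong)

lemma linear_cob: "Vector_Spaces.linear fscale fscale (cob \<Phi> :: (nat set \<Rightarrow> 'k::field) \<Rightarrow> _)"
  using fv.vector_space_axioms by (auto simp: Vector_Spaces.linear_iff cob_add cob_scale)

lemma subspace_cocycles: "fv.subspace (cocycles \<Phi> c)"
proof -
  interpret Vector_Spaces.linear fscale fscale "cob \<Phi>" by (rule linear_cob)
  show ?thesis using subspace_fsupp[of "layer \<Phi> c"]
    by (auto simp: fv.subspace_def cocycles_def cob_add cob_scale zero)
qed

lemma subspace_coboundaries: "fv.subspace (coboundaries \<Phi> c)"
proof -
  interpret Vector_Spaces.linear fscale fscale "cob \<Phi>" by (rule linear_cob)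
  show ?thesis using subspace_image[OF subspace_fsupp] by (auto simp: coboundaries_def fv.subspace_single_0)
qed

lemma cob_layer:
  assumes "\<forall>\<tau>\<in>\<Phi>. finite \<tau>" "f \<in> fsupp (layer \<Phi> c)"
  shows "cob \<Phi> f \<in> fsupp (layer \<Phi> (Suc c))"
proof -
  have "cob \<Phi> f \<tau> = 0" if "\<tau> \<notin> layer \<Phi> (Suc c)" for \<tau>
  proof (cases "\<tau> \<in> \<Phi>")
    case True
    then have "\<tau> - {l} \<notin> layer \<Phi> c" if "l \<in> \<tau>" for l
      using that \<open>\<tau> \<notin> layer \<Phi> (Suc c)\<close> assms(1) card_Suc_Diff1[of \<tau> l] by (auto simp: layer_def)
    then show ?thesis using assms(2) by (auto simp: cob_def fsupp_def intro!: sum.neutral)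
  qed (simp add: cob_def)
  then show ?thesis by (auto simp: fsupp_def)
qed

lemma finite_layer: "finite \<Phi> \<Longrightarrow> finite (layer \<Phi> c)"
  by (simp add: layer_def)

lemma fin_span_cocycles: "finite \<Phi> \<Longrightarrow> fin_span fscale (cocycles \<Phi> c)"
  by (rule fin_span_mono[OF fin_span_fsupp[OF finite_layer]]) (auto simp: cocycles_def)

lemma fin_span_coboundaries: "finite \<Phi> \<Longrightarrow> fin_span fscale (coboundaries \<Phi> c)"
  using fin_span_image[OF linear_cob fin_span_fsupp[OF finite_layer]] fin_span_subset[of "{}" "{0}" fscale]
  by (auto simp: coboundaries_def)

text \<open>Swapping the indices only shows that the sum equals its own negative, which says nothing
  in characteristic 2. The induction cancels the terms in pairs instead.\<close>

lemma antisym_sum_eq_0: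
  fixes f :: "nat \<Rightarrow> nat \<Rightarrow> 'a::ab_group_add"
  assumes "finite A" "\<And>l r. l \<in> A \<Longrightarrow> r \<in> A \<Longrightarrow> l \<noteq> r \<Longrightarrow> f l r = - f r l"
  shows "(\<Sum>l\<in>A. \<Sum>r\<in>A - {l}. f l r) = 0"
  using assms
proof (induction A rule: finite_induct)
  case (insert a A)
  have IH: "(\<Sum>l\<in>A. \<Sum>r\<in>A - {l}. f l r) = 0"
    by (rule insert.IH) (rule insert.prems; simp)
  have "(\<Sum>l\<in>insert a A. \<Sum>r\<in>insert a A - {l}. f l r)
      = (\<Sum>r\<in>A. f a r) + (\<Sum>l\<in>A. \<Sum>r\<in>insert a (A - {l}). f l r)"
    using insert(1,2) by (simp add: insert_Diff_if) (rule sum.cong, auto simp: insert_Diff_if)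
  also have "(\<Sum>l\<in>A. \<Sum>r\<in>insert a (A - {l}). f l r) = (\<Sum>l\<in>A. f l a + (\<Sum>r\<in>A - {l}. f l r))"
    using insert(1,2) by (intro sum.cong) auto
  also have "\<dots> = (\<Sum>l\<in>A. f l a)" by (simp add: sum.distrib IH)
  also have "(\<Sum>r\<in>A. f a r) = (\<Sum>r\<in>A. - f r a)"
    by (rule sum.cong[OF refl], rule insert.prems) (use insert(2) in auto)
  finally show ?case by (simp add: sum_negf)
qed simp

lemma cob_cob:
  assumes "cplx \<Phi>"
  shows "cob \<Phi> (cob \<Phi> f) = (0 :: nat set \<Rightarrow> 'k::field)"
proof
  fix \<tau>
  show "cob \<Phi> (cob \<Phi> f) \<tau> = 0 \<tau>"
  proof (cases "\<tau> \<in> \<Phi>")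
    case True
    then have fin: "finite \<tau>" and sub: "\<And>l. \<tau> - {l} \<in> \<Phi>" using assms by (auto simp: cplx_def)
    define g :: "nat \<Rightarrow> nat \<Rightarrow> 'k" where
      "g l r = sgn_ins l (\<tau> - {l}) * (sgn_ins r (\<tau> - {l} - {r}) * f (\<tau> - {l} - {r}))" for l r
    have "cob \<Phi> (cob \<Phi> f) \<tau> = (\<Sum>l\<in>\<tau>. \<Sum>r\<in>\<tau> - {l}. g l r)"
      using True sub by (simp add: cob_def g_def sum_distrib_left)
    also have "\<dots> = 0"
    proof (rule antisym_sum_eq_0[OF fin])
      fix l r assume lr: "l \<in> \<tau>" "r \<in> \<tau>" "l \<noteq> r"
      let ?A = "\<tau> - {l} - {r}"
      have e: "\<tau> - {l} = insert r ?A" "\<tau> - {r} = insert l ?A" "\<tau> - {r} - {l} = ?A" using lr by auto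
      have "sgn_ins r ?A * sgn_ins l (insert r ?A) = - (sgn_ins l ?A * sgn_ins r (insert l ?A) :: 'k)"
        using lr fin by (intro sgn_ins_swap) auto
      moreover have "g l r = sgn_ins r ?A * sgn_ins l (insert r ?A) * f ?A"
        unfolding g_def by (subst e(1)) (simp only: ac_simps)
      moreover have "g r l = sgn_ins l ?A * sgn_ins r (insert l ?A) * f ?A"
        unfolding g_def e(3) by (subst e(2)) (simp only: ac_simps)
      ultimately show "g l r = - g r l" by (simp only: mult_minus_left)
    qed
    finally show ?thesis by simp
  qed (simp add: cob_def)
qed

lemma coboundaries_subset_cocycles:
  assumes "cplx \<Phi>"
  shows "coboundaries \<Phi> c \<subseteq> (cocycles \<Phi> c :: (nat set \<Rightarrow> 'k::field) set)"
proof (cases "c = 0")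
  case True
  then show ?thesis using fv.subspace_0[OF subspace_cocycles] by (auto simp: coboundaries_def)
next
  case False
  then show ?thesis using cob_cob[OF assms] cob_layer[of \<Phi> _ "c - 1"] assms
    by (auto simp: coboundaries_def cocycles_def cplx_def)
qed

lemma dim_mono_fin:
  assumes "vector_space s" "module.subspace s W" "fin_span s W" "V \<subseteq> W"
  shows "vector_space.dim s V \<le> vector_space.dim s W"
proof -
  interpret vs: vector_space s by fact
  obtain B where "B \<subseteq> W" "vs.span B = W" "finite B" "card B = vs.dim W"
    using fin_span_basis[OF assms(1-3)] by metis
  then show ?thesis using vs.dim_le_card[of V B] assms(4) by simp
qed

lemma hcoh_nonneg:
  assumes "cplx \<Phi>"
  shows "hcoh TYPE('k::field) \<Phi> c \<ge> 0"
proof -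
  have "finite \<Phi>" using assms by (simp add: cplx_def)
  then show ?thesis
    using dim_mono_fin[OF fv.vector_space_axioms subspace_cocycles fin_span_cocycles
      coboundaries_subset_cocycles[OF assms], of c] by (simp add: hcoh_def)
qed

lemma linear_restrict:
  "Vector_Spaces.linear fscale fscale (\<lambda>f i. if i \<in> S then f i else (0 :: 'k::field))"
  using fv.vector_space_axioms by (auto simp: Vector_Spaces.linear_iff fun_eq_iff)

text \<open>The family falls into pairs of \<open>\<tau>\<close> and \<open>insert a \<tau>\<close>,
  and evaluating \<open>f\<close> at \<open>insert a \<tau>\<close> is the contracting homotopy of a
  cone with apex \<open>a\<close>. It is stated for families of sets because it is applied to
  differences of two complexes.\<close>

lemma toggle_acyclic:
  assumes fin: "\<forall>\<tau>\<in>\<Psi>. finite \<tau>"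
    and tog: "\<And>\<tau>. \<tau> \<in> \<Psi> \<Longrightarrow> insert a \<tau> \<in> \<Psi> \<and> \<tau> - {a} \<in> \<Psi>"
    and f: "f \<in> cocycles \<Psi> c"
  shows "f \<in> (coboundaries \<Psi> c :: (nat set \<Rightarrow> 'k::field) set)"
proof (cases "c = 0")
  case True
  \<comment> \<open>In degree 0 only the zero cochain is a coboundary, so \<open>f\<close> itself
    has to vanish. Its value at the empty set is read off from the cocycle condition at
    \<open>{a}\<close>.\<close>
  have "f \<tau> = 0" for \<tau>
  proof (rule ccontr)
    assume "f \<tau> \<noteq> 0"
    then have "\<tau> \<in> \<Psi>" "card \<tau> = 0" using f True by (auto simp: cocycles_def fsupp_def layer_def)
    then have "\<tau> = {}" "{} \<in> \<Psi>" using fin by auto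
    then have "{a} \<in> \<Psi>" using tog[of "{}"] by simp
    have "cob \<Psi> f {a} = 0" using f by (simp add: cocycles_def)
    then show False using \<open>{a} \<in> \<Psi>\<close> \<open>f \<tau> \<noteq> 0\<close> \<open>\<tau> = {}\<close> by (simp add: cob_def sgn_ins_def)
  qed
  then show ?thesis using True by (auto simp: coboundaries_def)
next
  case c0: False
  define h where "h \<tau> = (if a \<in> \<tau> then 0 else sgn_ins a \<tau> * f (insert a \<tau>))" for \<tau>
  have fs: "f \<tau> = 0" if "\<tau> \<notin> \<Psi> \<or> card \<tau> \<noteq> c" for \<tau>
    using f that by (auto simp: cocycles_def fsupp_def layer_def)
  have h: "h \<in> fsupp (layer \<Psi> (c - 1))"
  proof -
    have "h \<tau> = 0" if n: "\<tau> \<notin> layer \<Psi> (c - 1)" for \<tau>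
    proof (cases "a \<notin> \<tau> \<and> insert a \<tau> \<in> \<Psi>")
      case True
      then have "\<tau> \<in> \<Psi>" using tog[of "insert a \<tau>"] by (metis Diff_insert_absorb)
      then have "card (insert a \<tau>) = Suc (card \<tau>)" using fin True by simp
      then have "card (insert a \<tau>) \<noteq> c" using n \<open>\<tau> \<in> \<Psi>\<close> c0 by (auto simp: layer_def)
      then show ?thesis using fs[of "insert a \<tau>"] by (simp add: h_def)
    qed (auto simp: h_def fs)
    then show ?thesis by (auto simp: fsupp_def)
  qed
  have "cob \<Psi> h \<tau> = f \<tau>" for \<tau>
  proof (cases "\<tau> \<in> \<Psi>")
    case False
    then show ?thesis by (simp add: cob_def fs)
  next
    case \<tau>: True
    then have ft: "finite \<tau>" using fin by blast
    show ?thesis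
    proof (cases "a \<in> \<tau>")
      case True
      \<comment> \<open>Since \<open>h\<close> vanishes on the sets that contain \<open>a\<close>,
        only the summand that removes \<open>a\<close> survives.\<close>
      have "cob \<Psi> h \<tau> = (\<Sum>l\<in>\<tau>. if l = a then f \<tau> else 0)"
        unfolding cob_def using True \<tau>
        by (auto simp: h_def insert_absorb mult.assoc[symmetric] intro!: sum.cong)
      then show ?thesis using ft True by simp
    next
      case False
      let ?t = "insert a \<tau>"
      have it: "?t \<in> \<Psi>" using tog \<tau> by blast
      \<comment> \<open>The cocycle condition at \<open>insert a \<tau>\<close> expresses
        \<open>f \<tau>\<close> by the values of \<open>f\<close> at sets that contain
        \<open>a\<close>, which are the values entering \<open>h\<close>.\<close>
      have "0 = cob \<Psi> f ?t" using f by (simp add: cocycles_def)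
      also have "\<dots> = sgn_ins a \<tau> * f \<tau> + (\<Sum>l\<in>\<tau>. sgn_ins l (?t - {l}) * f (?t - {l}))"
        using it ft False by (simp add: cob_def)
      finally have "sgn_ins a \<tau> * f \<tau> = - (\<Sum>l\<in>\<tau>. sgn_ins l (?t - {l}) * f (?t - {l}))"
        by (simp add: eq_neg_iff_add_eq_0)
      then have "sgn_ins a \<tau> * (sgn_ins a \<tau> * f \<tau>) = sgn_ins a \<tau> * - (\<Sum>l\<in>\<tau>. sgn_ins l (?t - {l}) * f (?t - {l}))"
        by (rule arg_cong)
      then have z: "f \<tau> = - (\<Sum>l\<in>\<tau>. sgn_ins a \<tau> * (sgn_ins l (?t - {l}) * f (?t - {l})))"
        by (simp only: mult.assoc[symmetric] sgn_ins_square mult_1_left mult_minus_right sum_distrib_left)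
      have "cob \<Psi> h \<tau> = (\<Sum>l\<in>\<tau>. sgn_ins l (\<tau> - {l}) * (sgn_ins a (\<tau> - {l}) * f (insert a (\<tau> - {l}))))"
        using \<tau> False by (simp add: cob_def h_def)
      also have "\<dots> = (\<Sum>l\<in>\<tau>. - (sgn_ins a \<tau> * (sgn_ins l (?t - {l}) * f (?t - {l}))))"
      proof (rule sum.cong[OF refl])
        fix l assume l: "l \<in> \<tau>"
        let ?r = "\<tau> - {l}"
        have e: "?t - {l} = insert a ?r" using l False by auto
        have "sgn_ins l ?r * sgn_ins a (insert l ?r) = - (sgn_ins a ?r * sgn_ins l (insert a ?r) :: 'k)"
          using l False ft by (intro sgn_ins_swap) auto
        moreover have "insert l ?r = \<tau>" using l by auto
        ultimately have *: "sgn_ins l ?r * sgn_ins a \<tau> = - (sgn_ins a ?r * sgn_ins l (insert a ?r) :: 'k)" by simp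
        \<comment> \<open>Signs square to 1, so the factor \<open>sgn_ins a \<tau>\<close> may be
          inserted twice to bring in the swap identity.\<close>
        have "sgn_ins l ?r * sgn_ins a ?r
          = (sgn_ins l ?r * sgn_ins a \<tau>) * (sgn_ins a \<tau> * sgn_ins a ?r :: 'k)"
          by (metis (no_types) mult.assoc mult.left_neutral sgn_ins_square)
        also have "\<dots> = - (sgn_ins a \<tau> * sgn_ins l (insert a ?r)) * (sgn_ins a ?r * sgn_ins a ?r)"
          unfolding * by (simp only: ac_simps mult_minus_left mult_minus_right)
        finally have "sgn_ins l ?r * sgn_ins a ?r = - (sgn_ins a \<tau> * sgn_ins l (insert a ?r) :: 'k)" by simp
        then show "sgn_ins l ?r * (sgn_ins a ?r * f (insert a ?r)) = - (sgn_ins a \<tau> * (sgn_ins l (?t - {l}) * f (?t - {l})))"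
          unfolding e by (simp add: mult.assoc[symmetric])
      qed
      also have "\<dots> = f \<tau>" using z by (simp add: sum_negf)
      finally show ?thesis .
    qed
  qed
  then have "f = cob \<Psi> h" by auto
  then show ?thesis using h c0 by (auto simp: coboundaries_def)
qed

text \<open>Restriction of cochains to a subcomplex is a cochain map, because the faces of its
  members are again members.\<close>

lemma restrict_cob:
  assumes "cplx \<Phi>" "cplx X" "\<Phi> \<subseteq> X"
  shows "cob \<Phi> (\<lambda>\<tau>. if \<tau> \<in> \<Phi> then f \<tau> else 0) = (\<lambda>\<tau>. if \<tau> \<in> \<Phi> then cob X f \<tau> else 0)"
proof
  fix \<tau>
  have "\<tau> - {l} \<in> \<Phi>" if "\<tau> \<in> \<Phi>" for l using assms(1) that by (auto simp: cplx_def)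
  then show "cob \<Phi> (\<lambda>\<tau>. if \<tau> \<in> \<Phi> then f \<tau> else 0) \<tau> = (if \<tau> \<in> \<Phi> then cob X f \<tau> else 0)"
    using assms(3) by (auto simp: cob_def)
qed

lemma restrict_fsupp:
  assumes "\<Phi> \<subseteq> X"
  shows "(\<lambda>f \<tau>. if \<tau> \<in> \<Phi> then f \<tau> else 0) ` fsupp (layer X c) = (fsupp (layer \<Phi> c) :: (nat set \<Rightarrow> 'k::field) set)"
proof (intro equalityI subsetI)
  fix f :: "nat set \<Rightarrow> 'k" assume f: "f \<in> fsupp (layer \<Phi> c)"
  then have "f = (\<lambda>\<tau>. if \<tau> \<in> \<Phi> then f \<tau> else 0)" by (auto simp: fsupp_def layer_def)
  moreover have "f \<in> fsupp (layer X c)" using f assms by (auto simp: fsupp_def layer_def)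
  ultimately show "f \<in> (\<lambda>f \<tau>. if \<tau> \<in> \<Phi> then f \<tau> else 0) ` fsupp (layer X c)" by blast
qed (auto simp: fsupp_def layer_def)

text \<open>Cochains that vanish on the subcomplex form the relative cochain complex. Its
  differential is the truncated coboundary of the family \<open>X - \<Phi>\<close>, to which
  \<open>toggle_acyclic\<close> applies.\<close>

lemma cob_upper:
  assumes "cplx \<Phi>" "\<Phi> \<subseteq> X" "\<And>\<tau>. \<tau> \<in> \<Phi> \<Longrightarrow> f \<tau> = 0"
  shows "cob X f = cob (X - \<Phi>) f"
proof
  fix \<tau>
  have "\<tau> - {l} \<in> \<Phi>" if "\<tau> \<in> \<Phi>" for l using assms(1) that by (auto simp: cplx_def)
  then have "\<tau> \<in> \<Phi> \<Longrightarrow> cob X f \<tau> = 0" using assms(3) by (simp add: cob_def)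
  then show "cob X f \<tau> = cob (X - \<Phi>) f \<tau>" by (auto simp: cob_def)
qed

text \<open>The long exact sequence of the pair \<open>(X, \<Phi>)\<close> when the relative cochain complex is acyclic.\<close>

lemma hcoh_toggle:
  assumes \<Phi>: "cplx \<Phi>" and X: "cplx X" and sub: "\<Phi> \<subseteq> X"
    and tog: "\<And>\<tau>. \<tau> \<in> X - \<Phi> \<Longrightarrow> insert a \<tau> \<in> X - \<Phi> \<and> \<tau> - {a} \<in> X - \<Phi>"
  shows "hcoh TYPE('k::field) X c = hcoh TYPE('k) \<Phi> c"
proof -
  define r :: "(nat set \<Rightarrow> 'k) \<Rightarrow> nat set \<Rightarrow> 'k" where "r f = (\<lambda>\<tau>. if \<tau> \<in> \<Phi> then f \<tau> else 0)" for f
  have lin: "Vector_Spaces.linear fscale fscale r"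
    using linear_restrict[of \<Phi>] by (simp add: r_def[abs_def])
  interpret r: Vector_Spaces.linear fscale fscale r by (rule lin)
  interpret cX: Vector_Spaces.linear fscale fscale "cob X :: (nat set \<Rightarrow> 'k) \<Rightarrow> _" by (rule linear_cob)
  have finX: "finite X" "\<forall>\<tau>\<in>X. finite \<tau>" using X by (auto simp: cplx_def)
  let ?P = "X - \<Phi>"
  have rc: "cob \<Phi> (r f) = r (cob X f)" for f unfolding r_def using restrict_cob[OF \<Phi> X sub] .
  have r0: "r f = 0 \<longleftrightarrow> (\<forall>\<tau>\<in>\<Phi>. f \<tau> = 0)" for f by (auto simp: r_def fun_eq_iff)
  have up: "cob X f = cob ?P f" if "r f = 0" for f using cob_upper[OF \<Phi> sub] that r0 by blast
  have sp: "r f = 0 \<Longrightarrow> f \<in> fsupp (layer X d) \<longleftrightarrow> f \<in> fsupp (layer ?P d)" for f d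
    using r0 by (auto simp: fsupp_def layer_def)
  have sp0: "f \<in> fsupp (layer ?P d) \<Longrightarrow> r f = 0" for f d
    using r0 by (auto simp: fsupp_def layer_def)
  have acyc: "cocycles ?P d \<subseteq> (coboundaries ?P d :: (nat set \<Rightarrow> 'k) set)" for d
  proof -
    have "\<forall>\<tau>\<in>?P. finite \<tau>" using finX by auto
    then show ?thesis using toggle_acyclic[OF _ tog] by blast
  qed
  have BP: "coboundaries ?P d \<subseteq> (coboundaries X d :: (nat set \<Rightarrow> 'k) set)" for d
  proof (cases "d = 0")
    case False
    show ?thesis
    proof
      fix g :: "nat set \<Rightarrow> 'k" assume "g \<in> coboundaries ?P d"
      then obtain f where f: "f \<in> fsupp (layer ?P (d - 1))" "g = cob ?P f" using False by (auto simp: coboundaries_def)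
      then have "g = cob X f" "f \<in> fsupp (layer X (d - 1))" using up sp sp0 by metis+
      then show "g \<in> coboundaries X d" using False by (auto simp: coboundaries_def)
    qed
  qed (simp add: coboundaries_def)
  \<comment> \<open>Restriction has the same kernel on cocycles and on coboundaries, namely the
    relative cocycles, since all of these are relative coboundaries. The two rank-nullity counts
    then differ equally.\<close>
  have kerZ: "{f \<in> cocycles X c. r f = 0} = cocycles ?P c"
    using up sp sp0 by (auto simp: cocycles_def)
  have kerB: "{f \<in> coboundaries X c. r f = 0} = (cocycles ?P c :: (nat set \<Rightarrow> 'k) set)"
    using coboundaries_subset_cocycles[OF X, of c] acyc[of c] BP[of c] unfolding kerZ[symmetric] by blast
  have imB: "r ` coboundaries X c = coboundaries \<Phi> c"
  proof (cases "c = 0")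
    case True
    then show ?thesis using r.zero by (simp add: coboundaries_def)
  next
    case False
    have "r ` cob X ` fsupp (layer X (c - 1)) = cob \<Phi> ` r ` fsupp (layer X (c - 1))"
      by (simp add: image_image rc)
    then show ?thesis using restrict_fsupp[OF sub, of "c - 1", where 'k='k] False
      by (simp add: coboundaries_def r_def[abs_def])
  qed
  have imZ: "r ` cocycles X c = cocycles \<Phi> c"
  proof (intro equalityI subsetI)
    fix g assume "g \<in> r ` cocycles X c"
    then obtain f where f: "g = r f" "f \<in> cocycles X c" by blast
    then have "g \<in> fsupp (layer \<Phi> c)" using restrict_fsupp[OF sub, of c, where 'k='k]
      unfolding cocycles_def r_def by blast
    then show "g \<in> cocycles \<Phi> c" using f rc r.zero by (simp add: cocycles_def)
  next
    fix g :: "nat set \<Rightarrow> 'k" assume g: "g \<in> cocycles \<Phi> c"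
    then have rg: "r g = g" by (auto simp: cocycles_def fsupp_def layer_def r_def)
    have gX: "g \<in> fsupp (layer X c)" using g sub by (auto simp: cocycles_def fsupp_def layer_def)
    have r1: "r (cob X g) = 0" using rc[of g] rg g by (simp add: cocycles_def)
    \<comment> \<open>A cocycle of the subcomplex, extended by zero, has a relative cocycle as
      coboundary. Subtracting a relative primitive \<open>y\<close> of it gives a cocycle of
      \<open>X\<close> with the same restriction.\<close>
    have "cob X g \<in> cocycles ?P (Suc c)"
      using r1 up sp cob_layer[OF finX(2) gX] cob_cob[OF X, of g] by (auto simp: cocycles_def)
    then obtain y where y: "y \<in> fsupp (layer ?P c)" "cob X g = cob ?P y"
      using acyc[of "Suc c"] by (auto simp: coboundaries_def)
    then have y2: "r y = 0" "y \<in> fsupp (layer X c)" "cob X y = cob X g" using up sp sp0 by metis+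
    have "g - y \<in> cocycles X c"
      using fv.subspace_diff[OF subspace_fsupp gX y2(2)] y2(3) cX.diff by (simp add: cocycles_def)
    moreover have "r (g - y) = g" using r.diff rg y2(1) by simp
    ultimately show "g \<in> r ` cocycles X c" by force
  qed
  show ?thesis
    using rank_nullity[OF lin subspace_cocycles fin_span_cocycles[OF finX(1)], of c]
      rank_nullity[OF lin subspace_coboundaries fin_span_coboundaries[OF finX(1)], of c]
    unfolding imB imZ kerZ kerB hcoh_def by linarith
qed

section \<open>The effect of a single simplex on cohomology\<close>

definition cob_rank :: "'k::field itself \<Rightarrow> nat set set \<Rightarrow> nat \<Rightarrow> nat" where
  "cob_rank _ \<Phi> c = fv.dim (cob \<Phi> ` fsupp (layer \<Phi> c) :: (nat set \<Rightarrow> 'k) set)"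

text \<open>Cochains minus outgoing rank minus incoming rank. In this form one additional simplex
  affects only one layer and one rank.\<close>

lemma hcoh_rank:
  assumes "finite \<Phi>"
  shows "hcoh TYPE('k::field) \<Phi> c = int (card (layer \<Phi> c)) - int (cob_rank TYPE('k) \<Phi> c)
    - (if c = 0 then 0 else int (cob_rank TYPE('k) \<Phi> (c - 1)))"
proof -
  have "fv.dim ({0} :: (nat set \<Rightarrow> 'k) set) = 0" using fv.dim_le_card[of "{0}" "{}"] by simp
  moreover have "cob_rank TYPE('k) \<Phi> c + fv.dim (cocycles \<Phi> c :: (nat set \<Rightarrow> 'k) set) = card (layer \<Phi> c)"
    using rank_nullity[OF linear_cob subspace_fsupp fin_span_fsupp[OF finite_layer[OF assms]], of \<Phi> c]
    by (simp add: cob_rank_def cocycles_def dim_fsupp finite_layer assms)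
  ultimately show ?thesis by (cases "c = 0") (auto simp: hcoh_def coboundaries_def cob_rank_def)
qed

text \<open>The layer of \<open>\<sigma>\<close> grows by one, and the only rank that can change is
  that of the coboundary into this layer, which grows by \<open>e\<close>. So the simplex either
  creates a class in its own degree (\<open>e = 0\<close>) or kills one in the degree below
  (\<open>e = 1\<close>). Which of the two happens depends on \<open>\<Phi>\<close> and is decided
  where the lemma is applied.\<close>

lemma hcoh_add_simplex:
  assumes \<Phi>: "cplx \<Phi>" and X: "cplx (insert \<sigma> \<Phi>)" and \<sigma>: "\<sigma> \<notin> \<Phi>" "\<sigma> \<noteq> {}"
  obtains e :: int where "e = 0 \<or> e = 1"
    "\<And>c. hcoh TYPE('k::field) (insert \<sigma> \<Phi>) c = hcoh TYPE('k) \<Phi> c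
       + (if c = card \<sigma> then 1 - e else 0) - (if c + 1 = card \<sigma> then e else 0)"
proof -
  let ?X = "insert \<sigma> \<Phi>"
  define r :: "(nat set \<Rightarrow> 'k) \<Rightarrow> nat set \<Rightarrow> 'k" where "r f = (\<lambda>\<tau>. if \<tau> \<in> \<Phi> then f \<tau> else 0)" for f
  have lin: "Vector_Spaces.linear fscale fscale r"
    using linear_restrict[of \<Phi>] by (simp add: r_def[abs_def])
  have fin: "finite \<Phi>" "finite ?X" "\<forall>\<tau>\<in>?X. finite \<tau>" using X by (auto simp: cplx_def)
  have cs: "card \<sigma> > 0" using \<sigma> fin by (auto simp: card_gt_0_iff)
  have rc: "cob \<Phi> (r f) = r (cob ?X f)" for f unfolding r_def by (rule restrict_cob[OF \<Phi> X]) auto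
  let ?K = "\<lambda>c. {g \<in> cob ?X ` fsupp (layer ?X c) :: (nat set \<Rightarrow> 'k) set. r g = 0}"
  have rank: "cob_rank TYPE('k) ?X c = cob_rank TYPE('k) \<Phi> c + fv.dim (?K c)" for c
  proof -
    interpret cX: Vector_Spaces.linear fscale fscale "cob ?X :: (nat set \<Rightarrow> 'k) \<Rightarrow> _" by (rule linear_cob)
    have "r ` cob ?X ` fsupp (layer ?X c) = cob \<Phi> ` r ` fsupp (layer ?X c)"
      by (simp add: image_image rc)
    also have "\<dots> = cob \<Phi> ` fsupp (layer \<Phi> c)"
      using restrict_fsupp[of \<Phi> ?X c, where 'k='k] by (simp add: r_def[abs_def] subset_insertI)
    finally show ?thesis
      using rank_nullity[OF lin cX.subspace_image[OF subspace_fsupp]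
          fin_span_image[OF linear_cob fin_span_fsupp[OF finite_layer[OF fin(2)]]], of c]
      by (simp add: cob_rank_def)
  qed
  \<comment> \<open>A coboundary that restricts to zero is supported on \<open>\<sigma>\<close>
    alone. The kernel is therefore at most a line, and nonzero only for cochains one degree below
    \<open>\<sigma>\<close>.\<close>
  have K: "?K c \<subseteq> fsupp (if card \<sigma> = Suc c then {\<sigma>} else {})" for c
  proof
    fix g assume "g \<in> ?K c"
    then have "r g = 0" and g: "g \<in> fsupp (layer ?X (Suc c))" using cob_layer[OF fin(3)] by auto
    then have "r g \<tau> = 0" for \<tau> by simp
    then have "\<forall>\<tau>\<in>\<Phi>. g \<tau> = 0" unfolding r_def by metis
    then show "g \<in> fsupp (if card \<sigma> = Suc c then {\<sigma>} else {})"
      using g by (auto simp: fsupp_def layer_def)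
  qed
  have d: "fv.dim (?K c) \<le> (if card \<sigma> = Suc c then 1 else 0)" for c
  proof -
    let ?S = "if card \<sigma> = Suc c then {\<sigma>} else {}"
    have "finite ?S" by simp
    then have "fv.dim (?K c) \<le> fv.dim (fsupp ?S :: (nat set \<Rightarrow> 'k) set)"
      by (intro dim_mono_fin[OF fv.vector_space_axioms subspace_fsupp _ K] fin_span_fsupp)
    then show ?thesis using \<open>finite ?S\<close> by (simp add: dim_fsupp split: if_splits)
  qed
  define e where "e = int (fv.dim (?K (card \<sigma> - 1)))"
  have dK: "int (fv.dim (?K c)) = (if c + 1 = card \<sigma> then e else 0)" for c
  proof (cases "c + 1 = card \<sigma>")
    case True
    then have c: "card \<sigma> - 1 = c" by simp
    show ?thesis unfolding if_P[OF True] e_def c ..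
  next
    case False
    then show ?thesis using d[of c] by auto
  qed
  have cl: "int (card (layer ?X c)) = int (card (layer \<Phi> c)) + (if c = card \<sigma> then 1 else 0)" for c
  proof -
    have "layer ?X c = (if c = card \<sigma> then insert \<sigma> (layer \<Phi> c) else layer \<Phi> c)"
      by (auto simp: layer_def)
    then show ?thesis using finite_layer[OF fin(1)] \<sigma>(1) by (auto simp: layer_def)
  qed
  show ?thesis
  proof
    show "e = 0 \<or> e = 1" using d[of "card \<sigma> - 1"] cs by (auto simp: e_def)
    fix c
    show "hcoh TYPE('k) ?X c = hcoh TYPE('k) \<Phi> c
       + (if c = card \<sigma> then 1 - e else 0) - (if c + 1 = card \<sigma> then e else 0)"
      unfolding hcoh_rank[OF fin(1)] hcoh_rank[OF fin(2)] rank cl of_nat_add dK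
      using cs by auto
  qed
qed

lemma hcoh_acyclic:
  assumes "cplx X" "\<And>\<tau>. \<tau> \<in> X \<Longrightarrow> insert a \<tau> \<in> X \<and> \<tau> - {a} \<in> X"
  shows "hcoh TYPE('k::field) X c = 0"
proof -
  have "\<forall>\<tau>\<in>X. finite \<tau>" using assms(1) by (auto simp: cplx_def)
  then have "cocycles X c \<subseteq> (coboundaries X c :: (nat set \<Rightarrow> 'k) set)"
    using toggle_acyclic[of X a _ c] assms(2) by blast
  with coboundaries_subset_cocycles[OF assms(1), of c, where 'k='k]
  have "cocycles X c = (coboundaries X c :: (nat set \<Rightarrow> 'k) set)" by blast
  then show ?thesis by (simp add: hcoh_def)
qed

text \<open>A cochain of degree 0 is determined by its value at the empty set, and the coboundary
  copies this value to \<open>{v}\<close>.\<close>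

lemma hcoh_0_vertex:
  assumes "cplx \<Phi>" "{v} \<in> \<Phi>"
  shows "hcoh TYPE('k::field) \<Phi> 0 = 0"
proof -
  have "cocycles \<Phi> 0 \<subseteq> ({0} :: (nat set \<Rightarrow> 'k) set)"
  proof
    fix f :: "nat set \<Rightarrow> 'k" assume f: "f \<in> cocycles \<Phi> 0"
    then have "cob \<Phi> f {v} = 0" by (simp add: cocycles_def)
    then have "f {} = 0" using assms(2) by (simp add: cob_def sgn_ins_def)
    have "f \<tau> = 0" for \<tau>
    proof (cases "\<tau> = {}")
      case False
      then have "\<tau> \<notin> layer \<Phi> 0" using assms(1) by (auto simp: layer_def cplx_def)
      then show ?thesis using f by (auto simp: cocycles_def fsupp_def)
    qed (simp add: \<open>f {} = 0\<close>)
    then show "f \<in> {0}" by (simp add: fun_eq_iff)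
  qed
  moreover have "0 \<in> (cocycles \<Phi> 0 :: (nat set \<Rightarrow> 'k) set)" by (rule fv.subspace_0[OF subspace_cocycles])
  ultimately have "cocycles \<Phi> 0 = ({0} :: (nat set \<Rightarrow> 'k) set)" by blast
  then show ?thesis by (simp add: hcoh_def coboundaries_def)
qed

lemma hcoh_point: "hcoh TYPE('k::field) {{}, {w}} c = 0"
  by (rule hcoh_acyclic[where a = w]) (auto simp: cplx_def Pow_insert)

text \<open>Obtained backwards: adding one vertex gives a point, which is acyclic. With
  \<open>e = 0\<close> the cohomology of \<open>{{}}\<close> in degree 1 would be negative, so the
  vertex kills the class in degree 0.\<close>

lemma hcoh_empty_face: "hcoh TYPE('k::field) {{}} c = (if c = 0 then 1 else 0)"
proof -
  have 1: "cplx {{}}" by (simp add: cplx_def)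
  have 2: "cplx (insert {0} {{}})" by (auto simp: cplx_def Pow_insert)
  obtain e :: int where e01: "e = 0 \<or> e = 1"
    and e: "\<And>c. hcoh TYPE('k) (insert {0} {{}}) c = hcoh TYPE('k) {{}} c
       + (if c = card {0::nat} then 1 - e else 0) - (if c + 1 = card {0::nat} then e else 0)"
    by (rule hcoh_add_simplex[OF 1 2]) auto
  have z: "hcoh TYPE('k) (insert {0} {{}}) d = 0" for d
    using hcoh_point[of 0 d] by (simp add: insert_commute)
  have "e = 1" using e01 z[of 1] e[of 1] hcoh_nonneg[OF 1, of 1, where 'k='k] by auto
  then show ?thesis using e[of c] unfolding z by (cases "c = 0"; cases "c = 1") auto
qed

lemma hcoh_simplex:
  assumes "finite J"
  shows "hcoh TYPE('k::field) (Pow J) c = (if J = {} \<and> c = 0 then 1 else 0)"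
proof (cases "J = {}")
  case True
  then show ?thesis using hcoh_empty_face[of c] by simp
next
  case False
  then obtain a where "a \<in> J" by blast
  moreover have "cplx (Pow J)" using assms finite_subset by (auto simp: cplx_def)
  ultimately show ?thesis using hcoh_acyclic[of "Pow J" a c, where 'k='k] by auto
qed

text \<open>The added sets \<open>insert w t\<close> with \<open>t\<close> inside
  \<open>\<rho>\<close> are paired by inserting or deleting any fixed vertex of
  \<open>\<rho>\<close>, so the relative complex is acyclic. The condition on \<open>\<rho>\<close>
  supplies this vertex; over the empty face \<open>w\<close> would be an isolated point.\<close>

lemma hcoh_cone_face:
  assumes L: "cplx L" and w: "\<And>\<tau>. \<tau> \<in> L \<Longrightarrow> w \<notin> \<tau>" and \<rho>: "\<rho> \<in> L" "\<rho> \<noteq> {}"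
  shows "cplx (L \<union> insert w ` Pow \<rho>)"
    and "hcoh TYPE('k::field) (L \<union> insert w ` Pow \<rho>) c = hcoh TYPE('k) L c"
proof -
  have sub: "Pow \<rho> \<subseteq> L" "finite \<rho>" "finite L" using L \<rho> by (auto simp: cplx_def)
  show X: "cplx (L \<union> insert w ` Pow \<rho>)"
    unfolding cplx_def
  proof (intro conjI ballI)
    fix \<tau> assume "\<tau> \<in> L \<union> insert w ` Pow \<rho>"
    then consider "\<tau> \<in> L" | t where "t \<subseteq> \<rho>" "\<tau> = insert w t" by blast
    then show "Pow \<tau> \<subseteq> L \<union> insert w ` Pow \<rho>"
    proof cases
      case 1 then show ?thesis using L by (auto simp: cplx_def)
    next
      case 2
      show ?thesis
      proof
        fix \<mu> assume "\<mu> \<in> Pow \<tau>"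
        then have "\<mu> - {w} \<in> Pow \<rho>" using 2 by auto
        moreover have "\<mu> = \<mu> - {w} \<or> \<mu> = insert w (\<mu> - {w})" by auto
        ultimately show "\<mu> \<in> L \<union> insert w ` Pow \<rho>" using sub(1) by (metis UnCI imageI subsetD)
      qed
    qed
    show "finite \<tau>"
      using \<open>\<tau> \<in> L \<union> insert w ` Pow \<rho>\<close>
    proof
      assume "\<tau> \<in> insert w ` Pow \<rho>"
      then obtain t where "t \<subseteq> \<rho>" "\<tau> = insert w t" by blast
      then show ?thesis using finite_subset[of t \<rho>] sub(2) by auto
    qed (use L in \<open>auto simp: cplx_def\<close>)
  qed (use sub in simp)
  obtain a where a: "a \<in> \<rho>" using \<rho>(2) by blast
  then have "a \<noteq> w" using w[OF \<rho>(1)] by blast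
  show "hcoh TYPE('k) (L \<union> insert w ` Pow \<rho>) c = hcoh TYPE('k) L c"
  proof (rule hcoh_toggle[OF L X, where a = a])
    fix \<tau> assume "\<tau> \<in> (L \<union> insert w ` Pow \<rho>) - L"
    then obtain t where t: "t \<subseteq> \<rho>" "\<tau> = insert w t" by blast
    have "insert a \<tau> = insert w (insert a t)" "\<tau> - {a} = insert w (t - {a})" using t \<open>a \<noteq> w\<close> by auto
    moreover have "insert a t \<subseteq> \<rho>" "t - {a} \<subseteq> \<rho>" using t a by auto
    moreover have "insert w s \<in> (L \<union> insert w ` Pow \<rho>) - L" if "s \<subseteq> \<rho>" for s
      using w[of "insert w s"] that by auto
    ultimately show "insert a \<tau> \<in> (L \<union> insert w ` Pow \<rho>) - L \<and> \<tau> - {a} \<in> (L \<union> insert w ` Pow \<rho>) - L"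
      by simp
  qed auto
qed

section \<open>Stacked spheres\<close>

text \<open>The star of \<open>\<sigma>\<close> is replaced by the cone over its boundary. This is
  the stellar subdivision only when \<open>\<sigma>\<close> is maximal, since then the link of
  \<open>\<sigma>\<close> consists of the empty face.\<close>

definition stell :: "nat set set \<Rightarrow> nat set \<Rightarrow> nat \<Rightarrow> nat set set" where
  "stell L \<sigma> w = (L - {\<sigma>}) \<union> insert w ` {\<tau>. \<tau> \<subset> \<sigma>}"

lemma cplx_stell:
  assumes L: "cplx L" and \<sigma>: "\<sigma> \<in> L" and max: "\<And>\<tau>. \<tau> \<in> L \<Longrightarrow> \<sigma> \<subseteq> \<tau> \<Longrightarrow> \<tau> = \<sigma>"
  shows "cplx (stell L \<sigma> w)"
proof -
  have f: "finite \<sigma>" "finite L" "Pow \<sigma> \<subseteq> L" using L \<sigma> by (auto simp: cplx_def)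
  show ?thesis
    unfolding cplx_def
  proof (intro conjI ballI)
    have "{\<tau>. \<tau> \<subset> \<sigma>} \<subseteq> Pow \<sigma>" by auto
    then show "finite (stell L \<sigma> w)" using f finite_subset[of _ "Pow \<sigma>"] by (auto simp: stell_def)
    fix \<tau> assume \<tau>: "\<tau> \<in> stell L \<sigma> w"
    then consider "\<tau> \<in> L" "\<tau> \<noteq> \<sigma>" | t where "t \<subset> \<sigma>" "\<tau> = insert w t" by (auto simp: stell_def)
    then show "Pow \<tau> \<subseteq> stell L \<sigma> w"
    proof cases
      case 1
      have "\<mu> \<in> stell L \<sigma> w" if "\<mu> \<subseteq> \<tau>" for \<mu>
      proof -
        have "\<mu> \<in> L" using 1 that L by (auto simp: cplx_def)
        moreover have "\<mu> \<noteq> \<sigma>" using max[OF 1(1)] 1(2) that by auto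
        ultimately show ?thesis by (simp add: stell_def)
      qed
      then show ?thesis by blast
    next
      case 2
      show ?thesis
      proof
        fix \<mu> assume "\<mu> \<in> Pow \<tau>"
        then have m: "\<mu> - {w} \<subset> \<sigma>" using 2 by auto
        then have "\<mu> - {w} \<in> stell L \<sigma> w" using f(3) by (auto simp: stell_def)
        moreover have "insert w (\<mu> - {w}) \<in> stell L \<sigma> w"
          unfolding stell_def using m by (intro UnI2 imageI CollectI)
        moreover have "\<mu> = \<mu> - {w} \<or> \<mu> = insert w (\<mu> - {w})" by auto
        ultimately show "\<mu> \<in> stell L \<sigma> w" by metis
      qed
    qed
    from \<tau> show "finite \<tau>"
      unfolding stell_def
    proof
      assume "\<tau> \<in> insert w ` {\<tau>. \<tau> \<subset> \<sigma>}"
      then obtain t where "t \<subset> \<sigma>" "\<tau> = insert w t" by blast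
      then show ?thesis using finite_subset[of t \<sigma>] f(1) by auto
    qed (use L in \<open>auto simp: cplx_def\<close>)
  qed
qed

text \<open>Both complexes are compared with the union of \<open>L\<close> and the full cone over
  \<open>\<sigma>\<close>. Besides the subdivision this union contains only \<open>\<sigma>\<close>
  and \<open>insert w \<sigma>\<close>, a pair for the toggle at \<open>w\<close>.\<close>

lemma hcoh_stell:
  assumes L: "cplx L" and \<sigma>: "\<sigma> \<in> L" "\<sigma> \<noteq> {}" and max: "\<And>\<tau>. \<tau> \<in> L \<Longrightarrow> \<sigma> \<subseteq> \<tau> \<Longrightarrow> \<tau> = \<sigma>"
    and w: "\<And>\<tau>. \<tau> \<in> L \<Longrightarrow> w \<notin> \<tau>"
  shows "hcoh TYPE('k::field) (stell L \<sigma> w) c = hcoh TYPE('k) L c"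
proof -
  let ?Y = "L \<union> insert w ` Pow \<sigma>"
  note Y = hcoh_cone_face[OF L w \<sigma>]
  have "?Y - stell L \<sigma> w = {\<sigma>, insert w \<sigma>}"
  proof -
    have "insert w t \<noteq> insert w \<sigma>" if "t \<subset> \<sigma>" for t
      using w[OF \<sigma>(1)] that by (metis Diff_insert_absorb psubsetD psubset_eq)
    moreover have "insert w t \<noteq> \<sigma>" for t using w[OF \<sigma>(1)] by blast
    moreover have "insert w \<sigma> \<notin> L" using w by blast
    ultimately show ?thesis using \<sigma>(1) by (auto simp: stell_def)
  qed
  moreover have "\<sigma> - {w} = \<sigma>" using w[OF \<sigma>(1)] by auto
  moreover have "stell L \<sigma> w \<subseteq> ?Y" by (auto simp: stell_def)
  ultimately have "hcoh TYPE('k) ?Y c = hcoh TYPE('k) (stell L \<sigma> w) c"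
    by (intro hcoh_toggle[OF cplx_stell[OF L \<sigma>(1) max] Y(1), where a = w]) auto
  then show ?thesis using Y(2)[where 'k='k] by simp
qed

definition restr :: "nat set set \<Rightarrow> nat set \<Rightarrow> nat set set" where
  "restr K J = {\<tau> \<in> K. \<tau> \<subseteq> J}"

lemma cplx_restr: "cplx K \<Longrightarrow> cplx (restr K J)"
  by (fastforce simp: cplx_def restr_def)

lemma cplx_remove:
  assumes "cplx L" "\<And>\<tau>. \<tau> \<in> L \<Longrightarrow> \<sigma> \<subseteq> \<tau> \<Longrightarrow> \<tau> = \<sigma>"
  shows "cplx (L - {\<sigma>})"
  unfolding cplx_def
proof (intro conjI ballI subsetI)
  fix \<tau> \<mu> assume t: "\<tau> \<in> L - {\<sigma>}" and "\<mu> \<in> Pow \<tau>"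
  then have "\<mu> \<in> L" using assms(1) by (auto simp: cplx_def)
  moreover have "\<mu> \<noteq> \<sigma>" using assms(2)[of \<tau>] t \<open>\<mu> \<in> Pow \<tau>\<close> by auto
  ultimately show "\<mu> \<in> L - {\<sigma>}" by simp
qed (use assms(1) in \<open>auto simp: cplx_def\<close>)

lemma restr_stell_1: "w \<notin> J \<Longrightarrow> restr (stell K \<sigma> w) J = restr K J - {\<sigma>}"
  by (auto simp: restr_def stell_def)

text \<open>If \<open>J\<close> does not contain \<open>\<sigma>\<close>, every subset of
  \<open>\<sigma> \<inter> J\<close> is a proper subset of \<open>\<sigma>\<close>. The new vertex
  is thus joined to a full simplex, or isolated if \<open>J\<close> misses
  \<open>\<sigma>\<close>.\<close>

lemma restr_stell_2:
  assumes "\<And>\<tau>. \<tau> \<in> K \<Longrightarrow> w \<notin> \<tau>" "w \<notin> \<sigma>" "\<not> \<sigma> \<subseteq> J"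
  shows "restr (stell K \<sigma> w) (insert w J) = restr K J \<union> insert w ` Pow (\<sigma> \<inter> J)"
proof -
  have "{\<tau>. \<tau> \<subset> \<sigma> \<and> insert w \<tau> \<subseteq> insert w J} = Pow (\<sigma> \<inter> J)"
    using assms(2,3) by auto
  moreover have "{\<tau>\<in>insert w ` {\<tau>. \<tau> \<subset> \<sigma>}. \<tau> \<subseteq> insert w J} = insert w ` {\<tau>. \<tau> \<subset> \<sigma> \<and> insert w \<tau> \<subseteq> insert w J}"
    by blast
  moreover have "{\<tau>\<in>K - {\<sigma>}. \<tau> \<subseteq> insert w J} = restr K J"
    using assms by (auto simp: restr_def)
  moreover have "restr (stell K \<sigma> w) (insert w J)
      = {\<tau>\<in>K - {\<sigma>}. \<tau> \<subseteq> insert w J} \<union> {\<tau>\<in>insert w ` {\<tau>. \<tau> \<subset> \<sigma>}. \<tau> \<subseteq> insert w J}"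
    unfolding restr_def stell_def by blast
  ultimately show ?thesis by simp
qed

lemma restr_stell_3:
  assumes "\<And>\<tau>. \<tau> \<in> K \<Longrightarrow> w \<notin> \<tau>" "\<sigma> \<subseteq> J"
  shows "restr (stell K \<sigma> w) (insert w J) = stell (restr K J) \<sigma> w"
  using assms unfolding restr_def stell_def by blast

text \<open>Stacked spheres of dimension \<open>n - 1\<close> after \<open>k\<close> subdivisions of
  the boundary of a simplex. The vertex set is carried along because full subcomplexes refer to it
  and because the new vertex has to be fresh.\<close>

inductive stacked :: "nat \<Rightarrow> nat \<Rightarrow> nat set \<Rightarrow> nat set set \<Rightarrow> bool" for n where
  base: "finite V \<Longrightarrow> card V = n + 1 \<Longrightarrow> stacked n 0 V {\<tau>. \<tau> \<subset> V}"
| step: "stacked n k V K \<Longrightarrow> w \<notin> V \<Longrightarrow> \<sigma> \<in> K \<Longrightarrow> card \<sigma> = n \<Longrightarrow> stacked n (Suc k) (insert w V) (stell K \<sigma> w)"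

text \<open>For \<open>n = 1\<close> the subdivided facet would be a vertex and would disappear from
  the complex; with \<open>n \<ge> 2\<close> all singletons remain faces.\<close>

lemma stacked_facts:
  assumes "stacked n k V K" "n \<ge> 2"
  shows "cplx K" "finite V" "card V = n + k + 1" "\<forall>\<tau>\<in>K. \<tau> \<subseteq> V \<and> card \<tau> \<le> n" "{} \<in> K" "\<forall>v\<in>V. {v} \<in> K"
proof -
  have "cplx K \<and> finite V \<and> card V = n + k + 1 \<and> (\<forall>\<tau>\<in>K. \<tau> \<subseteq> V \<and> card \<tau> \<le> n) \<and> {} \<in> K \<and> (\<forall>v\<in>V. {v} \<in> K)"
    using assms(1)
  proof induction
    case (base V)
    have "finite {\<tau>. \<tau> \<subset> V}" using base(1) by (auto intro: finite_subset[of _ "Pow V"])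
    moreover have "finite \<tau> \<and> card \<tau> < n + 1" if "\<tau> \<subset> V" for \<tau>
      using that base psubset_card_mono[of V \<tau>] by (auto intro: finite_subset)
    moreover have "{} \<subset> V" using base by (auto simp: psubset_eq)
    moreover have "{v} \<subset> V" if "v \<in> V" for v
    proof -
      have "V \<noteq> {v}" using base assms(2) by auto
      then show ?thesis using that by auto
    qed
    moreover have "Pow \<tau> \<subseteq> {\<tau>. \<tau> \<subset> V}" if "\<tau> \<subset> V" for \<tau> using that by auto
    ultimately show ?case using base unfolding cplx_def by (simp add: less_Suc_eq_le psubset_imp_subset)
  next
    case (step k V K w \<sigma>)
    have max: "\<tau> = \<sigma>" if "\<tau> \<in> K" "\<sigma> \<subseteq> \<tau>" for \<tau>
      using step card_subset_eq[of \<tau> \<sigma>] card_mono[of \<tau> \<sigma>] that by (auto simp: cplx_def)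
    have cp: "cplx (stell K \<sigma> w)" by (rule cplx_stell[OF _ \<open>\<sigma> \<in> K\<close> max]) (use step in simp_all)
    have fs: "finite \<sigma>" using step by (auto simp: cplx_def)
    have cw: "card (insert w t) \<le> n" if "t \<subset> \<sigma>" for t
      using psubset_card_mono[OF fs that] card_insert_le_m1[of n t w] \<open>card \<sigma> = n\<close> assms(2)
      by (simp add: card_insert_if finite_subset[of t \<sigma>] fs psubset_imp_subset that)
    have "\<sigma> \<noteq> {}" using \<open>card \<sigma> = n\<close> assms(2) by auto
    have "{v} \<noteq> \<sigma>" for v using \<open>card \<sigma> = n\<close> assms(2) by auto
    moreover have "{} \<subset> \<sigma>" using \<open>\<sigma> \<noteq> {}\<close> by auto
    then have "{w} \<in> insert w ` {\<tau>. \<tau> \<subset> \<sigma>}" by (intro image_eqI[of _ _ "{}"]) auto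
    moreover have "\<tau> \<subseteq> insert w V \<and> card \<tau> \<le> n" if \<tau>: "\<tau> \<in> stell K \<sigma> w" for \<tau>
      using \<tau> unfolding stell_def
    proof
      assume "\<tau> \<in> insert w ` {\<tau>. \<tau> \<subset> \<sigma>}"
      then obtain t where t: "t \<subset> \<sigma>" "\<tau> = insert w t" by blast
      moreover have "\<sigma> \<subseteq> V" using step by simp
      ultimately show ?thesis using cw[OF t(1)] by auto
    qed (use step in auto)
    moreover have "{} \<noteq> \<sigma>" using \<open>\<sigma> \<noteq> {}\<close> by simp
    moreover note cp
    ultimately show ?case using step by (simp add: stell_def)
  qed
  then show "cplx K" "finite V" "card V = n + k + 1" "\<forall>\<tau>\<in>K. \<tau> \<subseteq> V \<and> card \<tau> \<le> n" "{} \<in> K" "\<forall>v\<in>V. {v} \<in> K"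
    by auto
qed

lemma stacked_facet_maximal:
  assumes "stacked n k V K" "n \<ge> 2" "card \<sigma> = n" "\<tau> \<in> K" "\<sigma> \<subseteq> \<tau>"
  shows "\<tau> = \<sigma>"
  using stacked_facts[OF assms(1,2)] assms(3-5) card_subset_eq[of \<tau> \<sigma>] card_mono[of \<tau> \<sigma>]
  by (auto simp: cplx_def)

text \<open>Three shapes occur: a subdivision of the old full subcomplex if \<open>J\<close>
  contains \<open>\<sigma>\<close>, a cone over the face \<open>\<sigma> \<inter> J\<close> if
  \<open>J\<close> only meets \<open>\<sigma>\<close>, and an added isolated vertex if
  \<open>J\<close> misses \<open>\<sigma>\<close>. Only the last changes the cohomology, by a new
  component, except that for empty \<open>J\<close> the result is a single point.\<close>

lemma hcoh_restr_stell_new: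
  assumes K: "stacked n k V K" and n: "n \<ge> 2" and w: "w \<notin> V" and \<sigma>: "\<sigma> \<in> K" "card \<sigma> = n" and J: "J \<subseteq> V"
  shows "hcoh TYPE('k::field) (restr (stell K \<sigma> w) (insert w J)) c =
    (if J = {} then 0 else hcoh TYPE('k) (restr K J) c + (if \<sigma> \<inter> J = {} \<and> c = 1 then 1 else 0))"
proof -
  note F = stacked_facts[OF K n]
  have wK: "w \<notin> \<tau>" if "\<tau> \<in> K" for \<tau> using F(4) that w by blast
  have ne: "\<sigma> \<noteq> {}" using \<sigma> n by auto
  have cJ: "cplx (restr K J)" using F(1) by (rule cplx_restr)
  have wJ: "w \<notin> \<tau>" if "\<tau> \<in> restr K J" for \<tau> using wK that by (auto simp: restr_def)
  show ?thesis
  proof (cases "\<sigma> \<subseteq> J")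
    case True
    have "J \<noteq> {}" "\<sigma> \<inter> J \<noteq> {}" using True ne by auto
    have "hcoh TYPE('k) (stell (restr K J) \<sigma> w) c = hcoh TYPE('k) (restr K J) c"
      by (rule hcoh_stell[OF cJ _ ne _ wJ])
        (use True \<sigma> stacked_facet_maximal[OF K n \<sigma>(2)] in \<open>auto simp: restr_def\<close>)
    then show ?thesis using restr_stell_3[OF wK True] \<open>J \<noteq> {}\<close> \<open>\<sigma> \<inter> J \<noteq> {}\<close> by simp
  next
    case False
    note e = restr_stell_2[OF wK wK[OF \<sigma>(1)] False]
    show ?thesis
    proof (cases "\<sigma> \<inter> J = {}")
      case False
      then have "J \<noteq> {}" by auto
      have "Pow \<sigma> \<subseteq> K" using F(1) \<sigma> by (auto simp: cplx_def)
      then have "\<sigma> \<inter> J \<in> restr K J" by (auto simp: restr_def)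
      then show ?thesis using hcoh_cone_face(2)[OF cJ wJ _ False, where 'k='k] e False \<open>J \<noteq> {}\<close> by simp
    next
      case True
      then have e: "restr (stell K \<sigma> w) (insert w J) = insert {w} (restr K J)" using e by simp
      show ?thesis
      proof (cases "J = {}")
        case True
        have "restr K {} = {{}}" using F(5) by (auto simp: restr_def)
        then show ?thesis using e True hcoh_point[of w c, where 'k='k] by (simp add: insert_commute)
      next
        case False
        then obtain v where v: "v \<in> J" by blast
        then have vr: "{v} \<in> restr K J" using F(6) J by (auto simp: restr_def)
        have cw: "cplx (insert {w} (restr K J))"
          using cJ F(5) by (auto simp: cplx_def restr_def Pow_insert)
        have nw: "{w} \<notin> restr K J" using wJ by blast
        obtain e :: int where e01: "e = 0 \<or> e = 1"
          and ee: "\<And>c. hcoh TYPE('k) (insert {w} (restr K J)) c = hcoh TYPE('k) (restr K J) c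
             + (if c = card {w} then 1 - e else 0) - (if c + 1 = card {w} then e else 0)"
          by (rule hcoh_add_simplex[OF cJ cw nw]) auto
        \<comment> \<open>\<open>J\<close> already has a vertex, so degree 0 carries no class that
          the isolated vertex could kill.\<close>
        have "e = 0" using e01 ee[of 0] hcoh_0_vertex[OF cJ vr, where 'k='k] hcoh_nonneg[OF cw, of 0, where 'k='k]
          by auto
        then show ?thesis using ee[of c] False True e by simp
      qed
    qed
  qed
qed

text \<open>Read in reverse, the old full subcomplex arises from the new one by adding
  \<open>\<sigma>\<close>. The assumption \<open>top\<close> rules out that this creates a class, so
  \<open>\<sigma>\<close> kills one in degree \<open>n - 1\<close>, and this class is present in the
  new complex.\<close>

lemma hcoh_restr_stell_old:
  assumes K: "stacked n k V K" and n: "n \<ge> 2" and w: "w \<notin> V" and \<sigma>: "\<sigma> \<in> K" "card \<sigma> = n" and J: "J \<subset> V"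
    and top: "hcoh TYPE('k::field) (restr K J) n = 0"
  shows "hcoh TYPE('k::field) (restr (stell K \<sigma> w) J) c =
    hcoh TYPE('k) (restr K J) c + (if \<sigma> \<subseteq> J \<and> c + 1 = n then 1 else 0)"
proof -
  note F = stacked_facts[OF K n]
  have e: "restr (stell K \<sigma> w) J = restr K J - {\<sigma>}" using restr_stell_1[of w J K \<sigma>] w J by blast
  show ?thesis
  proof (cases "\<sigma> \<subseteq> J")
    case False
    then have "restr K J - {\<sigma>} = restr K J" by (auto simp: restr_def)
    then show ?thesis using e False by simp
  next
    case True
    then have s: "\<sigma> \<in> restr K J" using \<sigma> by (simp add: restr_def)
    have cJ: "cplx (restr K J)" using F(1) by (rule cplx_restr)
    have m: "cplx (restr K J - {\<sigma>})"
      by (rule cplx_remove[OF cJ]) (use stacked_facet_maximal[OF K n \<sigma>(2)] in \<open>auto simp: restr_def\<close>)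
    have i: "insert \<sigma> (restr K J - {\<sigma>}) = restr K J" using s by auto
    have ne: "\<sigma> \<noteq> {}" using \<sigma> n by auto
    obtain e :: int where e01: "e = 0 \<or> e = 1"
      and ee: "\<And>c. hcoh TYPE('k) (restr K J) c = hcoh TYPE('k) (restr K J - {\<sigma>}) c
         + (if c = card \<sigma> then 1 - e else 0) - (if c + 1 = card \<sigma> then e else 0)"
      by (rule hcoh_add_simplex[OF m _ _ ne, unfolded i]) (use cJ in auto)
    have "e = 1" using e01 ee[of n] top \<sigma>(2) hcoh_nonneg[OF m, of n, where 'k='k] by auto
    then show ?thesis using ee[of c] e \<sigma>(2) True by auto
  qed
qed

lemma restr_all: "\<forall>\<tau>\<in>K. \<tau> \<subseteq> V \<Longrightarrow> restr K V = K"
  by (auto simp: restr_def)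

text \<open>The complex without \<open>\<sigma>\<close> has no class that \<open>\<sigma>\<close>
  could kill, so putting it back creates the fundamental class.\<close>

lemma hcoh_sphere:
  assumes ball: "\<And>c. hcoh TYPE('k::field) (K - {\<sigma>}) c = 0" and K: "cplx K" "cplx (K - {\<sigma>})" "\<sigma> \<in> K" "card \<sigma> > 0"
    and nz: "hcoh TYPE('k) K (card \<sigma> - 1) \<ge> 0"
  shows "hcoh TYPE('k) K c = (if c = card \<sigma> then 1 else 0)"
proof -
  have i: "insert \<sigma> (K - {\<sigma>}) = K" using K by auto
  obtain e :: int where e01: "e = 0 \<or> e = 1"
    and ee: "\<And>c. hcoh TYPE('k) K c = hcoh TYPE('k) (K - {\<sigma>}) c
       + (if c = card \<sigma> then 1 - e else 0) - (if c + 1 = card \<sigma> then e else 0)"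
    by (rule hcoh_add_simplex[OF K(2), of \<sigma>, unfolded i]) (use K in auto)
  have "card \<sigma> - 1 \<noteq> card \<sigma>" "card \<sigma> - 1 + 1 = card \<sigma>" using K(4) by auto
  then have "e = 0" using e01 ee[of "card \<sigma> - 1"] nz ball by simp
  then show ?thesis using ee[of c] ball by simp
qed

text \<open>After a subdivision the old vertex set \<open>V\<close> is a proper subset of the new
  one, and its full subcomplex is \<open>K - {\<sigma>}\<close>. Vanishing of the top cohomology
  there is an instance of the second claim, which is therefore proved along with the first.\<close>

lemma stacked_homology:
  assumes "stacked n k V K" and n: "n \<ge> 2"
  shows "(\<forall>J. J \<subset> V \<longrightarrow> hcoh TYPE('k::field) (restr K J) n = 0) \<and>
    (\<forall>\<sigma>\<in>K. card \<sigma> = n \<longrightarrow> (\<forall>c. hcoh TYPE('k) (K - {\<sigma>}) c = 0))"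
  using assms(1)
proof induction
  case (base V)
  have st: "stacked n 0 V {\<tau>. \<tau> \<subset> V}" using base by (rule stacked.base)
  note F = stacked_facts[OF st n]
  have "hcoh TYPE('k) (restr {\<tau>. \<tau> \<subset> V} J) n = 0" if "J \<subset> V" for J
  proof -
    have "restr {\<tau>. \<tau> \<subset> V} J = Pow J" using that by (auto simp: restr_def)
    moreover have "finite J" using that base finite_subset by auto
    ultimately show ?thesis using hcoh_simplex[of J n, where 'k='k] n by simp
  qed
  moreover have "hcoh TYPE('k) ({\<tau>. \<tau> \<subset> V} - {\<sigma>}) c = 0" if \<sigma>: "\<sigma> \<in> {\<tau>. \<tau> \<subset> V}" "card \<sigma> = n" for \<sigma> c
  proof -
    have cm: "cplx ({\<tau>. \<tau> \<subset> V} - {\<sigma>})"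
      by (rule cplx_remove[OF F(1)]) (use stacked_facet_maximal[OF st n \<sigma>(2)] in blast)
    have "card (V - \<sigma>) = 1" using \<sigma> base by (subst card_Diff_subset) (auto intro: finite_subset)
    then obtain a where a: "V - \<sigma> = {a}" by (auto simp: card_1_singleton_iff)
    \<comment> \<open>\<open>a\<close> is the vertex opposite to the removed facet; what remains of
      the boundary of the simplex is the cone with apex \<open>a\<close> over the boundary of
      \<open>\<sigma>\<close>.\<close>
    have Va: "V = insert a \<sigma>" "a \<notin> \<sigma>" using a \<sigma>(1) by auto
    show ?thesis
    proof (rule hcoh_acyclic[OF cm, where a = a])
      fix \<tau> assume t: "\<tau> \<in> {\<tau>. \<tau> \<subset> V} - {\<sigma>}"
      have "insert a \<tau> \<noteq> V" using t Va by (auto simp: psubset_eq)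
      moreover have "insert a \<tau> \<noteq> \<sigma>" using Va by auto
      moreover have "\<tau> - {a} \<noteq> \<sigma>"
      proof
        assume "\<tau> - {a} = \<sigma>"
        then have "\<tau> = \<sigma> \<or> \<tau> = V" using Va by auto
        then show False using t by auto
      qed
      ultimately show "insert a \<tau> \<in> {\<tau>. \<tau> \<subset> V} - {\<sigma>} \<and> \<tau> - {a} \<in> {\<tau>. \<tau> \<subset> V} - {\<sigma>}" using t Va by auto
    qed
  qed
  ultimately show ?case by blast
next
  case (step k V K w \<sigma>)
  note K = step.hyps(1) and w = step.hyps(2) and \<sigma> = step.hyps(3,4)
  note F = stacked_facts[OF K n]
  note max = stacked_facet_maximal[OF K n]
  let ?S = "stell K \<sigma> w"
  have st': "stacked n (Suc k) (insert w V) ?S" using step.hyps by (rule stacked.step)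
  note F' = stacked_facts[OF st' n]
  have wK: "w \<notin> \<tau>" if "\<tau> \<in> K" for \<tau> using F(4) that w by blast
  have ne: "\<sigma> \<noteq> {}" using \<sigma> n by auto
  have ball: "hcoh TYPE('k) (K - {\<sigma>'}) c = 0" if "\<sigma>' \<in> K" "card \<sigma>' = n" for \<sigma>' c
    using step.IH that by blast
  have VK: "restr K V = K" using F(4) by (intro restr_all) blast
  have "hcoh TYPE('k) (restr ?S J) n = 0" if J: "J \<subset> insert w V" for J
  proof (cases "w \<in> J")
    case True
    then have e: "insert w (J - {w}) = J" by auto
    have J': "J - {w} \<subset> V" using J True w by auto
    then have "J - {w} \<subseteq> V" by simp
    from hcoh_restr_stell_new[OF K n w \<sigma> this, of n, where 'k='k] step.IH J' n
    show ?thesis unfolding e by auto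
  next
    case False
    then have JV: "J \<subseteq> V" using J by auto
    show ?thesis
    proof (cases "J = V")
      case True
      then have "restr ?S J = K - {\<sigma>}" using restr_stell_1[OF False, of K \<sigma>] VK by simp
      then show ?thesis using ball[OF \<sigma>] by simp
    next
      case False
      then have "J \<subset> V" using JV by auto
      then show ?thesis using hcoh_restr_stell_old[OF K n w \<sigma>, of J n, where 'k='k] step.IH by auto
    qed
  qed
  moreover have "hcoh TYPE('k) (?S - {\<sigma>'}) c = 0" if \<sigma>': "\<sigma>' \<in> ?S" "card \<sigma>' = n" for \<sigma>' c
  proof -
    have cm: "cplx (?S - {\<sigma>'})"
      by (rule cplx_remove[OF F'(1)]) (use stacked_facet_maximal[OF st' n \<sigma>'(2)] in blast)
    show ?thesis
    proof (cases "w \<in> \<sigma>'")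
      case False
      then have s: "\<sigma>' \<in> K" "\<sigma>' \<noteq> \<sigma>" using \<sigma>' by (auto simp: stell_def)
      \<comment> \<open>An old facet may be removed before the subdivision, and the subdivision
        leaves the cohomology unchanged.\<close>
      have "?S - {\<sigma>'} = stell (K - {\<sigma>'}) \<sigma> w" using False by (auto simp: stell_def)
      moreover have "cplx (K - {\<sigma>'})" by (rule cplx_remove[OF F(1)]) (use max[OF \<sigma>'(2)] in blast)
      ultimately show ?thesis using hcoh_stell[of "K - {\<sigma>'}" \<sigma> w c, where 'k='k] \<sigma> ne s(2) max[OF \<sigma>(2)] wK ball[OF s(1) \<sigma>'(2)]
        by simp
    next
      case True
      then have "\<sigma>' \<notin> K" using wK by blast
      then obtain t where t: "t \<subset> \<sigma>" "\<sigma>' = insert w t" using \<sigma>' by (auto simp: stell_def)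
      have ws: "w \<notin> \<sigma>" using wK \<sigma> by blast
      have fs: "finite \<sigma>" "finite t" using F(1) \<sigma> t finite_subset[of t \<sigma>] by (auto simp: cplx_def)
      have "w \<notin> t" using ws t by auto
      then have "Suc (card t) = n" using \<sigma>'(2) t fs by simp
      then have "card (\<sigma> - t) = 1" using fs t \<sigma>(2) by (subst card_Diff_subset) auto
      then obtain a where a: "\<sigma> - t = {a}" by (auto simp: card_1_singleton_iff)
      have sa: "\<sigma> = insert a t" "a \<notin> t" using a t(1) by auto
      have ck: "cplx (K - {\<sigma>})" by (rule cplx_remove[OF F(1)]) (use max[OF \<sigma>(2)] in blast)
      \<comment> \<open>The removed facet is \<open>insert w t\<close>, where \<open>t\<close> omits
        only \<open>a\<close> from \<open>\<sigma>\<close>. Once it is gone, the sets that contain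
        \<open>w\<close> are paired by inserting or deleting \<open>a\<close>, so they do not change
        the cohomology of \<open>K - {\<sigma>}\<close>.\<close>
      have "hcoh TYPE('k) (?S - {\<sigma>'}) c = hcoh TYPE('k) (K - {\<sigma>}) c"
      proof (rule hcoh_toggle[OF ck cm, where a = a])
        show "K - {\<sigma>} \<subseteq> ?S - {\<sigma>'}" using \<open>\<sigma>' \<notin> K\<close> by (auto simp: stell_def)
        fix \<tau> assume \<tau>: "\<tau> \<in> ?S - {\<sigma>'} - (K - {\<sigma>})"
        then have "\<tau> \<in> insert w ` {\<tau>. \<tau> \<subset> \<sigma>}" unfolding stell_def by blast
        then obtain s where s: "s \<subset> \<sigma>" "\<tau> = insert w s" by blast
        have aw: "a \<noteq> w" using sa ws by auto
        have "s \<noteq> t" using \<tau> s t by auto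
        have in1: "insert w r \<in> ?S - {\<sigma>'} - (K - {\<sigma>})" if "r \<subset> \<sigma>" "r \<noteq> t" for r
        proof -
          have "insert w r \<notin> K" using wK by blast
          moreover have "insert w r \<noteq> \<sigma>'" using that t \<open>w \<notin> t\<close> ws by (metis Diff_insert_absorb psubsetD)
          ultimately show ?thesis using that unfolding stell_def by blast
        qed
        have "insert a s \<subset> \<sigma>" using s sa \<open>s \<noteq> t\<close> by auto
        moreover have "insert a s \<noteq> t" using sa by auto
        moreover have "s - {a} \<subset> \<sigma>" using s by auto
        moreover have "s - {a} \<noteq> t" using s sa \<open>s \<noteq> t\<close> by auto
        moreover have "insert a \<tau> = insert w (insert a s)" "\<tau> - {a} = insert w (s - {a})" using s aw by auto
        ultimately show "insert a \<tau> \<in> ?S - {\<sigma>'} - (K - {\<sigma>}) \<and> \<tau> - {a} \<in> ?S - {\<sigma>'} - (K - {\<sigma>})"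
          using in1 by simp
      qed
      then show ?thesis using ball[OF \<sigma>] by simp
    qed
  qed
  ultimately show ?case by blast
qed

lemma hcoh_stacked:
  assumes K: "stacked n k V K" and n: "n \<ge> 2" and \<sigma>: "\<sigma> \<in> K" "card \<sigma> = n"
  shows "hcoh TYPE('k::field) K c = (if c = n then 1 else 0)"
proof -
  note F = stacked_facts[OF K n]
  have m: "cplx (K - {\<sigma>})"
    by (rule cplx_remove[OF F(1)]) (use stacked_facet_maximal[OF K n \<sigma>(2)] in blast)
  have "hcoh TYPE('k) (K - {\<sigma>}) c = 0" for c using stacked_homology[OF K n, where 'k='k] \<sigma> by blast
  then show ?thesis
    using hcoh_sphere[OF _ F(1) m \<sigma>(1) _ hcoh_nonneg[OF F(1)], where 'k='k, of c] \<sigma>(2) n by simp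
qed

section \<open>Summation over vertex sets of a fixed size\<close>

definition betti_sum :: "'k::field itself \<Rightarrow> nat set set \<Rightarrow> nat set \<Rightarrow> nat \<Rightarrow> nat \<Rightarrow> int" where
  "betti_sum T K V c j = (\<Sum>J | J \<subseteq> V \<and> card J = j. hcoh T (restr K J) c)"

text \<open>At \<open>j = i + 1\<close> this is the first formula of the theorem. The product alone
  is -1 at \<open>j = 0\<close>; the second summand corrects this to 0, since the empty set of
  vertices has no component to count.\<close>

definition linear_strand :: "nat \<Rightarrow> nat \<Rightarrow> int" where
  "linear_strand k j = (int j - 1) * int ((k + 1) choose j) + (if j = 0 then 1 else 0)"

text \<open>Pascal's rule. The summand \<open>(k + 1) choose j\<close> counts the sets of
  \<open>j\<close> old vertices that miss the cut facet, and the final correction excludes the empty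
  set, which gains no component.\<close>

lemma linear_strand_Suc:
  "linear_strand (Suc k) (Suc j) = linear_strand k (Suc j) + linear_strand k j + int ((k + 1) choose j)
     - (if j = 0 then 1 else 0)"
  by (cases j) (simp_all add: linear_strand_def algebra_simps)

lemma linear_strand_0 [simp]: "linear_strand k 0 = 0"
  by (simp add: linear_strand_def)

lemma linear_strand_large: "j > k + 1 \<Longrightarrow> linear_strand k j = 0"
  by (simp add: linear_strand_def binomial_eq_0)

lemma sum_subsets_insert:
  fixes f :: "nat set \<Rightarrow> int"
  assumes "finite V" "w \<notin> V"
  shows "(\<Sum>J | J \<subseteq> insert w V \<and> card J = j. f J) = (\<Sum>J | J \<subseteq> V \<and> card J = j. f J)
    + (if j = 0 then 0 else \<Sum>J | J \<subseteq> V \<and> card J = j - 1. f (insert w J))"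
proof -
  let ?A = "{J. J \<subseteq> V \<and> card J = j}"
  let ?B = "if j = 0 then {} else insert w ` {J. J \<subseteq> V \<and> card J = j - 1}"
  have fin: "finite {J. J \<subseteq> V \<and> P J}" for P using assms(1) by simp
  have "{J. J \<subseteq> insert w V \<and> card J = j} = ?A \<union> ?B"
  proof (intro equalityI subsetI)
    fix J assume J: "J \<in> {J. J \<subseteq> insert w V \<and> card J = j}"
    then have fJ: "finite J" using assms(1) finite_subset[of J "insert w V"] by simp
    show "J \<in> ?A \<union> ?B"
    proof (cases "w \<in> J")
      case True
      then have "card J = Suc (card (J - {w}))" using card_Suc_Diff1[OF fJ True] by simp
      then have j: "j \<noteq> 0" and 1: "J - {w} \<in> {J. J \<subseteq> V \<and> card J = j - 1}" using J by auto
      have "J \<in> insert w ` {J. J \<subseteq> V \<and> card J = j - 1}"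
        by (rule image_eqI[OF _ 1]) (use True in auto)
      then show ?thesis using j by simp
    qed (use J in auto)
  next
    fix J assume J: "J \<in> ?A \<union> ?B"
    show "J \<in> {J. J \<subseteq> insert w V \<and> card J = j}"
    proof (cases "J \<in> ?A")
      case False
      then obtain I where I: "I \<subseteq> V" "card I = j - 1" "J = insert w I" "j \<noteq> 0" using J by (auto split: if_splits)
      then have "finite I" "w \<notin> I" using assms finite_subset[of I V] by auto
      then show ?thesis using I by auto
    qed auto
  qed
  moreover have "?A \<inter> ?B = {}" using assms(2) by auto
  moreover have "finite ?A" "finite ?B" using fin by auto
  ultimately have "(\<Sum>J | J \<subseteq> insert w V \<and> card J = j. f J) = sum f ?A + sum f ?B"
    by (metis (no_types, lifting) sum.union_disjoint)
  moreover have "sum f (insert w ` {J. J \<subseteq> V \<and> card J = j - 1}) = (\<Sum>J | J \<subseteq> V \<and> card J = j - 1. f (insert w J))"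
  proof (rule sum.reindex_cong[of "insert w"])
    show "inj_on (insert w) {J. J \<subseteq> V \<and> card J = j - 1}"
      using assms(2) by (intro inj_onI) (metis (mono_tags) insert_ident mem_Collect_eq subsetD)
  qed auto
  ultimately show ?thesis by auto
qed

lemma sum_of_bool_card:
  assumes "finite A"
  shows "(\<Sum>J\<in>A. if P J then (1::int) else 0) = int (card {J\<in>A. P J})"
  using assms by (simp add: sum.If_cases Int_def)

text \<open>The values in degrees 1 and \<open>n - 1\<close> mirror each other, as Alexander duality
  in the sphere predicts. Here both come from the same recursion: the first counts sets that miss
  the cut facet, the second counts sets that contain it by their complements.\<close>

lemma betti_sum_stacked:
  assumes "stacked n k V K" and n: "n \<ge> 3" and "j \<le> n + k + 1"
  shows "betti_sum TYPE('k::field) K V c j =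
    (if c = 0 then (if j = 0 then 1 else 0) else if c = 1 then linear_strand k j
     else if c + 1 = n then linear_strand k (n + k + 1 - j)
     else if c = n \<and> j = n + k + 1 then 1 else 0)"
  using assms(1,3)
proof (induction arbitrary: j)
  case (base V)
  have st: "stacked n 0 V {\<tau>. \<tau> \<subset> V}" using base(1,2) by (rule stacked.base)
  let ?K = "{\<tau>. \<tau> \<subset> V}"
  obtain v where v: "v \<in> V" using base(2) by fastforce
  have h: "hcoh TYPE('k) (restr ?K J) c = (if J = V then (if c = n then 1 else 0) else if J = {} \<and> c = 0 then 1 else 0)"
    if "J \<subseteq> V" for J
  proof (cases "J = V")
    case True
    have "V - {v} \<in> ?K" "card (V - {v}) = n" using v base by auto
    moreover have "restr ?K V = ?K" by (auto simp: restr_def)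
    ultimately show ?thesis using hcoh_stacked[OF st _ , of "V - {v}" c, where 'k='k] n True by simp
  next
    case False
    have "restr ?K J = Pow J" using that False by (auto simp: restr_def)
    moreover have "finite J" using that base finite_subset by auto
    ultimately show ?thesis using False hcoh_simplex[of J c, where 'k='k] by simp
  qed
  have "betti_sum TYPE('k) ?K V c j = (\<Sum>J | J \<subseteq> V \<and> card J = j.
      if J = V then (if c = n then 1 else 0) else if J = {} \<and> c = 0 then 1 else 0)"
    unfolding betti_sum_def using h by (intro sum.cong) auto
  also have "\<dots> = (if (j = n + 1 \<and> c = n) \<or> (j = 0 \<and> c = 0) then 1 else 0)"
  proof -
    consider "j = 0" | "j = n + 1" | "j \<noteq> 0" "j \<noteq> n + 1" by blast
    then show ?thesis
    proof cases
      case 1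
      have "{J. J \<subseteq> V \<and> card J = j} = {{}}" using base 1 finite_subset[of _ V] by (auto simp: card_eq_0_iff)
      moreover have "{} \<noteq> V" using v by auto
      ultimately show ?thesis using 1 by simp
    next
      case 2
      have "{J. J \<subseteq> V \<and> card J = j} = {V}" using base 2 card_subset_eq[of V] by auto
      moreover have "V \<noteq> {}" using v by auto
      ultimately show ?thesis using 2 by simp
    next
      case 3
      then show ?thesis using base by (intro trans[OF sum.neutral]) auto
    qed
  qed
  finally have e: "betti_sum TYPE('k) ?K V c j = (if (j = n + 1 \<and> c = n) \<or> (j = 0 \<and> c = 0) then 1 else 0)" .
  \<comment> \<open>Both strands are empty for the boundary of a simplex: the factor vanishes at 1,
    the correction acts at 0, and the binomial vanishes beyond.\<close>
  have "linear_strand 0 i = 0" for i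
  proof -
    have "i = 0 \<or> i = 1 \<or> i > 1" by auto
    then show ?thesis by (auto simp: linear_strand_def)
  qed
  then show ?case using e n by auto
next
  case (step k V K w \<sigma>)
  note K = step.hyps(1) and w = step.hyps(2) and \<sigma> = step.hyps(3,4)
  have n2: "n \<ge> 2" using n by simp
  note F = stacked_facts[OF K n2]
  define m where "m = n + k + 1"
  have cV: "card V = m" using F(3) m_def by simp
  let ?S = "stell K \<sigma> w"
  have fin: "finite {J. J \<subseteq> V \<and> P J}" for P using F(2) by simp
  have s\<sigma>: "\<sigma> \<subseteq> V" using F(4) \<sigma> by blast
  have cd: "card (V - \<sigma>) = k + 1" using s\<sigma> \<sigma>(2) cV F(2) finite_subset by (subst card_Diff_subset) (auto simp: m_def)
  have VK: "restr K V = K" using F(4) by (intro restr_all) blast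
  have hV: "hcoh TYPE('k) (restr K V) c = (if c = n then 1 else 0)"
    using hcoh_stacked[OF K n2 \<sigma>, where 'k='k] VK by simp
  \<comment> \<open>The correction at \<open>J = V\<close> undoes two terms: the top class of the
    whole sphere is lost, and the general increment for sets that contain \<open>\<sigma>\<close>
    does not occur, because the sphere minus a facet is acyclic.\<close>
  have old: "hcoh TYPE('k) (restr ?S J) c = hcoh TYPE('k) (restr K J) c
      + (if \<sigma> \<subseteq> J then if c + 1 = n then 1 else 0 else 0) - (if J = V then if c = n \<or> c + 1 = n then 1 else 0 else 0)" if J: "J \<subseteq> V" for J
  proof (cases "J = V")
    case True
    have "restr ?S V = K - {\<sigma>}" using restr_stell_1[of w V K \<sigma>] w VK by simp
    then have "hcoh TYPE('k) (restr ?S V) c = 0" using stacked_homology[OF K n2, where 'k='k] \<sigma> by simp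
    then show ?thesis using True hV s\<sigma> by auto
  next
    case False
    then have "J \<subset> V" using J by auto
    then show ?thesis using hcoh_restr_stell_old[OF K n2 w \<sigma> \<open>J \<subset> V\<close>, of c, where 'k='k]
        stacked_homology[OF K n2, where 'k='k] False by auto
  qed
  \<comment> \<open>The correction at the empty set undoes two terms: the class of
    \<open>{{}}\<close> in degree 0 disappears, and the single new vertex does not count as an
    additional component.\<close>
  have new: "hcoh TYPE('k) (restr ?S (insert w J)) c = hcoh TYPE('k) (restr K J) c
      + (if J \<subseteq> V - \<sigma> then if c = 1 then 1 else 0 else 0) - (if J = {} then if c = 0 \<or> c = 1 then 1 else 0 else 0)" if J: "J \<subseteq> V" for J
  proof -
    have "restr K {} = {{}}" using F(5) by (auto simp: restr_def)
    then have "hcoh TYPE('k) (restr K {}) c = (if c = 0 then 1 else 0)" using hcoh_empty_face[of c, where 'k='k] by simp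
    moreover have "\<sigma> \<inter> J = {} \<longleftrightarrow> J \<subseteq> V - \<sigma>" using J by auto
    ultimately show ?thesis using hcoh_restr_stell_new[OF K n2 w \<sigma> J, of c, where 'k='k] by auto
  qed
  have s1: "(\<Sum>J | J \<subseteq> V \<and> card J = i. hcoh TYPE('k) (restr ?S J) c) = betti_sum TYPE('k) K V c i
     + (if c + 1 = n then int ((k + 1) choose (m - i)) else 0) - (if i = m then if c = n \<or> c + 1 = n then 1 else 0 else 0)"
    if i: "i \<le> m" for i
  proof -
    let ?A = "{J. J \<subseteq> V \<and> card J = i}"
    \<comment> \<open>Sets that contain \<open>\<sigma>\<close> are counted by their complements,
      which lie among the \<open>k + 1\<close> vertices off \<open>\<sigma>\<close>.\<close>
    have "bij_betw (\<lambda>J. V - J) {J\<in>?A. \<sigma> \<subseteq> J} {L. L \<subseteq> V - \<sigma> \<and> card L = m - i}"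
    proof (rule bij_betw_byWitness[where f' = "\<lambda>J. V - J"])
      show "(\<lambda>J. V - J) ` {J\<in>?A. \<sigma> \<subseteq> J} \<subseteq> {L. L \<subseteq> V - \<sigma> \<and> card L = m - i}"
      proof
        fix L assume "L \<in> (\<lambda>J. V - J) ` {J\<in>?A. \<sigma> \<subseteq> J}"
        then obtain J where J: "J \<subseteq> V" "card J = i" "\<sigma> \<subseteq> J" "L = V - J" by blast
        then have "finite J" using F(2) finite_subset by auto
        then show "L \<in> {L. L \<subseteq> V - \<sigma> \<and> card L = m - i}" using J cV by (auto simp: card_Diff_subset)
      qed
      show "(\<lambda>J. V - J) ` {L. L \<subseteq> V - \<sigma> \<and> card L = m - i} \<subseteq> {J\<in>?A. \<sigma> \<subseteq> J}"
      proof
        fix J assume "J \<in> (\<lambda>J. V - J) ` {L. L \<subseteq> V - \<sigma> \<and> card L = m - i}"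
        then obtain L where L: "L \<subseteq> V - \<sigma>" "card L = m - i" "J = V - L" by blast
        then have "L \<subseteq> V" "finite L" using F(2) finite_subset by auto
        then show "J \<in> {J\<in>?A. \<sigma> \<subseteq> J}" using L cV i s\<sigma> by (auto simp: card_Diff_subset)
      qed
    qed auto
    then have c1: "int (card {J\<in>?A. \<sigma> \<subseteq> J}) = int ((k + 1) choose (m - i))"
      using bij_betw_same_card n_subsets[of "V - \<sigma>" "m - i"] F(2) cd by fastforce
    have "{J\<in>?A. J = V} = (if i = m then {V} else {})" using cV by auto
    then have c2: "int (card {J\<in>?A. J = V}) = (if i = m then 1 else 0)" by simp
    have "(\<Sum>J\<in>?A. hcoh TYPE('k) (restr ?S J) c) = (\<Sum>J\<in>?A. hcoh TYPE('k) (restr K J) c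
      + (if c + 1 = n then 1 else 0) * (if \<sigma> \<subseteq> J then 1 else 0) - (if c = n \<or> c + 1 = n then 1 else 0) * (if J = V then 1 else 0))"
      using old by (intro sum.cong) auto
    then show ?thesis
      by (simp add: sum.distrib sum_subtractf sum_of_bool_card[OF fin, simplified] c1[simplified] c2[simplified] betti_sum_def flip: sum_distrib_left)
  qed
  have s2: "(\<Sum>J | J \<subseteq> V \<and> card J = i. hcoh TYPE('k) (restr ?S (insert w J)) c) = betti_sum TYPE('k) K V c i
     + (if c = 1 then int ((k + 1) choose i) else 0) - (if i = 0 then if c = 0 \<or> c = 1 then 1 else 0 else 0)" for i
  proof -
    let ?A = "{J. J \<subseteq> V \<and> card J = i}"
    have "{J\<in>?A. J \<subseteq> V - \<sigma>} = {J. J \<subseteq> V - \<sigma> \<and> card J = i}" by auto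
    then have c1: "int (card {J\<in>?A. J \<subseteq> V - \<sigma>}) = int ((k + 1) choose i)"
      using n_subsets[of "V - \<sigma>" i] F(2) cd by simp
    have "{J\<in>?A. J = {}} = (if i = 0 then {{}} else {})" by auto
    then have c2: "int (card {J\<in>?A. J = {}}) = (if i = 0 then 1 else 0)" by simp
    have "(\<Sum>J\<in>?A. hcoh TYPE('k) (restr ?S (insert w J)) c) = (\<Sum>J\<in>?A. hcoh TYPE('k) (restr K J) c
      + (if c = 1 then 1 else 0) * (if J \<subseteq> V - \<sigma> then 1 else 0) - (if c = 0 \<or> c = 1 then 1 else 0) * (if J = {} then 1 else 0))"
      using new by (intro sum.cong) auto
    then show ?thesis
      by (simp add: sum.distrib sum_subtractf sum_of_bool_card[OF fin, simplified] c1[simplified] c2[simplified] betti_sum_def flip: sum_distrib_left)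
  qed
  have IH: "i \<le> m \<Longrightarrow> betti_sum TYPE('k) K V c i = (if c = 0 then (if i = 0 then 1 else 0) else if c = 1 then linear_strand k i
     else if c + 1 = n then linear_strand k (m - i) else if c = n \<and> i = m then 1 else 0)" for i
    using step.IH[of i] by (simp add: m_def)
  have eS: "betti_sum TYPE('k) ?S (insert w V) c j = (\<Sum>J | J \<subseteq> V \<and> card J = j. hcoh TYPE('k) (restr ?S J) c)
    + (if j = 0 then 0 else \<Sum>J | J \<subseteq> V \<and> card J = j - 1. hcoh TYPE('k) (restr ?S (insert w J)) c)"
    unfolding betti_sum_def by (rule sum_subsets_insert[OF F(2) w])
  have ls: "linear_strand k m = 0" "linear_strand k (Suc m) = 0" "(k + 1) choose m = 0"
    using n by (auto simp: linear_strand_large m_def)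
  have jm: "j \<le> Suc m" using step.prems by (simp add: m_def)
  have m': "n + Suc k + 1 = Suc m" by (simp add: m_def)
  show ?case
  proof (cases "j = 0")
    case True
    have "linear_strand (Suc k) (Suc m) = 0" using n by (simp add: linear_strand_large m_def)
    moreover have "m > 0" by (simp add: m_def)
    ultimately show ?thesis unfolding eS m' using s1[of j] IH[of j] True n ls by auto
  next
    case j0: False
    then obtain i where i: "j = Suc i" by (cases j) auto
    show ?thesis
    proof (cases "j = Suc m")
      case True
      have "(\<Sum>J | J \<subseteq> V \<and> card J = j. hcoh TYPE('k) (restr ?S J) c) = 0"
      proof -
        have "{J. J \<subseteq> V \<and> card J = j} = {}" 
        proof (intro equals0I)
          fix J assume "J \<in> {J. J \<subseteq> V \<and> card J = j}"
          then show False using card_mono[OF F(2), of J] True cV by simp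
        qed
        then show ?thesis by (simp only: sum.empty)
      qed
      moreover have "m > 0" "m \<noteq> 0" by (auto simp: m_def)
      ultimately show ?thesis unfolding eS m' using s2[of m] IH[of m] True n ls linear_strand_Suc[of k m] by auto
    next
      case False
      then have jm: "j \<le> m" using jm by simp
      then have e: "Suc m - j = Suc (m - j)" "m - (j - 1) = Suc (m - j)" "j - 1 \<le> m" "m - j = 0 \<longleftrightarrow> j = m" using j0 by auto
      have i2: "m - i = Suc (m - j)" "m - Suc i = m - j" using i e by auto
      \<comment> \<open>After the cut the complementary size is \<open>Suc m - j = Suc x\<close>.
        The induction hypothesis is read at \<open>x\<close> for \<open>j\<close> and at
        \<open>Suc x\<close> for \<open>j - 1\<close>, which are the two arguments in
        \<open>linear_strand_Suc\<close>.\<close>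
      define x where "x = m - j"
      have x: "x = 0 \<longleftrightarrow> j = m" "Suc m - j = Suc x" "m - (j - 1) = Suc x" using e x_def by auto
      note S1 = s1[OF jm, folded x_def] and S2 = s2[of "j - 1"]
      note I1 = IH[OF jm, folded x_def] and I2 = IH[OF e(3), unfolded x(3)]
      have L: "linear_strand (Suc k) (Suc x) = linear_strand k (Suc x) + linear_strand k x + int ((k + 1) choose x)
          - (if j = m then 1 else 0)"
        using linear_strand_Suc[of k x] x(1) by simp
      have L1: "linear_strand (Suc k) j = linear_strand k j + linear_strand k (j - 1) + int ((k + 1) choose (j - 1))
          - (if j = 1 then 1 else 0)"
        using linear_strand_Suc[of k i] i by simp
      have j1: "j - 1 = 0 \<longleftrightarrow> j = 1" "j - 1 = m \<longleftrightarrow> j = Suc m" using j0 by auto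
      consider "c = 0" | "c = 1" | "c + 1 = n" | "c = n" | "c \<noteq> 0" "c \<noteq> 1" "c + 1 \<noteq> n" "c \<noteq> n" by blast
      then show ?thesis
        unfolding eS m' if_not_P[OF j0] S1 S2 I1 I2 x(2) j1
        by cases (use n j0 jm L L1 in \<open>simp_all del: binomial_Suc_Suc\<close>)
    qed
  qed
qed

section \<open>Vertex cuts of simple polytopes\<close>

text \<open>The halfspaces themselves index their normals and offsets. Irredundancy puts them in
  bijection with the facets (\<open>irredundant_rep_facet\<close>,
  \<open>irredundant_rep_inj\<close>), so simplices of the nerve can be described by sets of
  halfspaces.\<close>

definition irredundant_rep :: "'a::euclidean_space set \<Rightarrow> 'a set set \<Rightarrow> ('a set \<Rightarrow> 'a) \<Rightarrow> ('a set \<Rightarrow> real) \<Rightarrow> bool" where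
  "irredundant_rep P H a b \<longleftrightarrow> finite H \<and> P = affine hull P \<inter> \<Inter>H \<and>
     (\<forall>h\<in>H. a h \<noteq> 0 \<and> h = {x. a h \<bullet> x \<le> b h}) \<and> (\<forall>H'. H' \<subset> H \<longrightarrow> P \<subset> affine hull P \<inter> \<Inter>H')"

lemma irredundant_rep_exists:
  assumes "polyhedron P"
  obtains H a b where "irredundant_rep P H a b"
proof -
  obtain H where H: "finite H" "P = affine hull P \<inter> \<Inter>H"
      "\<forall>h\<in>H. \<exists>a b. a \<noteq> 0 \<and> h = {x. a \<bullet> x \<le> b}" "\<forall>H'. H' \<subset> H \<longrightarrow> P \<subset> affine hull P \<inter> \<Inter>H'"
    using assms by (simp add: polyhedron_Int_affine_minimal) meson
  then obtain a b where "\<And>h. h \<in> H \<Longrightarrow> a h \<noteq> 0 \<and> h = {x. a h \<bullet> x \<le> b h}"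
    by metis
  with H have "irredundant_rep P H a b" unfolding irredundant_rep_def by simp
  then show ?thesis by (rule that)
qed

lemma irredundant_rep_mem:
  assumes "irredundant_rep P H a b"
  shows "x \<in> P \<longleftrightarrow> x \<in> affine hull P \<and> (\<forall>h\<in>H. a h \<bullet> x \<le> b h)"
proof -
  have P: "P = affine hull P \<inter> \<Inter>H" and h: "\<And>h. h \<in> H \<Longrightarrow> h = {x. a h \<bullet> x \<le> b h}"
    using assms by (auto simp: irredundant_rep_def)
  have "x \<in> h \<longleftrightarrow> a h \<bullet> x \<le> b h" if "h \<in> H" for h using h[OF that] by (metis mem_Collect_eq)
  then have "x \<in> \<Inter>H \<longleftrightarrow> (\<forall>h\<in>H. a h \<bullet> x \<le> b h)" by auto
  then show ?thesis by (subst P) simp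
qed

lemma irredundant_rep_subset:
  assumes "irredundant_rep P H a b" "h \<in> H"
  shows "P \<subseteq> h"
proof -
  have "P = affine hull P \<inter> \<Inter>H" using assms by (auto simp: irredundant_rep_def)
  then have "P \<subseteq> \<Inter>H" by (metis inf_le2)
  then show ?thesis using assms(2) by blast
qed

lemma irredundant_rep_facet:
  assumes "irredundant_rep P H a b"
  shows "C facet_of P \<longleftrightarrow> (\<exists>h\<in>H. C = P \<inter> {x. a h \<bullet> x = b h})"
proof -
  have "C facet_of P \<longleftrightarrow> (\<exists>h. h \<in> H \<and> C = P \<inter> {x. a h \<bullet> x = b h})"
    by (rule facet_of_polyhedron_explicit) (use assms in \<open>simp_all add: irredundant_rep_def\<close>)
  then show ?thesis by auto
qed

text \<open>Omitting \<open>h\<close> enlarges the polyhedron, and any point gained violates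
  \<open>h\<close> and no other inequality.\<close>

lemma irredundant_rep_violated:
  assumes "irredundant_rep P H a b" "h \<in> H"
  obtains y where "y \<in> affine hull P" "a h \<bullet> y > b h" "\<And>g. g \<in> H \<Longrightarrow> g \<noteq> h \<Longrightarrow> a g \<bullet> y \<le> b g"
proof -
  have g: "x \<in> g \<longleftrightarrow> a g \<bullet> x \<le> b g" if "g \<in> H" for g x
    using assms that unfolding irredundant_rep_def by (metis mem_Collect_eq)
  have "H - {h} \<subset> H" using assms(2) by auto
  then have "P \<subset> affine hull P \<inter> \<Inter>(H - {h})"
    using assms(1) by (simp add: irredundant_rep_def)
  then obtain y where y: "y \<in> affine hull P" "y \<in> \<Inter>(H - {h})" "y \<notin> P" by auto
  have o: "a f \<bullet> y \<le> b f" if "f \<in> H" "f \<noteq> h" for f using g[OF that(1)] y(2) that by auto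
  moreover have "\<not> a h \<bullet> y \<le> b h" using o y irredundant_rep_mem[OF assms(1), of y] by metis
  ultimately show ?thesis using that y(1) by auto
qed

text \<open>The segment from a relative interior point \<open>p\<close> to a point \<open>y\<close>
  that violates only \<open>g\<close> crosses the hyperplane of \<open>g\<close> at a point
  \<open>z\<close> where all other inequalities are strict. So \<open>z\<close> lies on the facet of
  \<open>g\<close> and on no other.\<close>

lemma irredundant_rep_inj:
  assumes rep: "irredundant_rep P H a b" and "P \<noteq> {}" and P: "convex P"
  shows "inj_on (\<lambda>h. P \<inter> {x. a h \<bullet> x = b h}) H"
proof (rule inj_onI, rule ccontr)
  fix g h assume g: "g \<in> H" and h: "h \<in> H" and eq: "P \<inter> {x. a g \<bullet> x = b g} = P \<inter> {x. a h \<bullet> x = b h}" and "g \<noteq> h"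
  have "rel_interior P = {x \<in> P. \<forall>h\<in>H. a h \<bullet> x < b h}"
    by (rule rel_interior_polyhedron_explicit) (use rep in \<open>simp_all add: irredundant_rep_def\<close>)
  moreover have "rel_interior P \<noteq> {}" using assms by (simp add: rel_interior_eq_empty)
  ultimately obtain p where p: "p \<in> P" "\<forall>h\<in>H. a h \<bullet> p < b h" by blast
  obtain y where y: "y \<in> affine hull P" "a g \<bullet> y > b g" "\<And>f. f \<in> H \<Longrightarrow> f \<noteq> g \<Longrightarrow> a f \<bullet> y \<le> b f"
    using irredundant_rep_violated[OF rep g] by metis
  define u where "u = (b g - a g \<bullet> p) / (a g \<bullet> y - a g \<bullet> p)"
  have gp: "a g \<bullet> p < b g" using p g by blast
  then have u: "0 < u" "u < 1" using y(2) by (auto simp: u_def field_simps)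
  define z where "z = (1 - u) *\<^sub>R p + u *\<^sub>R y"
  have az: "a f \<bullet> z = (1 - u) * (a f \<bullet> p) + u * (a f \<bullet> y)" for f by (simp add: z_def inner_add_right)
  have zg: "a g \<bullet> z = b g"
  proof -
    have "a g \<bullet> z = a g \<bullet> p + u * (a g \<bullet> y - a g \<bullet> p)" by (simp add: az algebra_simps)
    also have "u * (a g \<bullet> y - a g \<bullet> p) = b g - a g \<bullet> p" using gp y(2) by (simp add: u_def)
    finally show ?thesis by simp
  qed
  have zf: "a f \<bullet> z < b f" if "f \<in> H" "f \<noteq> g" for f
  proof -
    have "(1 - u) * (a f \<bullet> p) < (1 - u) * b f" using p that u by simp
    moreover have "u * (a f \<bullet> y) \<le> u * b f" using y(3)[OF that] u by simp
    ultimately show ?thesis unfolding az by (simp add: algebra_simps)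
  qed
  have "z \<in> affine hull P"
    unfolding z_def using p(1) y(1) by (intro mem_affine[OF affine_affine_hull]) (auto intro: hull_inc)
  then have "z \<in> P" using irredundant_rep_mem[OF rep, of z] zf zg by (metis less_eq_real_def)
  then have "a h \<bullet> z = b h" using eq zg by blast
  then show False using zf[OF h] \<open>g \<noteq> h\<close> by fastforce
qed

text \<open>The vectors of \<open>L\<close> and those orthogonal to \<open>A\<close> meet in
  dimension at least \<open>dim L - card A\<close>.\<close>

lemma orthogonal_vector_exists:
  fixes L :: "'a::euclidean_space set"
  assumes L: "subspace L" and A: "finite A" "card A < dim L"
  obtains u where "u \<in> L" "u \<noteq> 0" "\<And>a. a \<in> A \<Longrightarrow> a \<bullet> u = 0"
proof -
  define T where "T = {y::'a. \<forall>x\<in>span A. orthogonal x y}"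
  have T: "subspace T" by (auto simp: T_def subspace_def orthogonal_def inner_add_right)
  have "dim T + dim (span A) = DIM('a)"
    using dim_subspace_orthogonal_to_vectors[of "span A" UNIV] by (simp add: T_def)
  moreover have "dim (span A) \<le> card A" using A(1) dim_le_card' by simp
  moreover have "dim {x + y |x y. x \<in> L \<and> y \<in> T} + dim (L \<inter> T) = dim L + dim T"
    by (rule dim_sums_Int[OF L T])
  moreover have "dim {x + y |x y. x \<in> L \<and> y \<in> T} \<le> DIM('a)" by (rule dim_subset_UNIV)
  ultimately have "dim (L \<inter> T) \<noteq> 0" using A(2) by linarith
  then obtain u where "u \<in> L" "u \<in> T" "u \<noteq> 0" by (auto simp: dim_eq_0)
  then show ?thesis using that by (auto simp: T_def orthogonal_def span_base)
qed

text \<open>Omitting \<open>h0\<close> leaves fewer tight constraints than the dimension, so some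
  direction in the affine hull keeps all of them tight. Its sign is chosen to point to the inner
  side of \<open>h0\<close>, and a short step violates no slack constraint. This is the edge at
  \<open>v\<close> opposite to the facet of \<open>h0\<close>.\<close>

lemma simple_vertex_edge:
  assumes rep: "irredundant_rep P H a b" and v: "v \<in> P"
    and card: "int (card {h\<in>H. a h \<bullet> v = b h}) = aff_dim P"
    and h0: "h0 \<in> H" "a h0 \<bullet> v = b h0"
  obtains x where "x \<in> P" "x \<noteq> v" "\<And>h. h \<in> H \<Longrightarrow> a h \<bullet> v = b h \<Longrightarrow> h \<noteq> h0 \<Longrightarrow> a h \<bullet> x = b h"
proof -
  let ?I = "{h\<in>H. a h \<bullet> v = b h}"
  let ?L = "(\<lambda>x. (- v) + x) ` (affine hull P)"
  have fin: "finite H" using rep by (simp add: irredundant_rep_def)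
  have va: "v \<in> affine hull P" using v by (rule hull_inc)
  have L: "subspace ?L" by (rule affine_diffs_subspace[OF affine_affine_hull va])
  have dL: "int (dim ?L) = aff_dim P" using aff_dim_eq_dim[of v "affine hull P"] va by (simp add: hull_hull)
  have "card (a ` (?I - {h0})) \<le> card (?I - {h0})" using fin by (intro card_image_le) auto
  also have "\<dots> < card ?I" using h0 fin by (intro card_Diff1_less) auto
  finally have "card (a ` (?I - {h0})) < dim ?L" using card dL by linarith
  then obtain u0 where u0: "u0 \<in> ?L" "u0 \<noteq> 0" "\<And>c. c \<in> a ` (?I - {h0}) \<Longrightarrow> c \<bullet> u0 = 0"
    using orthogonal_vector_exists[OF L, of "a ` (?I - {h0})"] fin by auto
  define u where "u = (if a h0 \<bullet> u0 \<le> 0 then u0 else - u0)"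
  have u: "u \<in> ?L" "u \<noteq> 0" "a h0 \<bullet> u \<le> 0" "\<And>h. h \<in> ?I - {h0} \<Longrightarrow> a h \<bullet> u = 0"
    using u0 subspace_neg[OF L u0(1)] by (auto simp: u_def)
  have "eventually (\<lambda>e. \<forall>h\<in>H - ?I. a h \<bullet> (v + e *\<^sub>R u) < b h) (at_right (0::real))"
  proof (rule eventually_ball_finite)
    show "\<forall>h\<in>H - ?I. eventually (\<lambda>e. a h \<bullet> (v + e *\<^sub>R u) < b h) (at_right 0)"
    proof
      fix h assume h: "h \<in> H - ?I"
      then have "a h \<bullet> v < b h" using irredundant_rep_mem[OF rep] v by (auto simp: less_le)
      moreover have "((\<lambda>e. a h \<bullet> (v + e *\<^sub>R u)) \<longlongrightarrow> a h \<bullet> (v + 0 *\<^sub>R u)) (at_right 0)"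
        by (intro tendsto_intros)
      ultimately show "eventually (\<lambda>e. a h \<bullet> (v + e *\<^sub>R u) < b h) (at_right 0)"
        by (intro order_tendstoD(2)) auto
    qed
  qed (use fin in auto)
  moreover have "eventually (\<lambda>e. 0 < e) (at_right (0::real))" by (rule eventually_at_right_less)
  ultimately have "eventually (\<lambda>e. 0 < e \<and> (\<forall>h\<in>H - ?I. a h \<bullet> (v + e *\<^sub>R u) < b h)) (at_right (0::real))"
    by eventually_elim auto
  then obtain e :: real where e: "e > 0" "\<forall>h\<in>H - ?I. a h \<bullet> (v + e *\<^sub>R u) < b h"
    using eventually_happens trivial_limit_at_right_real by blast
  let ?x = "v + e *\<^sub>R u"
  have eq: "a h \<bullet> ?x = b h" if "h \<in> H" "a h \<bullet> v = b h" "h \<noteq> h0" for h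
    using u(4)[of h] that by (simp add: inner_add_right)
  have "e *\<^sub>R u \<in> ?L" using u(1) L by (rule_tac subspace_scale)
  then have "?x \<in> affine hull P" by auto
  moreover have "a h \<bullet> ?x \<le> b h" if "h \<in> H" for h
  proof (cases "h = h0")
    case True
    then show ?thesis using u(3) e(1) h0 by (simp add: inner_add_right mult_nonneg_nonpos)
  next
    case False
    show ?thesis
    proof (cases "a h \<bullet> v = b h")
      case True
      then show ?thesis using eq[OF that True False] by simp
    next
      case False
      then have "h \<in> H - ?I" using that by simp
      then show ?thesis using e(2) less_imp_le by blast
    qed
  qed
  ultimately have "?x \<in> P" using irredundant_rep_mem[OF rep] by blast
  moreover have "?x \<noteq> v" using e(1) u(2) by simp
  ultimately show ?thesis using that eq by blast
qed

section \<open>Faces and their position relative to the cutting hyperplane\<close>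

lemma linear_form_less_aux:
  fixes c g y :: "'a::euclidean_space"
  assumes "c \<bullet> g < d"
  obtains e where "0 < e" "e < 1" "c \<bullet> (g + e *\<^sub>R (y - g)) < d"
proof -
  have "((\<lambda>e. c \<bullet> (g + e *\<^sub>R (y - g))) \<longlongrightarrow> c \<bullet> (g + 0 *\<^sub>R (y - g))) (at_right 0)"
    by (intro tendsto_intros)
  then have "eventually (\<lambda>e. c \<bullet> (g + e *\<^sub>R (y - g)) < d) (at_right 0)"
    using assms by (intro order_tendstoD(2)) auto
  moreover have "eventually (\<lambda>e. 0 < e \<and> e < 1) (at_right (0::real))"
    unfolding eventually_at_right_field by (intro exI[of _ 1]) auto
  ultimately have "eventually (\<lambda>e. 0 < e \<and> e < 1 \<and> c \<bullet> (g + e *\<^sub>R (y - g)) < d) (at_right (0::real))"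
    by eventually_elim auto
  then show ?thesis
    using that eventually_happens trivial_limit_at_right_real by blast
qed

lemma polytope_eq_vertex_hull: "polytope (E :: 'a::euclidean_space set) \<Longrightarrow> E = convex hull {x. x extreme_point_of E}"
  by (rule Krein_Milman_Minkowski) (auto simp: polytope_imp_compact polytope_imp_convex)

lemma vertex_below:
  fixes E :: "'a::euclidean_space set"
  assumes E: "polytope E" "E \<noteq> {}" "E \<noteq> {v}"
    and below: "\<And>w. w extreme_point_of E \<Longrightarrow> w \<noteq> v \<Longrightarrow> c \<bullet> w < d"
  obtains x where "x \<in> E" "c \<bullet> x < d"
proof (cases "\<exists>w. w extreme_point_of E \<and> w \<noteq> v")
  case True
  then show ?thesis using that below by (auto simp: extreme_point_of_def)
next
  case False
  then have s: "{x. x extreme_point_of E} \<subseteq> {v}" by auto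
  then have "convex hull {x. x extreme_point_of E} \<subseteq> {v}" using hull_mono[OF s, of convex] by simp
  then have "E \<subseteq> {v}" using polytope_eq_vertex_hull[OF E(1)] by simp
  then show ?thesis using E by blast
qed

lemma all_vertices_below:
  fixes E :: "'a::euclidean_space set"
  assumes E: "polytope E" and x: "x \<in> E"
    and below: "\<And>w. w extreme_point_of E \<Longrightarrow> c \<bullet> w < d"
  shows "c \<bullet> x < d"
proof -
  have "{x. x extreme_point_of E} \<subseteq> {x. c \<bullet> x < d}" using below by auto
  then have "convex hull {x. x extreme_point_of E} \<subseteq> {x. c \<bullet> x < d}"
    by (rule hull_minimal) (rule convex_halfspace_lt)
  then show ?thesis using polytope_eq_vertex_hull[OF E] x by auto
qed

lemma segment_meets_hyperplane:
  fixes E :: "'a::euclidean_space set"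
  assumes E: "convex E" and x: "x \<in> E" "c \<bullet> x < d" and v: "v \<in> E" "c \<bullet> v > d"
  obtains z where "z \<in> E" "c \<bullet> z = d"
proof -
  define t where "t = (d - c \<bullet> x) / (c \<bullet> v - c \<bullet> x)"
  have t: "0 < t" "t < 1" using x v by (auto simp: t_def field_simps)
  have "t * (c \<bullet> v - c \<bullet> x) = d - c \<bullet> x" using x v by (simp add: t_def)
  then have "c \<bullet> ((1 - t) *\<^sub>R x + t *\<^sub>R v) = d" by (simp add: inner_add_right algebra_simps)
  moreover have "(1 - t) *\<^sub>R x + t *\<^sub>R v \<in> E" using E x v t by (intro convexD) auto
  ultimately show ?thesis using that by blast
qed

locale cut_vertex =
  fixes P :: "'a::euclidean_space set" and H a b n v c d
  assumes poly: "polytope P" and rep: "irredundant_rep P H a b" and n: "n \<ge> 2" and dim: "aff_dim P = int n"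
    and vex: "v extreme_point_of P" and simple: "card {G. G facet_of P \<and> v \<in> G} = n"
    and c0: "c \<noteq> 0" and cv: "c \<bullet> v > d" and cw: "\<And>w. w extreme_point_of P \<Longrightarrow> w \<noteq> v \<Longrightarrow> c \<bullet> w < d"
begin

abbreviation "facet h \<equiv> P \<inter> {x. a h \<bullet> x = b h}"
abbreviation "Q \<equiv> P \<inter> {x. c \<bullet> x \<le> d}"
abbreviation "N \<equiv> {x. c \<bullet> x \<le> d}"

definition "tight = {h\<in>H. a h \<bullet> v = b h}"
text \<open>The empty index set gives \<open>P\<close> itself, so a set of facets is a simplex of
  the nerve exactly when its \<open>fc\<close> is nonempty.\<close>

definition "fc I = P \<inter> {x. \<forall>h\<in>I. a h \<bullet> x = b h}"

lemma vP: "v \<in> P" using vex by (simp add: extreme_point_of_def)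

lemma P_ne: "P \<noteq> {}" using vP by auto

lemma H_fin: "finite H" using rep by (simp add: irredundant_rep_def)

lemma facet_inj: "inj_on facet H"
  by (rule irredundant_rep_inj[OF rep P_ne polytope_imp_convex[OF poly]])

lemma card_tight: "card tight = n"
proof -
  have "facet ` tight = {G. G facet_of P \<and> v \<in> G}"
    unfolding irredundant_rep_facet[OF rep] using vP by (auto simp: tight_def)
  moreover have "inj_on facet tight" by (rule inj_on_subset[OF facet_inj]) (auto simp: tight_def)
  then have "card (facet ` tight) = card tight" by (rule card_image)
  ultimately show ?thesis using simple by simp
qed

lemma fc_face: "I \<subseteq> H \<Longrightarrow> fc I face_of P"
proof (cases "I = {}")
  case True
  then show ?thesis using poly by (simp add: fc_def face_of_refl polytope_imp_convex)
next
  case False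
  assume I: "I \<subseteq> H"
  have "facet h face_of P" if "h \<in> I" for h
    by (rule facet_of_imp_face_of) (use irredundant_rep_facet[OF rep] I that in auto)
  then have "\<Inter> (facet ` I) face_of P" using False by (intro face_of_Inter) (simp, blast)
  moreover have "\<Inter> (facet ` I) = fc I" using False by (auto simp: fc_def)
  ultimately show ?thesis by simp
qed

lemma fc_polytope: "I \<subseteq> H \<Longrightarrow> polytope (fc I)"
  using fc_face face_of_polytope_polytope poly by blast

lemma fc_vertex: "I \<subseteq> H \<Longrightarrow> w extreme_point_of fc I \<Longrightarrow> w extreme_point_of P"
  using extreme_point_of_face fc_face by blast

lemma v_in_fc: "I \<subseteq> H \<Longrightarrow> v \<in> fc I \<longleftrightarrow> I \<subseteq> tight"
  using vP by (auto simp: fc_def tight_def)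

lemma fc_tight: "fc tight = {v}"
proof -
  have "{v} face_of P" using vex by (simp add: face_of_singleton)
  moreover have "{v} \<noteq> P" using dim n by (metis aff_dim_sing of_nat_0_eq_iff of_nat_0 not_numeral_le_zero)
  ultimately have e: "{v} = \<Inter>{G. G facet_of P \<and> {v} \<subseteq> G}"
    using face_of_polyhedron[OF polytope_imp_polyhedron[OF poly]] by blast
  have "fc tight \<subseteq> {v}"
  proof
    fix x assume x: "x \<in> fc tight"
    have "x \<in> G" if G: "G facet_of P" "v \<in> G" for G
    proof -
      obtain h where h: "h \<in> H" "G = facet h" using G(1) unfolding irredundant_rep_facet[OF rep] by auto
      then have "h \<in> tight" using G(2) by (simp add: tight_def)
      then show ?thesis using x h(2) by (simp add: fc_def)
    qed
    then show "x \<in> {v}" by (subst e) simp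
  qed
  then show ?thesis using v_in_fc[of tight] by (auto simp: tight_def)
qed

text \<open>At a simple vertex an edge remains as soon as one of its facets is left out.\<close>

lemma fc_not_point:
  assumes "I \<subset> tight"
  shows "fc I \<noteq> {v}"
proof -
  obtain h0 where h0: "h0 \<in> tight" "h0 \<notin> I" using assms by blast
  have "int (card {h\<in>H. a h \<bullet> v = b h}) = aff_dim P" using card_tight dim by (simp add: tight_def)
  then obtain x where "x \<in> P" "x \<noteq> v" "\<And>h. h \<in> H \<Longrightarrow> a h \<bullet> v = b h \<Longrightarrow> h \<noteq> h0 \<Longrightarrow> a h \<bullet> x = b h"
    using simple_vertex_edge[OF rep vP, of h0] h0(1) unfolding tight_def by blast
  then have "x \<in> fc I" using assms h0 by (auto simp: fc_def tight_def)
  then show ?thesis using \<open>x \<noteq> v\<close> by blast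
qed

lemma fc_eq_point: "I \<subseteq> H \<Longrightarrow> fc I = {v} \<longleftrightarrow> I = tight"
  using fc_tight fc_not_point[of I] v_in_fc[of I] by blast

lemma below_if:
  assumes "I \<subseteq> H" "fc I \<noteq> {}" "I \<noteq> tight"
  obtains x where "x \<in> fc I" "c \<bullet> x < d"
proof -
  have "fc I \<noteq> {v}" using fc_eq_point[OF assms(1)] assms(3) by simp
  then show ?thesis
    by (rule vertex_below[OF fc_polytope[OF assms(1)] assms(2)]) (use cw fc_vertex[OF assms(1)] that in blast)+
qed

text \<open>A face that misses \<open>v\<close> is the hull of vertices of \<open>P\<close> that lie
  strictly below the cut.\<close>

lemma fc_below:
  assumes "I \<subseteq> H" "\<not> I \<subseteq> tight" "x \<in> fc I"
  shows "c \<bullet> x < d"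
proof (rule all_vertices_below[OF fc_polytope[OF assms(1)] assms(3)])
  fix w assume w: "w extreme_point_of fc I"
  then have "w \<noteq> v" using v_in_fc[OF assms(1)] assms(2) by (auto simp: extreme_point_of_def)
  then show "c \<bullet> w < d" using cw fc_vertex[OF assms(1) w] by blast
qed

text \<open>Every nonempty face other than \<open>{v}\<close> has a point strictly below the cut, so
  among the old facets the nerve loses the simplex \<open>tight\<close> and nothing else.\<close>

lemma fc_cut: "I \<subseteq> H \<Longrightarrow> fc I \<inter> Q \<noteq> {} \<longleftrightarrow> fc I \<noteq> {} \<and> I \<noteq> tight"
proof (cases "fc I = {} \<or> I = tight")
  case True
  then show ?thesis using fc_tight cv by auto
next
  case False
  assume "I \<subseteq> H"
  then obtain x where "x \<in> fc I" "c \<bullet> x < d" using below_if False by blast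
  then have "x \<in> fc I \<inter> Q" by (auto simp: fc_def)
  then show ?thesis using False by blast
qed

text \<open>A face that contains \<open>v\<close> and more crosses the hyperplane on a segment from
  \<open>v\<close> to a point below; faces that miss \<open>v\<close> stay below. Hence the link of
  the new facet in the nerve is the boundary of the simplex \<open>tight\<close>.\<close>

lemma fc_hyperplane: "I \<subseteq> H \<Longrightarrow> fc I \<inter> {x. c \<bullet> x = d} \<noteq> {} \<longleftrightarrow> I \<subset> tight"
proof -
  assume I: "I \<subseteq> H"
  show ?thesis
  proof (cases "I \<subset> tight")
    case True
    then have v: "v \<in> fc I" using v_in_fc[OF I] by blast
    then obtain x where "x \<in> fc I" "c \<bullet> x < d" using below_if[OF I] True by blast
    then obtain z where "z \<in> fc I" "c \<bullet> z = d"
      using segment_meets_hyperplane[OF polytope_imp_convex[OF fc_polytope[OF I]] _ _ v cv] by metis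
    then show ?thesis using True by blast
  next
    case False
    then have "I = tight \<or> \<not> I \<subseteq> tight" by auto
    then show ?thesis
    proof
      assume "I = tight"
      then show ?thesis using fc_tight cv by auto
    next
      assume nt: "\<not> I \<subseteq> tight"
      have "x \<notin> {x. c \<bullet> x = d}" if "x \<in> fc I" for x using fc_below[OF I nt that] by simp
      then have "fc I \<inter> {x. c \<bullet> x = d} = {}" by blast
      then show ?thesis using False by simp
    qed
  qed
qed

lemma N_new: "N \<notin> H"
proof
  assume "N \<in> H"
  then have "v \<in> N" using vP irredundant_rep_subset[OF rep] by blast
  then show False using cv by simp
qed

definition "a' = a(N := c)"
definition "b' = b(N := d)"

lemma a'_simps [simp]: "a' N = c" "b' N = d" "h \<in> H \<Longrightarrow> a' h = a h" "h \<in> H \<Longrightarrow> b' h = b h"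
  using N_new by (auto simp: a'_def b'_def)

text \<open>The points of \<open>P\<close> strictly below the cut form a nonempty relatively open
  subset, so the cut preserves the affine hull and the dimension.\<close>

lemma affine_hull_Q: "affine hull Q = affine hull P"
proof
  show "affine hull Q \<subseteq> affine hull P" by (rule hull_mono) auto
  obtain x where x: "x \<in> P" "c \<bullet> x < d"
  proof -
    have "{} \<noteq> tight" using card_tight n by (metis card.empty not_numeral_le_zero)
    moreover have "fc {} = P" by (simp add: fc_def)
    ultimately show ?thesis using below_if[of "{}"] P_ne that by auto
  qed
  have "affine hull (P \<inter> {x. c \<bullet> x < d}) = affine hull P"
    using x by (intro affine_hull_convex_Int_open polytope_imp_convex poly open_halfspace_lt) auto
  moreover have "affine hull (P \<inter> {x. c \<bullet> x < d}) \<subseteq> affine hull Q" by (rule hull_mono) auto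
  ultimately show "affine hull P \<subseteq> affine hull Q" by simp
qed

text \<open>Each inequality needs a point that violates it alone. For the cut this is
  \<open>v\<close>. For an old \<open>h\<close>, a point \<open>y\<close> that violates only
  \<open>h\<close> is pulled so close to a point \<open>g\<close> of the facet of \<open>h\<close>
  below the cut that the new inequality holds as well.\<close>

lemma rep_Q: "irredundant_rep Q (insert N H) a' b'"
proof -
  have half: "h = {x. a h \<bullet> x \<le> b h}" "a h \<noteq> 0" if "h \<in> H" for h
    using rep that by (auto simp: irredundant_rep_def)
  have mem: "x \<in> affine hull P \<inter> \<Inter>(insert N H) \<longleftrightarrow> x \<in> Q" for x
  proof -
    have "x \<in> P \<longleftrightarrow> x \<in> affine hull P \<and> x \<in> \<Inter>H" using rep unfolding irredundant_rep_def by (metis IntD1 IntD2 IntI)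
    then show ?thesis by auto
  qed
  have viol: "\<exists>y \<in> affine hull P. y \<notin> h \<and> (\<forall>g\<in>insert N H. g \<noteq> h \<longrightarrow> y \<in> g)" if h: "h \<in> insert N H" for h
  proof (cases "h = N")
    case True
    have "v \<in> g" if "g \<in> H" for g using vP irredundant_rep_subset[OF rep that] by blast
    then show ?thesis using True vP cv by (intro bexI[of _ v]) (auto intro: hull_inc)
  next
    case False
    then have hH: "h \<in> H" using h by simp
    obtain y where y: "y \<in> affine hull P" "a h \<bullet> y > b h" "\<And>g. g \<in> H \<Longrightarrow> g \<noteq> h \<Longrightarrow> a g \<bullet> y \<le> b g"
      using irredundant_rep_violated[OF rep hH] by metis
    have "facet h facet_of P" using irredundant_rep_facet[OF rep] hH by blast
    then have "fc {h} \<noteq> {}" by (auto simp: facet_of_def fc_def)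
    \<comment> \<open>As \<open>n \<ge> 2\<close>, one facet alone does not cut out the vertex
      \<open>v\<close>, so every facet keeps points strictly below the cut.\<close>
    moreover have "{h} \<noteq> tight"
    proof
      assume "{h} = tight"
      then have "card tight = card {h}" by simp
      then show False using card_tight n by simp
    qed
    ultimately obtain g where g: "g \<in> fc {h}" "c \<bullet> g < d" using below_if[of "{h}"] hH by auto
    obtain e where e: "0 < e" "e < 1" "c \<bullet> (g + e *\<^sub>R (y - g)) < d"
      by (rule linear_form_less_aux[OF g(2)])
    define z where "z = g + e *\<^sub>R (y - g)"
    have z: "z = (1 - e) *\<^sub>R g + e *\<^sub>R y" by (simp add: z_def algebra_simps)
    have gP: "g \<in> P" "a h \<bullet> g = b h" using g by (auto simp: fc_def)
    have gle: "a f \<bullet> g \<le> b f" if "f \<in> H" for f using irredundant_rep_mem[OF rep] gP that by blast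
    have az: "a f \<bullet> z = (1 - e) * (a f \<bullet> g) + e * (a f \<bullet> y)" for f by (simp add: z inner_add_right)
    have "z \<in> affine hull P"
      unfolding z using gP(1) y(1) by (intro mem_affine[OF affine_affine_hull]) (auto intro: hull_inc)
    moreover have "z \<notin> h"
    proof -
      have "e * (a h \<bullet> y) > e * b h" using y(2) e by simp
      then have "a h \<bullet> z > b h" unfolding az gP(2) by (simp add: algebra_simps)
      then show ?thesis using half(1)[OF hH] by (metis mem_Collect_eq not_le)
    qed
    moreover have "z \<in> f" if "f \<in> H" "f \<noteq> h" for f
    proof -
      have "(1 - e) * (a f \<bullet> g) \<le> (1 - e) * b f" "e * (a f \<bullet> y) \<le> e * b f"
        using gle[OF that(1)] y(3)[OF that] e by simp_all
      then have "a f \<bullet> z \<le> b f" unfolding az by (simp add: algebra_simps)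
      then show ?thesis using half(1)[OF that(1)] by (metis mem_Collect_eq)
    qed
    moreover have "z \<in> N" using e(3) by (simp add: z_def)
    ultimately show ?thesis by blast
  qed
  show ?thesis
    unfolding irredundant_rep_def affine_hull_Q
  proof (intro conjI allI impI ballI)
    show "finite (insert N H)" using H_fin by simp
    show "Q = affine hull P \<inter> \<Inter>(insert N H)" using mem by blast
    fix h assume h: "h \<in> insert N H"
    show "a' h \<noteq> 0" using h c0 half by auto
    show "h = {x. a' h \<bullet> x \<le> b' h}"
    proof (cases "h = N")
      case False
      then have hH: "h \<in> H" using h by simp
      show ?thesis unfolding a'_simps(3)[OF hH] a'_simps(4)[OF hH] by (rule half(1)[OF hH])
    qed simp
  next
    fix H' assume H': "H' \<subset> insert N H"
    then obtain h where h: "h \<in> insert N H" "h \<notin> H'" by blast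
    obtain y where y: "y \<in> affine hull P" "y \<notin> h" "\<forall>g\<in>insert N H. g \<noteq> h \<longrightarrow> y \<in> g" using viol[OF h(1)] by blast
    have "y \<in> g" if "g \<in> H'" for g using y(3) that H' h(2) by (metis psubsetD)
    then have yH: "y \<in> affine hull P \<inter> \<Inter>H'" using y(1) by simp
    have "y \<notin> \<Inter>(insert N H)" using y(2) h(1) by (meson InterE)
    have yQ: "y \<notin> Q"
    proof
      assume "y \<in> Q"
      then have "y \<in> affine hull P \<inter> \<Inter>(insert N H)" by (rule mem[THEN iffD2])
      then have "y \<in> \<Inter>(insert N H)" by (rule IntD2)
      with \<open>y \<notin> \<Inter>(insert N H)\<close> show False by (rule notE)
    qed
    have sub: "affine hull P \<inter> \<Inter>(insert N H) \<subseteq> affine hull P \<inter> \<Inter>H'"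
      using H' by (intro Int_mono Inter_anti_mono) auto
    have "Q \<subseteq> affine hull P \<inter> \<Inter>H'"
    proof
      fix x assume "x \<in> Q"
      then have "x \<in> affine hull P \<inter> \<Inter>(insert N H)" by (rule mem[THEN iffD2])
      then show "x \<in> affine hull P \<inter> \<Inter>H'" by (rule subsetD[OF sub])
    qed
    then show "Q \<subset> affine hull P \<inter> \<Inter>H'" using yH yQ by (metis psubsetI)
  qed
qed

end

text \<open>\<open>facet_complex\<close> for an arbitrary label set: the facet created by the last
  cut may carry any label, so the labels of the older facets need not form an initial
  segment.\<close>

definition fcomplex :: "'a set \<Rightarrow> nat set \<Rightarrow> (nat \<Rightarrow> 'a set) \<Rightarrow> nat set set" where
  "fcomplex P V F = {I. I \<subseteq> V \<and> P \<inter> (\<Inter>i\<in>I. F i) \<noteq> {}}"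

context cut_vertex begin

text \<open>Deleting the label \<open>w\<close> of the new facet from an enumeration of the facets
  of \<open>Q\<close> leaves one of the facets of \<open>P\<close> by the other labels; this is why
  \<open>IH\<close> ranges over all labellings. The map \<open>l\<close> passes from labels to
  halfspaces, where \<open>fc_cut\<close> and \<open>fc_hyperplane\<close> give the two kinds of
  sets in \<open>stell\<close>.\<close>

lemma fcomplex_cut:
  assumes F: "bij_betw F V' {G. G facet_of Q}"
    and IH: "\<And>V F. bij_betw F V {G. G facet_of P} \<Longrightarrow> stacked n k V (fcomplex P V F)"
  shows "stacked n (Suc k) V' (fcomplex Q V' F)"
proof -
  define \<phi> where "\<phi> h = Q \<inter> {x. a' h \<bullet> x = b' h}" for h
  have "fc {} \<inter> Q \<noteq> {}"
    using fc_cut[of "{}"] card_tight n P_ne by (metis card.empty empty_subsetI fc_hyperplane fc_def Int_emptyI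
        card_gt_0_iff less_le_trans pos2 psubsetI inf_bot_left)
  then have "Q \<noteq> {}" by auto
  moreover have "convex Q" by (intro convex_Int polytope_imp_convex poly convex_halfspace_le)
  ultimately have "inj_on \<phi> (insert N H)" unfolding \<phi>_def by (rule irredundant_rep_inj[OF rep_Q])
  moreover have "\<phi> ` insert N H = {G. G facet_of Q}"
    unfolding irredundant_rep_facet[OF rep_Q] \<phi>_def by auto
  ultimately have \<phi>: "bij_betw \<phi> (insert N H) {G. G facet_of Q}" by (simp add: bij_betw_def)
  define l where "l i = inv_into (insert N H) \<phi> (F i)" for i
  have l: "bij_betw l V' (insert N H)"
    using bij_betw_trans[OF F bij_betw_inv_into[OF \<phi>]] by (simp add: l_def[abs_def] o_def)
  have \<phi>l: "F i = \<phi> (l i)" if "i \<in> V'" for i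
  proof -
    have "F i \<in> \<phi> ` insert N H" using F \<phi> that by (auto simp: bij_betw_def)
    then show ?thesis by (simp add: l_def f_inv_into_f)
  qed
  obtain w where w: "w \<in> V'" "l w = N" using l by (metis bij_betw_iff_bijections insertI1)
  define V where "V = V' - {w}"
  have V': "V' = insert w V" "w \<notin> V" using w by (auto simp: V_def)
  have lV: "bij_betw l V H"
    using bij_betw_DiffI[OF l, of "{w}" "{N}"] w N_new by (auto simp: V_def bij_betw_def)
  have lH: "l i \<in> H" if "i \<in> V" for i using lV that by (auto simp: bij_betw_def)
  have injl: "inj_on l V" using lV by (simp add: bij_betw_def)
  define F0 where "F0 i = facet (l i)" for i
  have "bij_betw facet H {G. G facet_of P}"
    using facet_inj unfolding bij_betw_def irredundant_rep_facet[OF rep] by auto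
  then have F0: "bij_betw F0 V {G. G facet_of P}"
    using bij_betw_trans[OF lV, of facet] by (simp add: F0_def[abs_def] o_def)
  define \<sigma> where "\<sigma> = {i\<in>V. l i \<in> tight}"
  have \<sigma>V: "\<sigma> \<subseteq> V" by (auto simp: \<sigma>_def)
  have l\<sigma>: "l ` \<sigma> = tight"
  proof -
    have "l ` V = H" using lV by (simp add: bij_betw_def)
    then show ?thesis unfolding \<sigma>_def tight_def by force
  qed
  have card\<sigma>: "card \<sigma> = n"
    using card_image[OF inj_on_subset[OF injl \<sigma>V]] l\<sigma> card_tight by simp
  have eqt: "l ` I = tight \<longleftrightarrow> I = \<sigma>" if "I \<subseteq> V" for I
    unfolding l\<sigma>[symmetric] using inj_on_image_eq_iff[OF injl that \<sigma>V] .
  have subt: "l ` I \<subseteq> tight \<longleftrightarrow> I \<subseteq> \<sigma>" if "I \<subseteq> V" for I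
    using that by (auto simp: \<sigma>_def)
  have lI: "l ` I \<subseteq> H" if "I \<subseteq> V" for I using lH that by blast
  have K: "P \<inter> (\<Inter>i\<in>I. F0 i) = fc (l ` I)" for I
    by (auto simp: F0_def fc_def)
  have KP: "I \<in> fcomplex P V F0 \<longleftrightarrow> I \<subseteq> V \<and> fc (l ` I) \<noteq> {}" for I
    by (simp add: fcomplex_def K)
  have FQ: "F i = Q \<inter> {x. a (l i) \<bullet> x = b (l i)}" if "i \<in> V" for i
    using \<phi>l[of i] lH[OF that] that V' by (simp add: \<phi>_def)
  have Fw: "F w = Q \<inter> {x. c \<bullet> x = d}" using \<phi>l[OF w(1)] w(2) by (simp add: \<phi>_def)
  have Q1: "Q \<inter> (\<Inter>i\<in>I. F i) = fc (l ` I) \<inter> Q" if "I \<subseteq> V" for I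
  proof -
    have "Q \<inter> (\<Inter>i\<in>I. F i) = Q \<inter> (\<Inter>i\<in>I. Q \<inter> {x. a (l i) \<bullet> x = b (l i)})"
      using FQ that by auto
    then show ?thesis by (auto simp: fc_def)
  qed
  have Q2: "Q \<inter> (\<Inter>i\<in>insert w I. F i) = fc (l ` I) \<inter> {x. c \<bullet> x = d}" if "I \<subseteq> V" for I
  proof -
    have "Q \<inter> (\<Inter>i\<in>insert w I. F i) = F w \<inter> (Q \<inter> (\<Inter>i\<in>I. F i))" by auto
    then show ?thesis unfolding Q1[OF that] Fw by (auto simp: fc_def)
  qed
  have "fcomplex Q V' F = stell (fcomplex P V F0) \<sigma> w"
  proof (rule Set.set_eqI)
    fix I
    show "I \<in> fcomplex Q V' F \<longleftrightarrow> I \<in> stell (fcomplex P V F0) \<sigma> w"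
    proof (cases "w \<in> I")
      case False
      then have sub: "I \<subseteq> V' \<longleftrightarrow> I \<subseteq> V" using V' by auto
      have "I \<in> fcomplex Q V' F \<longleftrightarrow> I \<subseteq> V \<and> fc (l ` I) \<inter> Q \<noteq> {}"
        unfolding fcomplex_def mem_Collect_eq sub using Q1[of I] by metis
      also have "\<dots> \<longleftrightarrow> I \<subseteq> V \<and> fc (l ` I) \<noteq> {} \<and> I \<noteq> \<sigma>"
        using fc_cut[OF lI[of I]] eqt[of I] by metis
      also have "\<dots> \<longleftrightarrow> I \<in> stell (fcomplex P V F0) \<sigma> w"
        using False KP by (auto simp: stell_def)
      finally show ?thesis .
    next
      case True
      define J where "J = I - {w}"
      have I: "I = insert w J" "w \<notin> J" using True by (auto simp: J_def)
      have sub: "I \<subseteq> V' \<longleftrightarrow> J \<subseteq> V" using V' I by auto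
      have "I \<in> fcomplex Q V' F \<longleftrightarrow> J \<subseteq> V \<and> fc (l ` J) \<inter> {x. c \<bullet> x = d} \<noteq> {}"
        unfolding fcomplex_def mem_Collect_eq sub using Q2[of J] I(1) by metis
      also have "\<dots> \<longleftrightarrow> J \<subseteq> V \<and> J \<subset> \<sigma>"
        using fc_hyperplane[OF lI[of J]] eqt[of J] subt[of J] by (metis psubset_eq)
      also have "\<dots> \<longleftrightarrow> J \<subset> \<sigma>" using \<sigma>V by auto
      also have "\<dots> \<longleftrightarrow> I \<in> insert w ` {\<tau>. \<tau> \<subset> \<sigma>}"
      proof
        assume "I \<in> insert w ` {\<tau>. \<tau> \<subset> \<sigma>}"
        then obtain t where t: "t \<subset> \<sigma>" "I = insert w t" by blast
        then have "w \<notin> t" using \<sigma>V V' by auto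
        then have "t = J" using t(2) I by (metis insert_ident)
        then show "J \<subset> \<sigma>" using t by simp
      qed (use I in auto)
      also have "\<dots> \<longleftrightarrow> I \<in> stell (fcomplex P V F0) \<sigma> w"
        using True V' KP[of I] by (auto simp: stell_def)
      finally show ?thesis .
    qed
  qed
  moreover have "\<sigma> \<in> fcomplex P V F0" using KP[of \<sigma>] \<sigma>V l\<sigma> fc_tight by simp
  ultimately show ?thesis
    using stacked.step[OF IH[OF F0] V'(2) _ card\<sigma>] V'(1) by simp
qed

lemma polytope_Q: "polytope Q"
  by (rule polytope_Int_polyhedron[OF poly polyhedron_halfspace_le])

lemma aff_dim_Q: "aff_dim Q = int n"
  using affine_hull_Q dim by (metis aff_dim_affine_hull)

end

text \<open>Each facet omits one vertex of the simplex. If a facet is missing from \<open>I\<close>,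
  the vertex it omits lies on all facets in \<open>I\<close>. All facets together have no common
  point: their intersection would be a face with a vertex \<open>u\<close>, but the facet opposite
  to \<open>u\<close> does not contain \<open>u\<close>.\<close>

lemma fcomplex_simplex:
  assumes \<Delta>: "(int n) simplex \<Delta>" and n: "n \<ge> 1" and F: "bij_betw F V {G. G facet_of \<Delta>}"
  shows "stacked n 0 V (fcomplex \<Delta> V F)"
proof -
  obtain C where C: "\<not> affine_dependent C" "int (card C) = int n + 1" "\<Delta> = convex hull C"
    using \<Delta> unfolding simplex_def by auto
  have fC: "finite C" "card C = n + 1" using C aff_independent_finite by auto
  let ?g = "\<lambda>u. convex hull (C - {u})"
  have facets: "{G. G facet_of \<Delta>} = ?g ` C"
    using facet_of_convex_hull_affine_independent_alt[OF C(1)] fC n C(3) by auto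
  have hull_in: "u \<in> convex hull D \<longleftrightarrow> u \<in> D" if "D \<subseteq> C" "u \<in> C" for D u
  proof
    assume u: "u \<in> convex hull D"
    show "u \<in> D"
    proof (rule ccontr)
      assume "u \<notin> D"
      then have "D \<subseteq> C - {u}" using that by auto
      then have "u \<in> convex hull (C - {u})" using u hull_mono by blast
      then have "u \<in> affine hull (C - {u})" using convex_hull_subset_affine_hull by blast
      then show False using C(1) that(2) by (auto simp: affine_dependent_def)
    qed
  qed (simp add: hull_inc)
  have "inj_on ?g C"
  proof (rule inj_onI, rule ccontr)
    fix u v assume uv: "u \<in> C" "v \<in> C" "?g u = ?g v" "u \<noteq> v"
    then have "u \<in> ?g v" by (intro hull_inc) auto
    then have "u \<in> ?g u" using uv by simp
    then show False using hull_in[of "C - {u}" u] uv by simp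
  qed
  then have g: "bij_betw ?g C {G. G facet_of \<Delta>}" using facets by (simp add: bij_betw_def)
  define l where "l i = inv_into C ?g (F i)" for i
  have l: "bij_betw l V C"
    using bij_betw_trans[OF F bij_betw_inv_into[OF g]] by (simp add: l_def[abs_def] o_def)
  have Fl: "F i = ?g (l i)" if "i \<in> V" for i
  proof -
    have "F i \<in> ?g ` C" using bij_betwE[OF F] that facets by blast
    from f_inv_into_f[OF this] show ?thesis unfolding l_def by (rule sym)
  qed
  have V: "finite V" "card V = n + 1" using l fC bij_betw_finite bij_betw_same_card by metis+
  have "I \<in> fcomplex \<Delta> V F \<longleftrightarrow> I \<subset> V" for I
  proof (cases "I \<subseteq> V")
    case I: True
    show ?thesis
    proof (cases "I = V")
      case False
      then obtain i where i: "i \<in> V" "i \<notin> I" using I by blast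
      have "l i \<in> C" using l i by (auto simp: bij_betw_def)
      moreover have "l i \<in> F j" if "j \<in> I" for j
      proof -
        have "l i \<noteq> l j" using l i I that by (metis bij_betw_def inj_on_contraD subsetD)
        then show ?thesis using Fl[of j] that I \<open>l i \<in> C\<close> by (auto intro!: hull_inc)
      qed
      ultimately have "l i \<in> \<Delta> \<inter> (\<Inter>j\<in>I. F j)" using C(3) by (auto intro: hull_inc)
      then show ?thesis using I False by (auto simp: fcomplex_def)
    next
      case True
      have "\<Delta> \<inter> (\<Inter>i\<in>V. F i) = {}"
      proof (rule equals0I)
        fix x assume x: "x \<in> \<Delta> \<inter> (\<Inter>i\<in>V. F i)"
        let ?E = "\<Inter>i\<in>V. F i"
        have "V \<noteq> {}" using V by auto
        have "?E face_of \<Delta>"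
        proof (rule face_of_Inter)
          show "F ` V \<noteq> {}" using \<open>V \<noteq> {}\<close> by simp
          fix G assume "G \<in> F ` V"
          then show "G face_of \<Delta>" using F facet_of_imp_face_of by (auto simp: bij_betw_def)
        qed
        then obtain D where D: "D \<subseteq> C" "?E = convex hull D"
          using face_of_convex_hull_affine_independent[OF C(1)] C(3) by auto
        have "D \<noteq> {}" using x D by auto
        then obtain u where u: "u \<in> D" by blast
        then obtain i where i: "i \<in> V" "l i = u" using l D(1) by (metis bij_betw_iff_bijections subsetD)
        have "u \<in> ?E" using D u by (auto intro: hull_inc)
        then have "u \<in> ?g u" using Fl[OF i(1)] i by auto
        then show False using hull_in[of "C - {u}" u] u D by auto
      qed
      then show ?thesis using True by (simp add: fcomplex_def)
    qed
  qed (auto simp: fcomplex_def)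
  then have "fcomplex \<Delta> V F = {I. I \<subset> V}" by blast
  then show ?thesis using stacked.base[OF V] by simp
qed

lemma truncation_stacked:
  assumes \<Delta>: "(int n) simplex \<Delta>" and n: "n \<ge> 2" and cut: "(vertex_cut ^^ k) \<Delta> P"
  shows "polytope P \<and> aff_dim P = int n \<and>
    (\<forall>V F. bij_betw F V {G. G facet_of P} \<longrightarrow> stacked n k V (fcomplex P V F))"
  using cut
proof (induction k arbitrary: P)
  case 0
  then have "P = \<Delta>" by simp
  moreover have "n \<ge> 1" using n by simp
  ultimately show ?case
    using fcomplex_simplex[OF \<Delta>] simplex_imp_polytope[OF \<Delta>] aff_dim_simplex[OF \<Delta>] by simp
next
  case (Suc k)
  then obtain P' where P': "(vertex_cut ^^ k) \<Delta> P'" and "vertex_cut P' P" by auto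
  note IH = Suc.IH[OF P']
  obtain v c d where v: "v extreme_point_of P'" "c \<noteq> 0" "c \<bullet> v > d"
      "\<And>w. w extreme_point_of P' \<Longrightarrow> w \<noteq> v \<Longrightarrow> c \<bullet> w < d" and P: "P = P' \<inter> {x. c \<bullet> x \<le> d}"
    and simple: "simple_polytope P'"
    using \<open>vertex_cut P' P\<close> unfolding vertex_cut_def by blast
  obtain H a b where rep: "irredundant_rep P' H a b"
    using irredundant_rep_exists IH polytope_imp_polyhedron by metis
  have "card {G. G facet_of P' \<and> v \<in> G} = n" using simple v(1) IH unfolding simple_polytope_def by simp
  then interpret cut_vertex P' H a b n v c d
    using IH rep n v by unfold_locales auto
  show ?case unfolding P using polytope_Q aff_dim_Q fcomplex_cut IH by blast
qed

section \<open>Graded free resolutions\<close>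

abbreviation lookup :: "('a \<Rightarrow>\<^sub>0 'b::zero) \<Rightarrow> 'a \<Rightarrow> 'b" where "lookup \<equiv> Poly_Mapping.lookup"
abbreviation keys :: "('a \<Rightarrow>\<^sub>0 'b::zero) \<Rightarrow> 'a set" where "keys \<equiv> Poly_Mapping.keys"
abbreviation single :: "'a \<Rightarrow> 'b::zero \<Rightarrow> ('a \<Rightarrow>\<^sub>0 'b)" where "single \<equiv> Poly_Mapping.single"

type_synonym mon = "nat \<Rightarrow>\<^sub>0 nat"

text \<open>Coordinates over the field: generators times monomials form a basis of a free module
  over the polynomial ring.\<close>

definition coef :: "(nat \<Rightarrow>\<^sub>0 'k mpoly) \<Rightarrow> nat \<Rightarrow> mon \<Rightarrow> 'k::zero" where
  "coef x b t = lookup (lookup x b) t"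

lemma coef_eqI: "(\<And>b t. coef x b t = coef y b t) \<Longrightarrow> x = y"
  by (intro poly_mapping_eqI) (auto simp: coef_def intro: poly_mapping_eqI)

lemma coef_0 [simp]: "coef 0 b t = 0"
  by (simp add: coef_def)

lemma coef_add [simp]: "coef (x + y) b t = coef x b t + coef y b t"
  by (simp add: coef_def lookup_add)

lemma coef_sum: "coef (sum f A) b t = (\<Sum>a\<in>A. coef (f a) b t)"
  by (induction A rule: infinite_finite_induct) auto

lemma coef_single: "coef (single b (single t c)) b' t' = (if b = b' \<and> t = t' then c else 0)"
  by (auto simp: coef_def lookup_single when_def)

lemma finite_coef: "finite {(b, t). coef x b t \<noteq> 0}"
proof -
  have "{(b, t). coef x b t \<noteq> 0} \<subseteq> Sigma (keys x) (\<lambda>b. keys (lookup x b))"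
    by (auto simp: coef_def in_keys_iff)
  then show ?thesis by (rule finite_subset) auto
qed

lemma mon_degree_add: "mon_degree (s + t) = mon_degree s + mon_degree t"
proof -
  let ?A = "keys s \<union> keys t"
  have e: "mon_degree u = 2 * (\<Sum>i\<in>?A. lookup u i)" if "keys u \<subseteq> ?A" for u
    unfolding mon_degree_def using that by (intro arg_cong[where f="(*) 2"] sum.mono_neutral_left) (auto simp: in_keys_iff)
  show ?thesis using e[of s] e[of t] e[of "s + t"] keys_add[of s t]
    by (simp add: lookup_add sum.distrib)
qed

lemma mon_degree_0 [simp]: "mon_degree 0 = 0"
  by (simp add: mon_degree_def)

lemma mon_degree_single [simp]: "mon_degree (single l 1) = 2"
  by (simp add: mon_degree_def)

lemma keys_plus_mon: "keys (s + t :: mon) = keys s \<union> keys t"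
  by (auto simp: in_keys_iff lookup_add)

lemma finite_mons: "finite {t. keys t \<subseteq> {1..m} \<and> mon_degree t \<le> d}"
proof -
  let ?S = "{t. keys t \<subseteq> {1..m} \<and> mon_degree t \<le> d}"
  let ?f = "\<lambda>t. restrict (lookup t) {1..m}"
  have "lookup t i \<le> d" if "t \<in> ?S" for t i
  proof (cases "i \<in> keys t")
    case True
    then have "lookup t i \<le> (\<Sum>i\<in>keys t. lookup t i)" by (intro member_le_sum) auto
    then show ?thesis using that by (simp add: mon_degree_def)
  qed (simp add: in_keys_iff)
  then have "?f ` ?S \<subseteq> PiE {1..m} (\<lambda>_. {..d})" by auto
  moreover have "finite (PiE {1..m} (\<lambda>_. {..d}))" by (intro finite_PiE) auto
  ultimately have "finite (?f ` ?S)" by (rule finite_subset)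
  moreover have "inj_on ?f ?S"
  proof (rule inj_onI, rule poly_mapping_eqI)
    fix s t i assume st: "s \<in> ?S" "t \<in> ?S" and e: "?f s = ?f t"
    show "lookup s i = lookup t i"
    proof (cases "i \<in> {1..m}")
      case True
      then show ?thesis using fun_cong[OF e, of i] by simp
    next
      case False
      then have "i \<notin> keys s" "i \<notin> keys t" using st by auto
      then show ?thesis by (simp add: in_keys_iff)
    qed
  qed
  ultimately show ?thesis by (rule finite_imageD)
qed

definition kscale :: "'k::field \<Rightarrow> (nat \<Rightarrow>\<^sub>0 'k mpoly) \<Rightarrow> (nat \<Rightarrow>\<^sub>0 'k mpoly)" where
  "kscale c x = pm_scale (single 0 c) x"

lemma lookup_single_mult_any:
  "lookup (single s c * p) k = c * (\<Sum>q. lookup p q when k = s + q)" for p :: "(mon \<Rightarrow>\<^sub>0 'k::comm_ring_1)"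
  by (simp add: lookup_mult lookup_single when_mult)

lemma lookup_single_mult: "lookup (single s c * p) (s + t) = c * lookup p t" for p :: "(mon \<Rightarrow>\<^sub>0 'k::comm_ring_1)"
  by (simp add: lookup_single_mult_any)

lemma lookup_single_mult_0:
  "(\<And>t. k \<noteq> s + t) \<Longrightarrow> lookup (single s c * p) k = 0" for p :: "(mon \<Rightarrow>\<^sub>0 'k::comm_ring_1)"
  by (simp add: lookup_single_mult_any)

lemma coef_kscale [simp]: "coef (kscale c x) b t = c * coef x b t"
  using lookup_single_mult[of 0 c "lookup x b" t] by (simp add: kscale_def coef_def lookup_pm_scale)

interpretation km: vector_space "kscale :: 'k::field \<Rightarrow> (nat \<Rightarrow>\<^sub>0 'k mpoly) \<Rightarrow> _"
  by unfold_locales (auto intro!: coef_eqI simp: algebra_simps)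

lemma coef_diff [simp]: "coef (x - y) b t = coef x b t - coef y b t"
  by (simp add: coef_def lookup_minus)

lemma coef_uminus [simp]: "coef (- x) b t = - coef x b t"
  by (simp add: coef_def)

definition cscale :: "'k::field \<Rightarrow> ('i \<Rightarrow> (nat \<Rightarrow>\<^sub>0 'k mpoly)) \<Rightarrow> 'i \<Rightarrow> (nat \<Rightarrow>\<^sub>0 'k mpoly)" where
  "cscale c x = (\<lambda>A. kscale c (x A))"

interpretation cv: vector_space "cscale :: 'k::field \<Rightarrow> ('i \<Rightarrow> (nat \<Rightarrow>\<^sub>0 'k mpoly)) \<Rightarrow> _"
  by unfold_locales (auto simp: cscale_def fun_eq_iff km.scale_right_distrib km.scale_left_distrib)

definition csup :: "('i \<times> nat \<times> mon) set \<Rightarrow> ('i \<Rightarrow> (nat \<Rightarrow>\<^sub>0 'k::field mpoly)) set" where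
  "csup T = {x. \<forall>A b t. coef (x A) b t \<noteq> 0 \<longrightarrow> (A, b, t) \<in> T}"

lemma csupD: "x \<in> csup T \<Longrightarrow> (A, b, t) \<notin> T \<Longrightarrow> coef (x A) b t = 0"
  unfolding csup_def by blast

lemma subspace_csup: "cv.subspace (csup T)"
  unfolding cv.subspace_def csup_def by (auto simp: cscale_def) (metis add.right_neutral)

lemma csup_expand:
  fixes c :: "'i \<Rightarrow> nat \<Rightarrow> mon \<Rightarrow> 'k::field"
  assumes "finite T" and c: "\<And>A b t. c A b t \<noteq> 0 \<Longrightarrow> (A, b, t) \<in> T"
  defines "x \<equiv> \<Sum>y\<in>T. cscale (c (fst y) (fst (snd y)) (snd (snd y)))
     (\<lambda>A. if A = fst y then single (fst (snd y)) (single (snd (snd y)) 1) else 0)"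
  shows "coef (x A) b t = c A b t"
proof -
  have "coef (x A) b t = (\<Sum>y\<in>T. if y = (A, b, t) then c A b t else 0)"
    unfolding x_def sum_fun_apply coef_sum
    by (rule sum.cong[OF refl]) (auto simp: cscale_def coef_single prod_eq_iff)
  also have "\<dots> = (if (A, b, t) \<in> T then c A b t else 0)" using assms(1) by (rule sum.delta)
  finally show ?thesis using c[of A b t] by (simp split: if_splits) metis
qed

text \<open>Elements of the double complex can thus be prescribed by their coefficients; finiteness
  of \<open>T\<close> provides the finite supports.\<close>

lemma csup_ex:
  fixes c :: "'i \<Rightarrow> nat \<Rightarrow> mon \<Rightarrow> 'k::field"
  assumes "finite T" and c: "\<And>A b t. c A b t \<noteq> 0 \<Longrightarrow> (A, b, t) \<in> T"
  obtains x where "x \<in> csup T" "\<And>A b t. coef (x A) b t = c A b t"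
proof
  let ?x = "\<Sum>y\<in>T. cscale (c (fst y) (fst (snd y)) (snd (snd y)))
     (\<lambda>A. if A = fst y then single (fst (snd y)) (single (snd (snd y)) 1) else 0)"
  show e: "coef (?x A) b t = c A b t" for A b t by (rule csup_expand[OF assms])
  have "(A, b, t) \<in> T" if "coef (?x A) b t \<noteq> 0" for A b t
    using that e[of A b t] c[of A b t] by metis
  then show "?x \<in> csup T" unfolding csup_def by blast
qed

lemma fin_span_csup:
  assumes "finite T"
  shows "fin_span cscale (csup T :: ('i \<Rightarrow> (nat \<Rightarrow>\<^sub>0 'k::field mpoly)) set)"
proof -
  let ?e = "\<lambda>y. (\<lambda>A. if A = fst y then single (fst (snd y)) (single (snd (snd y)) 1) else 0) :: 'i \<Rightarrow> (nat \<Rightarrow>\<^sub>0 'k mpoly)"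
  have "x \<in> cv.span (?e ` T)" if x: "x \<in> csup T" for x :: "'i \<Rightarrow> (nat \<Rightarrow>\<^sub>0 'k mpoly)"
  proof -
    define c where "c A b t = coef (x A) b t" for A b t
    have c: "c A b t \<noteq> 0 \<Longrightarrow> (A, b, t) \<in> T" for A b t using csupD[OF x] unfolding c_def by blast
    have e: "coef ((\<Sum>y\<in>T. cscale (c (fst y) (fst (snd y)) (snd (snd y))) (?e y)) A) b t = c A b t" for A b t
      by (rule csup_expand[OF assms]) (rule c)
    have "x = (\<Sum>y\<in>T. cscale (c (fst y) (fst (snd y)) (snd (snd y))) (?e y))"
      by (rule ext, rule coef_eqI, rule trans[OF _ e[symmetric]]) (simp only: c_def)
    moreover have "(\<Sum>y\<in>T. cscale (c (fst y) (fst (snd y)) (snd (snd y))) (?e y)) \<in> cv.span (?e ` T)"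
      by (intro cv.span_sum cv.span_scale cv.span_base imageI)
    ultimately show ?thesis by simp
  qed
  then show ?thesis using assms unfolding fin_span_def by blast
qed

lemma lin_ext_superset:
  assumes "finite B" "keys x \<subseteq> B"
  shows "lin_ext D x = (\<Sum>b\<in>B. pm_scale (lookup x b) (D b))"
  unfolding lin_ext_def using assms
  by (intro sum.mono_neutral_left) (auto simp: in_keys_iff intro!: poly_mapping_eqI simp: lookup_pm_scale)

lemma lookup_lin_ext: "lookup (lin_ext D x) c = (\<Sum>b\<in>keys x. lookup x b * lookup (D b) c)"
  by (simp add: lin_ext_def lookup_sum lookup_pm_scale)

lemma pm_scale_add_left: "pm_scale (p + q) x = pm_scale p x + pm_scale q x"
  by (intro poly_mapping_eqI) (simp add: lookup_pm_scale lookup_add distrib_right)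

lemma pm_scale_add_right: "pm_scale p (x + y) = pm_scale p x + pm_scale p y"
  by (intro poly_mapping_eqI) (simp add: lookup_pm_scale lookup_add distrib_left)

lemma pm_scale_mult: "pm_scale (p * q) x = pm_scale p (pm_scale q x)"
  by (intro poly_mapping_eqI) (simp add: lookup_pm_scale mult.assoc)

lemma pm_scale_sum_right: "pm_scale p (sum f A) = (\<Sum>a\<in>A. pm_scale p (f a))"
  by (intro poly_mapping_eqI) (simp add: lookup_pm_scale lookup_sum sum_distrib_left)

lemma lin_ext_add: "lin_ext D (x + y) = lin_ext D x + lin_ext D y"
proof -
  let ?B = "keys x \<union> keys y"
  have "lin_ext D (x + y) = (\<Sum>b\<in>?B. pm_scale (lookup (x + y) b) (D b))"
    using keys_add[of x y] by (intro lin_ext_superset) auto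
  moreover have "lin_ext D x = (\<Sum>b\<in>?B. pm_scale (lookup x b) (D b))" by (rule lin_ext_superset) auto
  moreover have "lin_ext D y = (\<Sum>b\<in>?B. pm_scale (lookup y b) (D b))" by (rule lin_ext_superset) auto
  ultimately show ?thesis by (simp add: lookup_add pm_scale_add_left sum.distrib)
qed

lemma keys_pm_scale: "keys (pm_scale p x) \<subseteq> keys x"
  by (auto simp: in_keys_iff lookup_pm_scale)

lemma lin_ext_pm_scale: "lin_ext D (pm_scale p x) = pm_scale p (lin_ext D x)"
proof -
  have "lin_ext D (pm_scale p x) = (\<Sum>b\<in>keys x. pm_scale (lookup (pm_scale p x) b) (D b))"
    using keys_pm_scale by (intro lin_ext_superset) auto
  then show ?thesis by (simp add: lookup_pm_scale pm_scale_mult pm_scale_sum_right lin_ext_def)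
qed

lemma lin_ext_0 [simp]: "lin_ext D 0 = 0"
  by (simp add: lin_ext_def)

lemma lin_ext_sum: "lin_ext D (sum f A) = (\<Sum>a\<in>A. lin_ext D (f a))"
  by (induction A rule: infinite_finite_induct) (auto simp: lin_ext_add)

lemma lin_ext_kscale: "lin_ext D (kscale c x) = kscale c (lin_ext D x)"
  by (simp add: kscale_def lin_ext_pm_scale)

lemma lin_ext_single: "lin_ext D (single b p) = pm_scale p (D b)"
  by (simp add: lin_ext_superset[of "{b}"])

text \<open>One coordinate projection serves for homogeneous components, for constant terms and for
  reduction modulo the face ideal.\<close>

definition filt :: "(nat \<Rightarrow> mon \<Rightarrow> bool) \<Rightarrow> (nat \<Rightarrow>\<^sub>0 'k::field mpoly) \<Rightarrow> (nat \<Rightarrow>\<^sub>0 'k mpoly)" where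
  "filt S x = Poly_Mapping.mapp (\<lambda>b p. Poly_Mapping.mapp (\<lambda>t c. if S b t then c else 0) p) x"

lemma coef_filt [simp]: "coef (filt S x) b t = (if S b t then coef x b t else 0)"
  by (auto simp: filt_def coef_def lookup_mapp when_def in_keys_iff)

lemma filt_add: "filt S (x + y) = filt S x + filt S y"
  by (rule coef_eqI) simp

lemma filt_kscale: "filt S (kscale c x) = kscale c (filt S x)"
  by (rule coef_eqI) simp

lemma filt_0 [simp]: "filt S 0 = 0"
  by (rule coef_eqI) simp

lemma filt_sum: "filt S (sum f A) = (\<Sum>a\<in>A. filt S (f a))"
  by (rule coef_eqI) (simp add: coef_sum)

definition homog :: "(nat \<Rightarrow> nat) \<Rightarrow> nat \<Rightarrow> (nat \<Rightarrow>\<^sub>0 'k::field mpoly) \<Rightarrow> bool" where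
  "homog g d x \<longleftrightarrow> (\<forall>b t. coef x b t \<noteq> 0 \<longrightarrow> mon_degree t + g b = d)"

abbreviation hcomp :: "(nat \<Rightarrow> nat) \<Rightarrow> nat \<Rightarrow> (nat \<Rightarrow>\<^sub>0 'k::field mpoly) \<Rightarrow> (nat \<Rightarrow>\<^sub>0 'k mpoly)" where
  "hcomp g d \<equiv> filt (\<lambda>b t. mon_degree t + g b = d)"

lemma homog_hcomp: "homog g d (hcomp g d x)"
  by (auto simp: homog_def)

lemma hcomp_homog: "homog g e x \<Longrightarrow> hcomp g d x = (if d = e then x else 0)"
  by (intro coef_eqI) (auto simp: homog_def)

lemma hcomp_decompose:
  obtains E where "finite E" "x = (\<Sum>d\<in>E. hcomp g d x)" "\<And>d. d \<notin> E \<Longrightarrow> hcomp g d x = 0"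
proof
  let ?E = "(\<lambda>(b, t). mon_degree t + g b) ` {(b, t). coef x b t \<noteq> 0}"
  have inE: "mon_degree t + g b \<in> ?E" if "coef x b t \<noteq> 0" for b t using that by force
  show fin: "finite ?E" using finite_coef by (rule finite_imageI)
  show "x = (\<Sum>d\<in>?E. hcomp g d x)"
  proof (rule coef_eqI)
    fix b t
    have "coef (\<Sum>d\<in>?E. hcomp g d x) b t = (\<Sum>d\<in>?E. if d = mon_degree t + g b then coef x b t else 0)"
      unfolding coef_sum by (rule sum.cong) auto
    also have "\<dots> = (if mon_degree t + g b \<in> ?E then coef x b t else 0)" using fin by (rule sum.delta)
    also have "\<dots> = coef x b t" using inE[of b t] by (cases "coef x b t = 0") auto
    finally show "coef x b t = coef (\<Sum>d\<in>?E. hcomp g d x) b t" by simp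
  qed
  show "hcomp g d x = 0" if "d \<notin> ?E" for d
    using that inE by (intro coef_eqI) auto
qed

definition graded_map :: "nat \<Rightarrow> nat set \<Rightarrow> (nat \<Rightarrow> nat) \<Rightarrow> nat set \<Rightarrow> (nat \<Rightarrow> nat) \<Rightarrow> (nat \<Rightarrow> (nat \<Rightarrow>\<^sub>0 'k::field mpoly)) \<Rightarrow> bool" where
  "graded_map m B g B' g' D \<longleftrightarrow> (\<forall>b\<in>B. D b \<in> free_mod m B' \<and> homog g' (g b) (D b))"

lemma homog_lin_ext:
  assumes D: "graded_map m B g B' g' D" and x: "keys x \<subseteq> B" "homog g d x"
  shows "homog g' d (lin_ext D x)"
  unfolding homog_def
proof (intro allI impI)
  fix c t assume "coef (lin_ext D x) c t \<noteq> 0"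
  then have "(\<Sum>b\<in>keys x. lookup (lookup x b * lookup (D b) c) t) \<noteq> 0"
    by (simp add: coef_def lookup_lin_ext lookup_sum)
  then obtain b where b: "b \<in> keys x" "lookup (lookup x b * lookup (D b) c) t \<noteq> 0"
    using sum.not_neutral_contains_not_neutral by blast
  then have "t \<in> keys (lookup x b * lookup (D b) c)" by (simp add: in_keys_iff)
  then obtain s u where su: "t = s + u" "s \<in> keys (lookup x b)" "u \<in> keys (lookup (D b) c)"
    using keys_mult by blast
  have "mon_degree s + g b = d" using x(2) su(2) by (auto simp: homog_def coef_def in_keys_iff)
  moreover have "mon_degree u + g' c = g b"
    using D b(1) x(1) su(3) by (auto simp: graded_map_def homog_def coef_def in_keys_iff subset_iff)
  ultimately show "mon_degree t + g' c = d" by (simp add: su(1) mon_degree_add)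
qed

lemma keys_filt: "keys (filt S x) \<subseteq> keys x"
  by (auto simp: filt_def in_keys_iff lookup_mapp)

text \<open>Graded maps commute with taking homogeneous components. Hence kernels are graded, and
  preimages of homogeneous elements can be chosen homogeneous.\<close>

lemma hcomp_lin_ext:
  assumes D: "graded_map m B g B' g' D" and x: "keys x \<subseteq> B"
  shows "hcomp g' d (lin_ext D x) = lin_ext D (hcomp g d x)"
proof -
  obtain E where E: "finite E" "x = (\<Sum>e\<in>E. hcomp g e x)" "\<And>e. e \<notin> E \<Longrightarrow> hcomp g e x = 0"
    using hcomp_decompose by blast
  have "homog g' e (lin_ext D (hcomp g e x))" for e
    using keys_filt x by (intro homog_lin_ext[OF D] homog_hcomp) blast
  then have h: "hcomp g' d (lin_ext D (hcomp g e x)) = (if d = e then lin_ext D (hcomp g e x) else 0)" for e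
    by (rule hcomp_homog)
  have "hcomp g' d (lin_ext D x) = hcomp g' d (\<Sum>e\<in>E. lin_ext D (hcomp g e x))"
    by (subst E(2)) (simp only: lin_ext_sum)
  also have "\<dots> = (\<Sum>e\<in>E. if d = e then lin_ext D (hcomp g e x) else 0)"
    unfolding filt_sum h ..
  also have "\<dots> = (if d \<in> E then lin_ext D (hcomp g d x) else 0)" using E(1) by (rule sum.delta')
  also have "\<dots> = lin_ext D (hcomp g d x)" using E(3)[of d] by simp
  finally show ?thesis .
qed

section \<open>The polynomial ring and the face ideal\<close>

lemma poly_ring_simps [simp]:
  "mult (poly_ring m) = (*)" "one (poly_ring m) = 1" "zero (poly_ring m) = 0" "add (poly_ring m) = (+)"
  by (simp_all add: poly_ring_def)

lemma poly_carrier_iff: "p \<in> carrier (poly_ring m) \<longleftrightarrow> (\<forall>t\<in>keys p. keys t \<subseteq> {1..m})"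
  by (simp add: poly_ring_def)

lemma poly_carrier_0 [simp]: "0 \<in> carrier (poly_ring m)"
  by (simp add: poly_carrier_iff)

lemma poly_carrier_1 [simp]: "1 \<in> carrier (poly_ring m)"
  by (simp add: poly_carrier_iff)

lemma poly_carrier_single: "keys t \<subseteq> {1..m} \<Longrightarrow> single t c \<in> carrier (poly_ring m)"
  by (simp add: poly_carrier_iff)

lemma poly_carrier_add: "p \<in> carrier (poly_ring m) \<Longrightarrow> q \<in> carrier (poly_ring m) \<Longrightarrow> p + q \<in> carrier (poly_ring m)"
  using keys_add[of p q] by (auto simp: poly_carrier_iff)

lemma poly_carrier_uminus: "p \<in> carrier (poly_ring m) \<Longrightarrow> - p \<in> carrier (poly_ring m)"
  by (simp add: poly_carrier_iff in_keys_iff)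

lemma poly_carrier_mult:
  assumes "p \<in> carrier (poly_ring m)" "q \<in> carrier (poly_ring m)"
  shows "p * q \<in> carrier (poly_ring m)"
  unfolding poly_carrier_iff
proof
  fix t assume "t \<in> keys (p * q)"
  then obtain a b where "t = a + b" "a \<in> keys p" "b \<in> keys q" using keys_mult by blast
  then show "keys t \<subseteq> {1..m}" using assms by (simp add: poly_carrier_iff keys_plus_mon)
qed

lemma cring_poly_ring: "cring (poly_ring m :: 'k::field mpoly ring)"
proof (rule cringI)
  show "abelian_group (poly_ring m :: 'k mpoly ring)"
  proof (rule abelian_groupI)
    fix p :: "'k mpoly" assume "p \<in> carrier (poly_ring m)"
    then show "\<exists>q\<in>carrier (poly_ring m). q \<oplus>\<^bsub>poly_ring m\<^esub> p = \<zero>\<^bsub>poly_ring m\<^esub>"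
      using poly_carrier_uminus[of p m] by (intro bexI[of _ "- p"]) auto
  qed (auto simp: poly_carrier_add ac_simps)
  show "comm_monoid (poly_ring m :: 'k mpoly ring)"
    by (rule comm_monoidI) (auto simp: poly_carrier_mult ac_simps)
qed (auto simp: algebra_simps)

lemma poly_mapping_sum_single: "p = (\<Sum>t\<in>keys p. single t (lookup p t))"
proof (rule poly_mapping_eqI)
  fix t
  have "lookup (\<Sum>t\<in>keys p. single t (lookup p t)) t = (\<Sum>s\<in>keys p. if s = t then lookup p t else 0)"
    unfolding lookup_sum by (rule sum.cong) (auto simp: lookup_single when_def)
  then show "lookup p t = lookup (\<Sum>t\<in>keys p. single t (lookup p t)) t" by (simp add: in_keys_iff)
qed

definition ind :: "nat set \<Rightarrow> mon" where "ind I = (\<Sum>i\<in>I. single i 1)"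

lemma lookup_ind: "finite I \<Longrightarrow> lookup (ind I) i = (if i \<in> I then 1 else 0)"
  unfolding ind_def lookup_sum by (simp add: lookup_single when_def)

lemma keys_ind: "finite I \<Longrightarrow> keys (ind I) = I"
  by (auto simp: in_keys_iff lookup_ind split: if_splits)

definition nonface_part :: "nat \<Rightarrow> nat set set \<Rightarrow> 'k::field mpoly set" where
  "nonface_part m K = {p \<in> carrier (poly_ring m). \<forall>t\<in>keys p. keys t \<notin> K}"

text \<open>A monomial whose support is a nonface is divisible by the square-free monomial of that
  support, so the ideal is spanned by such monomials. Conversely, multiplication enlarges supports
  and nonfaces are closed upwards. Membership thereby becomes a condition on supports.\<close>

lemma face_ideal_eq:
  assumes K: "\<And>I J. I \<in> K \<Longrightarrow> J \<subseteq> I \<Longrightarrow> J \<in> K"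
  shows "face_ideal m K = (nonface_part m K :: 'k::field mpoly set)"
proof -
  interpret cring "poly_ring m :: 'k mpoly ring" by (rule cring_poly_ring)
  let ?G = "{sqfree_monomial I |I. I \<subseteq> {1..m} \<and> I \<notin> K} :: 'k mpoly set"
  let ?N = "nonface_part m K :: 'k mpoly set"
  have absorb: "q * p \<in> ?N" if "p \<in> ?N" "q \<in> carrier (poly_ring m)" for p q
    unfolding nonface_part_def
  proof (intro CollectI conjI ballI)
    show "q * p \<in> carrier (poly_ring m)" using that by (intro poly_carrier_mult) (auto simp: nonface_part_def)
    fix t assume "t \<in> keys (q * p)"
    then obtain a b where ab: "t = a + b" "a \<in> keys q" "b \<in> keys p" using keys_mult by blast
    then have "keys b \<notin> K" "keys b \<subseteq> keys t" using that by (auto simp: nonface_part_def keys_plus_mon)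
    then show "keys t \<notin> K" using K by blast
  qed
  have add: "p + q \<in> ?N" if "p \<in> ?N" "q \<in> ?N" for p q
    using that keys_add[of p q] poly_carrier_add[of p m q] by (auto simp: nonface_part_def)
  have "ideal ?N (poly_ring m)"
  proof (rule idealI)
    show "ring (poly_ring m :: 'k mpoly ring)" by (rule ring_axioms)
    show "subgroup ?N (add_monoid (poly_ring m))"
    proof (rule subgroup.intro)
      fix p :: "'k mpoly" assume p: "p \<in> ?N"
      then have pc: "p \<in> carrier (poly_ring m)" by (simp add: nonface_part_def)
      have "inv\<^bsub>add_monoid (poly_ring m)\<^esub> p = - p"
      proof -
        have "\<ominus>\<^bsub>poly_ring m\<^esub> p = - p"
          using minus_equality[of "- p" p] pc poly_carrier_uminus[OF pc] by simp
        then show ?thesis by (simp add: a_inv_def)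
      qed
      then show "inv\<^bsub>add_monoid (poly_ring m)\<^esub> p \<in> ?N"
        using p poly_carrier_uminus[of p m] by (auto simp: nonface_part_def in_keys_iff)
    next
      fix p q :: "'k mpoly" assume "p \<in> ?N" "q \<in> ?N"
      then have "p + q \<in> ?N" by (rule add)
      then show "p \<otimes>\<^bsub>add_monoid (poly_ring m)\<^esub> q \<in> ?N" by simp
    qed (simp_all add: nonface_part_def)
  next
    fix p q :: "'k mpoly" assume "p \<in> ?N" "q \<in> carrier (poly_ring m)"
    then have "q * p \<in> ?N" by (rule absorb)
    then show "q \<otimes>\<^bsub>poly_ring m\<^esub> p \<in> ?N" "p \<otimes>\<^bsub>poly_ring m\<^esub> q \<in> ?N"
      by (simp_all add: mult.commute[of p q])
  qed
  moreover have "?G \<subseteq> ?N"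
  proof
    fix p assume "p \<in> ?G"
    then obtain I where I: "p = sqfree_monomial I" "I \<subseteq> {1..m}" "I \<notin> K" by blast
    then have "finite I" using finite_subset by blast
    then show "p \<in> ?N" using I keys_ind[of I] by (simp add: nonface_part_def sqfree_monomial_def poly_carrier_iff ind_def)
  qed
  ultimately have "face_ideal m K \<subseteq> ?N" unfolding face_ideal_def by (intro genideal_minimal)
  moreover have "?N \<subseteq> face_ideal m K"
  proof
    fix p :: "'k mpoly" assume p: "p \<in> ?N"
    have G: "?G \<subseteq> carrier (poly_ring m)" using \<open>?G \<subseteq> ?N\<close> by (auto simp: nonface_part_def)
    interpret I: ideal "face_ideal m K :: 'k mpoly set" "poly_ring m"
      unfolding face_ideal_def by (rule genideal_ideal[OF G])
    have mono: "single t c \<in> face_ideal m K" if "keys t \<subseteq> {1..m}" "keys t \<notin> K" for t and c :: 'k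
    proof -
      have "t = (t - ind (keys t)) + ind (keys t)"
      proof (rule poly_mapping_eqI)
        fix i
        have "i \<in> keys t \<Longrightarrow> lookup t i \<ge> 1" by (simp add: in_keys_iff)
        then show "lookup t i = lookup ((t - ind (keys t)) + ind (keys t)) i"
          by (auto simp: lookup_add lookup_minus lookup_ind)
      qed
      then have "single t c = single ((t - ind (keys t)) + ind (keys t)) c" by (rule arg_cong)
      moreover have "sqfree_monomial (keys t) = (single (ind (keys t)) 1 :: 'k mpoly)"
        by (simp add: sqfree_monomial_def ind_def)
      ultimately have "single t c = single (t - ind (keys t)) c * sqfree_monomial (keys t)"
        by (simp only: mult_single mult_1_right)
      moreover have "sqfree_monomial (keys t) \<in> (face_ideal m K :: 'k mpoly set)"
        unfolding face_ideal_def using genideal_self[OF G] that by blast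
      moreover have "keys (t - ind (keys t)) \<subseteq> {1..m}" using that by (auto simp: in_keys_iff lookup_minus)
      then have "single (t - ind (keys t)) c \<in> carrier (poly_ring m)" by (rule poly_carrier_single)
      ultimately show ?thesis using I.I_l_closed[of "sqfree_monomial (keys t)" "single (t - ind (keys t)) c"] by simp
    qed
    have "(\<Sum>t\<in>T. single t (lookup p t)) \<in> face_ideal m K" if "finite T" "T \<subseteq> keys p" for T
      using that
    proof (induction T rule: finite_induct)
      case empty
      then show ?case using I.zero_closed by simp
    next
      case (insert t T)
      have "single t (lookup p t) \<in> face_ideal m K"
        using p insert.prems by (intro mono) (auto simp: nonface_part_def poly_carrier_iff)
      then show ?case using I.a_closed insert by simp
    qed
    then show "p \<in> face_ideal m K" using poly_mapping_sum_single[of p] by (metis finite_keys subset_refl)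
  qed
  ultimately show ?thesis by blast
qed

definition aug_poly :: "(nat \<Rightarrow> 'k::field mpoly) \<Rightarrow> (nat \<Rightarrow>\<^sub>0 'k mpoly) \<Rightarrow> 'k mpoly" where
  "aug_poly e x = (\<Sum>b\<in>keys x. lookup x b * e b)"

lemma aug_map_eq: "aug_map m J e x = (\<lambda>h. h + aug_poly e x) ` J"
  by (auto simp: aug_map_def aug_poly_def a_r_coset_def r_coset_def)

lemma nonface_part_diff:
  "p \<in> nonface_part m K \<Longrightarrow> q \<in> nonface_part m K \<Longrightarrow> p - q \<in> nonface_part m K"
  using keys_diff[of p q] poly_carrier_add[of p m "- q"] poly_carrier_uminus[of q m]
  by (auto simp: nonface_part_def)

lemma nonface_part_0: "0 \<in> nonface_part m K"
  by (simp add: nonface_part_def)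

lemma nonface_part_add:
  "p \<in> nonface_part m K \<Longrightarrow> q \<in> nonface_part m K \<Longrightarrow> p + q \<in> nonface_part m K"
  using keys_add[of p q] poly_carrier_add[of p m "q"]
  by (auto simp: nonface_part_def)

lemma nonface_coset_eq_iff:
  "(\<lambda>h. h + p) ` nonface_part m K = (\<lambda>h. h + q) ` nonface_part m K \<longleftrightarrow> p - q \<in> nonface_part m K"
proof
  assume "(\<lambda>h. h + p) ` nonface_part m K = (\<lambda>h. h + q) ` nonface_part m K"
  moreover have "p \<in> (\<lambda>h. h + p) ` nonface_part m K" using nonface_part_0[of m K] by (intro image_eqI[of _ _ 0]) auto
  ultimately obtain h where "h \<in> nonface_part m K" "p = h + q" by auto
  then show "p - q \<in> nonface_part m K" by simp
next
  assume a: "p - q \<in> nonface_part m K"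
  have "h + p \<in> (\<lambda>h. h + q) ` nonface_part m K" if "h \<in> nonface_part m K" for h
    using nonface_part_add[OF that a] by (intro image_eqI[of _ _ "h + (p - q)"]) auto
  moreover have "h + q \<in> (\<lambda>h. h + p) ` nonface_part m K" if "h \<in> nonface_part m K" for h
    using nonface_part_diff[OF that a] by (intro image_eqI[of _ _ "h - (p - q)"]) auto
  ultimately show "(\<lambda>h. h + p) ` nonface_part m K = (\<lambda>h. h + q) ` nonface_part m K" by blast
qed

lemma quot_carrier: "carrier (poly_ring m Quot J) = (\<lambda>p. (\<lambda>h. h + p) ` J) ` carrier (poly_ring m)"
  by (auto simp: FactRing_def A_RCOSETS_def RCOSETS_def r_coset_def image_iff)

lemma quot_zero: "\<zero>\<^bsub>poly_ring m Quot J\<^esub> = J"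
  by (simp add: FactRing_def)

lemma aug_map_zero_iff:
  "aug_map m (nonface_part m K) e x = \<zero>\<^bsub>poly_ring m Quot (nonface_part m K)\<^esub> \<longleftrightarrow> aug_poly e x \<in> nonface_part m K"
  using nonface_coset_eq_iff[of "aug_poly e x" m K 0] by (simp add: aug_map_eq quot_zero)

section \<open>Graded submodules and existence of a resolution\<close>

lemma free_mod_add: "x \<in> free_mod m B \<Longrightarrow> y \<in> free_mod m B \<Longrightarrow> x + y \<in> free_mod m B"
  using keys_add[of x y] by (auto simp: free_mod_def lookup_add poly_carrier_add)

lemma free_mod_0: "0 \<in> free_mod m B"
  by (simp add: free_mod_def)

lemma free_mod_sum: "(\<And>a. a \<in> A \<Longrightarrow> f a \<in> free_mod m B) \<Longrightarrow> sum f A \<in> free_mod m B"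
  by (induction A rule: infinite_finite_induct) (auto simp: free_mod_add free_mod_0)

lemma free_mod_pm_scale: "p \<in> carrier (poly_ring m) \<Longrightarrow> x \<in> free_mod m B \<Longrightarrow> pm_scale p x \<in> free_mod m B"
  using keys_pm_scale[of p x] by (auto simp: free_mod_def lookup_pm_scale poly_carrier_mult)

lemma free_mod_coef: "x \<in> free_mod m B \<longleftrightarrow> (\<forall>b t. coef x b t \<noteq> 0 \<longrightarrow> b \<in> B \<and> keys t \<subseteq> {1..m})"
proof
  assume "x \<in> free_mod m B"
  moreover have "b \<in> keys x \<and> t \<in> keys (lookup x b)" if "coef x b t \<noteq> 0" for b t
    using that by (auto simp: coef_def in_keys_iff)
  ultimately show "\<forall>b t. coef x b t \<noteq> 0 \<longrightarrow> b \<in> B \<and> keys t \<subseteq> {1..m}"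
    unfolding free_mod_def poly_carrier_iff by blast
next
  assume a: "\<forall>b t. coef x b t \<noteq> 0 \<longrightarrow> b \<in> B \<and> keys t \<subseteq> {1..m}"
  have "b \<in> B" if "b \<in> keys x" for b
  proof -
    have "lookup x b \<noteq> 0" using that by (simp add: in_keys_iff)
    then obtain t where "lookup (lookup x b) t \<noteq> 0" by (metis lookup_zero poly_mapping_eqI)
    then show ?thesis using a by (auto simp: coef_def)
  qed
  moreover have "lookup x b \<in> carrier (poly_ring m)" for b
    using a by (auto simp: poly_carrier_iff coef_def in_keys_iff)
  ultimately show "x \<in> free_mod m B" by (auto simp: free_mod_def)
qed

lemma free_mod_filt: "x \<in> free_mod m B \<Longrightarrow> filt S x \<in> free_mod m B"
  by (auto simp: free_mod_coef)

lemma free_mod_lin_ext: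
  assumes "graded_map m B g B' g' D" "x \<in> free_mod m B"
  shows "lin_ext D x \<in> free_mod m B'"
  unfolding lin_ext_def
  using assms by (intro free_mod_sum free_mod_pm_scale) (auto simp: graded_map_def free_mod_def)

lemma finite_basis_piece:
  assumes "\<And>d. finite {b \<in> B. g b = d}"
  shows "finite {(b, t). b \<in> B \<and> keys t \<subseteq> {1..m} \<and> mon_degree t + g b = d}"
proof -
  have "{(b, t). b \<in> B \<and> keys t \<subseteq> {1..m} \<and> mon_degree t + g b = d}
      \<subseteq> (\<Union>e\<in>{..d}. {b \<in> B. g b = e}) \<times> {t. keys t \<subseteq> {1..m} \<and> mon_degree t \<le> d}" by auto
  moreover have "finite ((\<Union>e\<in>{..d}. {b \<in> B. g b = e}) \<times> {t. keys t \<subseteq> {1..m} \<and> mon_degree t \<le> d})"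
    using assms finite_mons by (intro finite_cartesian_product) auto
  ultimately show ?thesis by (rule finite_subset)
qed

lemma fin_span_homog:
  assumes "\<And>d. finite {b \<in> B. g b = d}"
  shows "fin_span kscale {x \<in> free_mod m B. homog g d (x :: nat \<Rightarrow>\<^sub>0 'k::field mpoly)}"
proof -
  let ?T = "{()} \<times> {(b, t). b \<in> B \<and> keys t \<subseteq> {1..m} \<and> mon_degree t + g b = d}"
  have "Vector_Spaces.linear cscale kscale (\<lambda>x :: unit \<Rightarrow> (nat \<Rightarrow>\<^sub>0 'k mpoly). x ())"
    using cv.vector_space_axioms km.vector_space_axioms by (auto simp: Vector_Spaces.linear_iff cscale_def)
  moreover have "finite ?T" using finite_basis_piece[of B g m d] assms by simp
  ultimately have "fin_span kscale ((\<lambda>x :: unit \<Rightarrow> (nat \<Rightarrow>\<^sub>0 'k mpoly). x ()) ` csup ?T)"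
    by (rule fin_span_image[OF _ fin_span_csup])
  moreover have "{x \<in> free_mod m B. homog g d x} \<subseteq> (\<lambda>x :: unit \<Rightarrow> (nat \<Rightarrow>\<^sub>0 'k mpoly). x ()) ` csup ?T"
  proof
    fix x :: "nat \<Rightarrow>\<^sub>0 'k mpoly" assume x: "x \<in> {x \<in> free_mod m B. homog g d x}"
    then have "(\<lambda>_. x) \<in> csup ?T" by (auto simp: csup_def free_mod_coef homog_def)
    then show "x \<in> (\<lambda>x :: unit \<Rightarrow> (nat \<Rightarrow>\<^sub>0 'k mpoly). x ()) ` csup ?T" by (rule_tac image_eqI) auto
  qed
  ultimately show ?thesis by (rule fin_span_mono)
qed

lemma const_carrier [simp]: "single 0 c \<in> carrier (poly_ring m)"
  by (intro poly_carrier_single) simp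

lemma subspace_image_free_mod:
  "km.subspace (lin_ext D ` free_mod m B)"
proof (rule km.subspaceI)
  show "0 \<in> lin_ext D ` free_mod m B" using free_mod_0 by (intro image_eqI[of _ _ 0]) auto
  fix x y assume "x \<in> lin_ext D ` free_mod m B" "y \<in> lin_ext D ` free_mod m B"
  then obtain u v where "x = lin_ext D u" "y = lin_ext D v" "u \<in> free_mod m B" "v \<in> free_mod m B" by blast
  then show "x + y \<in> lin_ext D ` free_mod m B"
    by (intro image_eqI[of _ _ "u + v"]) (auto simp: lin_ext_add free_mod_add)
next
  fix c x assume "x \<in> lin_ext D ` free_mod m B"
  then obtain u where "x = lin_ext D u" "u \<in> free_mod m B" by blast
  then show "kscale c x \<in> lin_ext D ` free_mod m B"
    by (intro image_eqI[of _ _ "kscale c u"]) (auto simp: lin_ext_pm_scale kscale_def free_mod_pm_scale)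
qed

text \<open>A vector space basis of every graded piece serves as the generating set. It is finite in
  each degree because the pieces are finite-dimensional, which is the finiteness that
  \<open>graded_free_resolution\<close> asks for.\<close>

lemma graded_generators_exist:
  fixes M :: "(nat \<Rightarrow>\<^sub>0 'k::field mpoly) set"
  assumes fin: "\<And>d. finite {b \<in> B. g b = d}" and sub: "M \<subseteq> free_mod m B" and zero: "0 \<in> M"
    and add: "\<And>x y. x \<in> M \<Longrightarrow> y \<in> M \<Longrightarrow> x + y \<in> M"
    and scale: "\<And>p x. p \<in> carrier (poly_ring m) \<Longrightarrow> x \<in> M \<Longrightarrow> pm_scale p x \<in> M"
    and comp: "\<And>d x. x \<in> M \<Longrightarrow> hcomp g d x \<in> M"
  shows "\<exists>B' g' D. (\<forall>d. finite {b \<in> B'. g' b = d}) \<and> graded_map m B' g' B g D \<and> lin_ext D ` free_mod m B' = M"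
proof -
  define Md where "Md d = {x \<in> M. homog g d x}" for d
  have "km.subspace (Md d)" for d
  proof (rule km.subspaceI)
    show "0 \<in> Md d" using zero by (simp add: Md_def homog_def)
    fix x y assume "x \<in> Md d" "y \<in> Md d"
    then show "x + y \<in> Md d" using add by (auto simp: Md_def homog_def) (metis add.right_neutral)
  next
    fix c x assume x: "x \<in> Md d"
    then have "kscale c x \<in> M" unfolding kscale_def Md_def by (intro scale) auto
    then show "kscale c x \<in> Md d" using x by (auto simp: Md_def homog_def)
  qed
  moreover have "fin_span kscale (Md d)" for d
    by (rule fin_span_mono[OF fin_span_homog[OF fin, of m d]]) (use sub in \<open>auto simp: Md_def\<close>)
  ultimately have "\<exists>E. E \<subseteq> Md d \<and> km.span E = Md d \<and> finite E" for d
    using fin_span_basis[OF km.vector_space_axioms] by metis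
  then obtain E where E: "\<And>d. E d \<subseteq> Md d" "\<And>d. km.span (E d) = Md d" "\<And>d. finite (E d)" by metis
  have "\<exists>e. bij_betw e {0..<card (E d)} (E d)" for d using E(3) by (rule ex_bij_betw_nat_finite)
  then obtain e where e: "\<And>d. bij_betw (e d) {0..<card (E d)} (E d)" by metis
  \<comment> \<open>Generators have to be natural numbers, so the pair of a degree and a position in
    the basis of that degree is encoded as one.\<close>
  define B' where "B' = prod_encode ` (SIGMA d:UNIV. {0..<card (E d)})"
  define g' where "g' b = fst (prod_decode b)" for b
  define D where "D b = e (g' b) (snd (prod_decode b))" for b
  have B': "b \<in> B' \<longleftrightarrow> snd (prod_decode b) < card (E (g' b))" for b
    unfolding B'_def g'_def by (force simp: image_iff)
  have DE: "D b \<in> E (g' b)" if "b \<in> B'" for b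
    using that e[of "g' b"] unfolding B' D_def by (auto simp: bij_betw_def)
  have DM: "D b \<in> M" "homog g (g' b) (D b)" if "b \<in> B'" for b
    using DE[OF that] E(1) by (auto simp: Md_def)
  have "finite {b \<in> B'. g' b = d}" for d
  proof -
    have "{b \<in> B'. g' b = d} \<subseteq> (\<lambda>i. prod_encode (d, i)) ` {..<card (E d)}"
    proof
      fix b assume "b \<in> {b \<in> B'. g' b = d}"
      then have "b = prod_encode (d, snd (prod_decode b))" "snd (prod_decode b) < card (E d)"
        using B' by (auto simp: g'_def)
      then show "b \<in> (\<lambda>i. prod_encode (d, i)) ` {..<card (E d)}" by blast
    qed
    then show ?thesis by (rule finite_subset) simp
  qed
  moreover have "graded_map m B' g' B g D"
    using DM sub by (auto simp: graded_map_def)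
  moreover have "lin_ext D ` free_mod m B' = M"
  proof
    show "lin_ext D ` free_mod m B' \<subseteq> M"
    proof
      fix y assume "y \<in> lin_ext D ` free_mod m B'"
      then obtain x where x: "x \<in> free_mod m B'" "y = lin_ext D x" by blast
      have "(\<Sum>b\<in>A. pm_scale (lookup x b) (D b)) \<in> M" if "finite A" "A \<subseteq> B'" for A
        using that
      proof (induction A rule: finite_induct)
        case (insert b A)
        have "pm_scale (lookup x b) (D b) \<in> M"
          using x(1) insert.prems by (intro scale DM(1)) (auto simp: free_mod_def)
        then show ?case using insert add by simp
      qed (use zero in simp)
      then show "y \<in> M" using x by (simp add: lin_ext_def free_mod_def)
    qed
    have "x \<in> lin_ext D ` free_mod m B'" if x: "x \<in> Md d" for x d
    proof -
      have "E d \<subseteq> lin_ext D ` free_mod m B'"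
      proof
        fix y assume "y \<in> E d"
        then have "y \<in> e d ` {0..<card (E d)}" using bij_betw_imp_surj_on[OF e[of d]] by simp
        then obtain i where i: "i < card (E d)" "y = e d i" by auto
        let ?b = "prod_encode (d, i)"
        have "y = lin_ext D (single ?b 1)"
          using i by (auto simp: lin_ext_single D_def g'_def intro!: poly_mapping_eqI simp: lookup_pm_scale)
        moreover have "?b \<in> B'" using i unfolding B' g'_def by simp
        then have "single ?b 1 \<in> free_mod m B'" by (auto simp: free_mod_def lookup_single when_def)
        ultimately show "y \<in> lin_ext D ` free_mod m B'" by blast
      qed
      then have "km.span (E d) \<subseteq> lin_ext D ` free_mod m B'" by (rule km.span_minimal[OF _ subspace_image_free_mod])
      then show ?thesis using E(2) x by blast
    qed
    then have piece: "Md d \<subseteq> lin_ext D ` free_mod m B'" for d by blast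
    show "M \<subseteq> lin_ext D ` free_mod m B'"
    proof
      fix x assume x: "x \<in> M"
      obtain Es where "x = (\<Sum>d\<in>Es. hcomp g d x)" using hcomp_decompose by blast
      moreover have "hcomp g d x \<in> lin_ext D ` free_mod m B'" for d
        using comp[OF x] piece[of d] by (auto simp: Md_def homog_hcomp)
      ultimately show "x \<in> lin_ext D ` free_mod m B'"
        using km.subspace_sum[OF subspace_image_free_mod] by metis
    qed
  qed
  ultimately show ?thesis by blast
qed

lemma graded_kernel_generators:
  assumes fin: "\<And>d. finite {b \<in> B. g b = d}" and D: "graded_map m B g B0 g0 D"
  shows "\<exists>B' g' D'. (\<forall>d. finite {b \<in> B'. g' b = d}) \<and> graded_map m B' g' B g D' \<and>
    lin_ext D' ` free_mod m B' = {x \<in> free_mod m B. lin_ext D x = (0 :: nat \<Rightarrow>\<^sub>0 'k::field mpoly)}"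
proof (rule graded_generators_exist[OF fin])
  fix d x assume "x \<in> {x \<in> free_mod m B. lin_ext D x = 0}"
  moreover then have "keys x \<subseteq> B" by (simp add: free_mod_def)
  ultimately show "hcomp g d x \<in> {x \<in> free_mod m B. lin_ext D x = 0}"
    using hcomp_lin_ext[OF D, of x d] by (simp add: free_mod_filt)
qed (auto simp: free_mod_0 free_mod_add free_mod_pm_scale lin_ext_add lin_ext_pm_scale intro!: poly_mapping_eqI simp: lookup_pm_scale)

text \<open>Gives meaning to the choice in \<open>tor_dim\<close>. The resolution starts with one
  generator mapped to 1 and continues by covering each kernel with
  \<open>graded_kernel_generators\<close>.\<close>

lemma graded_free_resolution_exists:
  fixes K :: "nat set set"
  assumes K: "\<And>I J. I \<in> K \<Longrightarrow> J \<subseteq> I \<Longrightarrow> J \<in> K"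
  shows "\<exists>R :: 'k::field free_cplx. graded_free_resolution m (nonface_part m K) R"
proof -
  let ?J = "nonface_part m K :: 'k mpoly set"
  let ?e = "\<lambda>b::nat. 1 :: 'k mpoly"
  have fin0: "finite {b \<in> {0::nat}. (\<lambda>_. 0::nat) b = d}" for d by (rule finite_subset[of _ "{0}"]) auto
  have aug: "aug_poly ?e x = lookup x 0" if "x \<in> free_mod m {0}" for x
  proof -
    have "keys x \<subseteq> {0}" using that by (simp add: free_mod_def)
    then have "keys x = {} \<or> keys x = {0}" by (rule subset_singletonD)
    then show ?thesis
    proof
      assume "keys x = {}"
      then show ?thesis by (simp add: aug_poly_def)
    next
      assume "keys x = {0}"
      then show ?thesis by (simp add: aug_poly_def)
    qed
  qed
  have in_J: "lookup x 0 \<in> ?J \<longleftrightarrow> (\<forall>t. coef x 0 t \<noteq> 0 \<longrightarrow> keys t \<notin> K)" if "x \<in> free_mod m {0}" for x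
    using that by (auto simp: nonface_part_def free_mod_def coef_def in_keys_iff)
  let ?M = "{x \<in> free_mod m {0}. lookup x 0 \<in> ?J}"
  have "\<exists>B' g' D. (\<forall>d. finite {b \<in> B'. g' b = d}) \<and> graded_map m B' g' {0} (\<lambda>_. 0) D \<and> lin_ext D ` free_mod m B' = ?M"
  proof (rule graded_generators_exist[OF fin0])
    fix p :: "'k mpoly" and x assume p: "p \<in> carrier (poly_ring m)" and x: "x \<in> ?M"
    have "p * lookup x 0 \<in> ?J"
      unfolding nonface_part_def
    proof (intro CollectI conjI ballI)
      show "p * lookup x 0 \<in> carrier (poly_ring m)" using p x by (intro poly_carrier_mult) (auto simp: nonface_part_def)
      fix t assume "t \<in> keys (p * lookup x 0)"
      then obtain a b where "t = a + b" "b \<in> keys (lookup x 0)" using keys_mult by blast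
      then have "keys b \<notin> K" "keys b \<subseteq> keys t" using x by (auto simp: nonface_part_def keys_plus_mon)
      then show "keys t \<notin> K" using K by blast
    qed
    then show "pm_scale p x \<in> ?M" using p x by (simp add: free_mod_pm_scale lookup_pm_scale)
  next
    fix d x assume x: "x \<in> ?M"
    then show "hcomp (\<lambda>_. 0) d x \<in> ?M" using in_J[of x] in_J[of "hcomp (\<lambda>_. 0) d x"] by (auto simp: free_mod_filt)
  qed (auto simp: free_mod_0 free_mod_add nonface_part_0 nonface_part_add lookup_add)
  then obtain B1 g1 D1 where s1: "\<forall>d. finite {b \<in> B1. g1 b = d}" "graded_map m B1 g1 {0} (\<lambda>_. 0) D1"
      "lin_ext D1 ` free_mod m B1 = ?M" by blast
  define ok :: "nat set \<times> (nat \<Rightarrow> nat) \<times> (nat \<Rightarrow> (nat \<Rightarrow>\<^sub>0 'k mpoly)) \<Rightarrow> bool" where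
    "ok = (\<lambda>(B, g, D). (\<forall>d. finite {b \<in> B. g b = d}) \<and> (\<exists>B0 g0. graded_map m B g B0 g0 D))"
  define nxt :: "nat set \<times> (nat \<Rightarrow> nat) \<times> (nat \<Rightarrow> (nat \<Rightarrow>\<^sub>0 'k mpoly)) \<Rightarrow> _ \<Rightarrow> bool" where
    "nxt = (\<lambda>(B, g, D) (B', g', D'). graded_map m B' g' B g D' \<and>
        lin_ext D' ` free_mod m B' = {x \<in> free_mod m B. lin_ext D x = 0})"
  \<comment> \<open>A state is one stage of the resolution together with the invariants that the
    next kernel needs; the clause for \<open>n = 0\<close> fixes the first stage.\<close>
  have "\<exists>f. \<forall>n. (ok (f n) \<and> (n = 0 \<longrightarrow> f n = (B1, g1, D1))) \<and> nxt (f n) (f (Suc n))"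
  proof (rule dependent_nat_choice)
    show "\<exists>x. ok x \<and> (0 = (0::nat) \<longrightarrow> x = (B1, g1, D1))" using s1 by (auto simp: ok_def)
    fix x :: "nat set \<times> (nat \<Rightarrow> nat) \<times> (nat \<Rightarrow> (nat \<Rightarrow>\<^sub>0 'k mpoly))" and n :: nat
    assume "ok x \<and> (n = 0 \<longrightarrow> x = (B1, g1, D1))"
    moreover obtain B g D where x: "x = (B, g, D)" by (cases x) auto
    ultimately obtain B0 g0 where fin: "\<And>d. finite {b \<in> B. g b = d}" and D: "graded_map m B g B0 g0 D"
      by (auto simp: ok_def)
    obtain B' g' D' where "\<forall>d. finite {b \<in> B'. g' b = d}" "graded_map m B' g' B g D'"
      "lin_ext D' ` free_mod m B' = {x \<in> free_mod m B. lin_ext D x = 0}"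
      using graded_kernel_generators[OF fin D] by blast
    then have "ok (B', g', D')" "nxt x (B', g', D')" by (auto simp: ok_def nxt_def x)
    then show "\<exists>y. (ok y \<and> (Suc n = 0 \<longrightarrow> y = (B1, g1, D1))) \<and> nxt x y" by blast
  qed
  then obtain f where f: "\<And>n. ok (f n)" "f 0 = (B1, g1, D1)" "\<And>n. nxt (f n) (f (Suc n))" by metis
  \<comment> \<open>\<open>f n\<close> describes position \<open>n + 1\<close> of the resolution,
    since position 0 is the module with a single generator.\<close>
  define R :: "'k free_cplx" where
    "R = \<lparr>gens = \<lambda>i. if i = 0 then {0} else fst (f (i - 1)),
          gdeg = \<lambda>i. if i = 0 then (\<lambda>_. 0) else fst (snd (f (i - 1))),
          bd = \<lambda>i. snd (snd (f (i - 1))), aug = ?e\<rparr>"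
  have R: "gens R 0 = {0}" "gens R (Suc i) = fst (f i)" "gdeg R 0 = (\<lambda>_. 0)" "gdeg R (Suc i) = fst (snd (f i))"
    "bd R (Suc i) = snd (snd (f i))" "aug R = ?e" for i by (simp_all add: R_def)
  have gm: "graded_map m (gens R (Suc i)) (gdeg R (Suc i)) (gens R i) (gdeg R i) (bd R (Suc i))" for i
  proof (cases i)
    case 0
    then show ?thesis using s1(2) by (simp add: R f(2))
  next
    case (Suc j)
    then show ?thesis using f(3)[of j] by (auto simp: R nxt_def split: prod.splits)
  qed
  have "graded_free_resolution m ?J R"
    unfolding graded_free_resolution_def
  proof (intro conjI allI ballI)
    fix i d
    show "finite {b \<in> gens R i. gdeg R i b = d}"
      using f(1)[of "i - 1"] fin0[of d] by (cases i) (auto simp: R ok_def split: prod.splits)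
  next
    fix b assume "b \<in> gens R 0"
    then show "aug R b \<in> carrier (poly_ring m)" by (simp add: R)
    fix t assume "t \<in> keys (aug R b)"
    then show "mon_degree t = gdeg R 0 b" by (simp add: R)
  next
    fix i b assume b: "b \<in> gens R (Suc i)"
    then show "bd R (Suc i) b \<in> free_mod m (gens R i)" using gm by (simp add: graded_map_def)
    fix c t assume "t \<in> keys (lookup (bd R (Suc i) b) c)"
    then show "mon_degree t + gdeg R i c = gdeg R (Suc i) b"
      using gm[of i] b by (auto simp: graded_map_def homog_def coef_def in_keys_iff)
  next
    show "aug_map m ?J (aug R) ` free_mod m (gens R 0) = carrier (poly_ring m Quot ?J)"
    proof -
      have "(\<lambda>x. lookup x 0) ` free_mod m {0} = (carrier (poly_ring m) :: 'k mpoly set)"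
      proof (intro equalityI subsetI)
        fix p :: "'k mpoly" assume "p \<in> carrier (poly_ring m)"
        then have "single 0 p \<in> free_mod m {0}" by (auto simp: free_mod_def lookup_single when_def)
        then show "p \<in> (\<lambda>x. lookup x 0) ` free_mod m {0}" by (intro image_eqI[of _ _ "single 0 p"]) auto
      qed (auto simp: free_mod_def)
      moreover have "aug_map m ?J (aug R) ` free_mod m (gens R 0) = (\<lambda>p. (\<lambda>h. h + p) ` ?J) ` (\<lambda>x. lookup x 0) ` free_mod m {0}"
        unfolding image_image using aug by (intro image_cong) (auto simp: R aug_map_eq)
      ultimately show ?thesis by (simp add: quot_carrier)
    qed
    show "{x \<in> free_mod m (gens R 0). aug_map m ?J (aug R) x = \<zero>\<^bsub>poly_ring m Quot ?J\<^esub>} =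
       lin_ext (bd R 1) ` free_mod m (gens R 1)"
      using aug s1(3) R(2)[of 0] R(5)[of 0] by (auto simp: R aug_map_zero_iff f(2))
  next
    fix i
    show "{x \<in> free_mod m (gens R (Suc i)). lin_ext (bd R (Suc i)) x = 0} =
       lin_ext (bd R (Suc (Suc i))) ` free_mod m (gens R (Suc (Suc i)))"
      using f(3)[of i] by (auto simp: R nxt_def split: prod.splits)
  qed
  then show ?thesis by blast
qed

section \<open>The Koszul complex\<close>

text \<open>An element assigns a module coefficient to each exterior basis set. The basis element at
  \<open>insert l A\<close> goes, up to sign, to \<open>v_l\<close> times the one at
  \<open>A\<close>, so the coefficient at \<open>A\<close> collects one term for every
  \<open>l\<close> outside \<open>A\<close>.\<close>

definition kosz :: "nat \<Rightarrow> (nat set \<Rightarrow> (nat \<Rightarrow>\<^sub>0 'k::field mpoly)) \<Rightarrow> nat set \<Rightarrow> (nat \<Rightarrow>\<^sub>0 'k mpoly)" where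
  "kosz m x A = (\<Sum>l\<in>{1..m} - A. pm_scale (single (single l 1) (sgn_ins l A)) (x (insert l A)))"

declare mon_degree_single [unfolded One_nat_def, simp]

lemma mon_split: "l \<in> keys t \<Longrightarrow> single l 1 + (t - single l 1) = (t :: mon)"
proof (rule poly_mapping_eqI)
  fix i assume "l \<in> keys t"
  then have "lookup t l \<ge> 1" by (simp add: in_keys_iff)
  then show "lookup (single l 1 + (t - single l 1)) i = lookup t i"
    by (auto simp: lookup_add lookup_minus lookup_single when_def)
qed

lemma coef_pm_scale_single:
  "coef (pm_scale (single (single l 1) c) y) b t = (if l \<in> keys t then c * coef y b (t - single l 1) else 0)"
proof (cases "l \<in> keys t")
  case True
  then show ?thesis
    using lookup_single_mult[of "single l 1" c "lookup y b" "t - single l 1"] mon_split[OF True]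
    by (simp add: coef_def lookup_pm_scale)
next
  case False
  then have "t \<noteq> single l 1 + u" for u by (auto simp: keys_plus_mon)
  then show ?thesis using False lookup_single_mult_0[of t "single l 1" c "lookup y b"]
    by (simp add: coef_def lookup_pm_scale)
qed

lemma coef_kosz:
  "coef (kosz m x A) b t = (\<Sum>l\<in>({1..m} - A) \<inter> keys t. sgn_ins l A * coef (x (insert l A)) b (t - single l 1))"
proof -
  have "coef (kosz m x A) b t = (\<Sum>l\<in>{1..m} - A. if l \<in> keys t then sgn_ins l A * coef (x (insert l A)) b (t - single l 1) else 0)"
    unfolding kosz_def coef_sum coef_pm_scale_single ..
  then show ?thesis by (simp add: sum.inter_restrict del: One_nat_def)
qed

lemma kosz_kosz:
  assumes "finite A"
  shows "kosz m (kosz m x) A = (0 :: nat \<Rightarrow>\<^sub>0 'k::field mpoly)"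
proof -
  let ?v = "\<lambda>l. single (single l 1) :: 'k \<Rightarrow> 'k mpoly"
  define f where "f l r = pm_scale (?v l (sgn_ins l A)) (pm_scale (?v r (sgn_ins r (insert l A))) (x (insert r (insert l A))))" for l r
  have "kosz m (kosz m x) A = (\<Sum>l\<in>{1..m} - A. \<Sum>r\<in>({1..m} - A) - {l}. f l r)"
    unfolding kosz_def pm_scale_sum_right f_def by (intro sum.cong) auto
  also have "\<dots> = 0"
  proof (rule antisym_sum_eq_0)
    fix l r assume lr: "l \<in> {1..m} - A" "r \<in> {1..m} - A" "l \<noteq> r"
    have "f l r = pm_scale (single (single l 1 + single r 1) (sgn_ins l A * sgn_ins r (insert l A))) (x (insert r (insert l A)))"
      by (simp add: f_def mult_single flip: pm_scale_mult)
    moreover have "f r l = pm_scale (single (single l 1 + single r 1) (sgn_ins r A * sgn_ins l (insert r A))) (x (insert r (insert l A)))"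
      by (simp add: f_def mult_single add.commute insert_commute flip: pm_scale_mult)
    moreover have "sgn_ins l A * sgn_ins r (insert l A) = - (sgn_ins r A * sgn_ins l (insert r A) :: 'k)"
      using assms lr by (intro sgn_ins_swap) auto
    moreover have "pm_scale (single u (- c)) y = - pm_scale (single u c) y" for u c and y :: "nat \<Rightarrow>\<^sub>0 'k mpoly"
      by (intro poly_mapping_eqI) (simp add: lookup_pm_scale single_uminus)
    ultimately show "f l r = - f r l" by simp
  qed simp
  finally show ?thesis .
qed

text \<open>Basis of the part of total degree \<open>d\<close> in exterior degree \<open>q\<close>;
  each exterior generator has internal degree 2, as its variable does.\<close>

definition Tk :: "nat \<Rightarrow> nat set \<Rightarrow> (nat \<Rightarrow> nat) \<Rightarrow> nat \<Rightarrow> nat \<Rightarrow> (nat set \<times> nat \<times> mon) set" where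
  "Tk m B g d q = {(A, b, t). A \<subseteq> {1..m} \<and> card A = q \<and> b \<in> B \<and> keys t \<subseteq> {1..m} \<and> mon_degree t + g b + 2 * q = d}"

lemma finite_Tk:
  assumes "\<And>d. finite {b \<in> B. g b = d}"
  shows "finite (Tk m B g d q)"
proof -
  let ?S = "{(b, t). b \<in> B \<and> keys t \<subseteq> {1..m} \<and> mon_degree t + g b = d - 2 * q}"
  have "Tk m B g d q \<subseteq> Pow {1..m} \<times> ?S" by (auto simp: Tk_def)
  moreover have "finite {(b, t). b \<in> B \<and> keys t \<subseteq> {1..m} \<and> mon_degree t + g b = d - 2 * q}"
  proof -
    have "?S \<subseteq> (\<Union>e\<in>{..d}. {b \<in> B. g b = e}) \<times> {t. keys t \<subseteq> {1..m} \<and> mon_degree t \<le> d}" by auto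
    moreover have "finite ((\<Union>e\<in>{..d}. {b \<in> B. g b = e}) \<times> {t. keys t \<subseteq> {1..m} \<and> mon_degree t \<le> d})"
      using assms finite_mons by (intro finite_cartesian_product) auto
    ultimately show ?thesis by (rule finite_subset)
  qed
  then have "finite (Pow {1..m} \<times> ?S)" by simp
  ultimately show ?thesis by (rule finite_subset)
qed

lemma mon_degree_minus: "l \<in> keys t \<Longrightarrow> mon_degree t = 2 + mon_degree (t - single l 1)"
  using mon_split[of l t] mon_degree_add[of "single l 1" "t - single l 1"] by (simp del: One_nat_def)

lemma keys_minus_mon: "l \<in> keys t \<Longrightarrow> keys (t :: mon) = insert l (keys (t - single l 1))"
  using mon_split[of l t] keys_plus_mon[of "single l 1" "t - single l 1"] by simp

lemma kosz_csup:
  assumes x: "x \<in> csup (Tk m B g d (Suc q))"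
  shows "kosz m x \<in> csup (Tk m B g d q)"
  unfolding csup_def
proof (intro CollectI allI impI)
  fix A b t assume "coef (kosz m x A) b t \<noteq> 0"
  then obtain l where l: "l \<in> ({1..m} - A) \<inter> keys t" "coef (x (insert l A)) b (t - single l 1) \<noteq> 0"
    unfolding coef_kosz by (metis (no_types, lifting) mult_zero_right sum.neutral)
  then have T: "(insert l A, b, t - single l 1) \<in> Tk m B g d (Suc q)" using x unfolding csup_def by blast
  then have "finite A" using finite_subset[of "insert l A" "{1..m}"] by (auto simp: Tk_def)
  then show "(A, b, t) \<in> Tk m B g d q"
    using T l keys_minus_mon[of l t] mon_degree_minus[of l t] by (auto simp: Tk_def)
qed

text \<open>The contraction moves the smallest index \<open>l\<close> of the multidegree from the monomial into the
  exterior part.\<close>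

lemma kosz_exact:
  fixes x :: "nat set \<Rightarrow> (nat \<Rightarrow>\<^sub>0 'k::field mpoly)"
  assumes fin: "finite (Tk m B g d (Suc q))" and x: "x \<in> csup (Tk m B g d q)"
    and cyc: "kosz m x = 0" and c0: "\<And>b. coef (x {}) b 0 = 0"
  shows "\<exists>y\<in>csup (Tk m B g d (Suc q)). kosz m y = x"
proof -
  define mu where "mu A t = Min (A \<union> keys t)" for A and t :: mon
  define c where "c A b t = (if mu A t \<in> A then coef (x (A - {mu A t})) b (t + single (mu A t) 1) else 0)" for A b t
  have cT: "(A, b, t) \<in> Tk m B g d (Suc q)" if "c A b t \<noteq> 0" for A b t
  proof -
    let ?l = "mu A t"
    have l: "?l \<in> A" and T: "(A - {?l}, b, t + single ?l 1) \<in> Tk m B g d q"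
      using that x by (auto simp: c_def csup_def split: if_splits)
    have "finite (A - {?l})" by (rule finite_subset[of _ "{1..m}"]) (use T in \<open>auto simp: Tk_def\<close>)
    then have "card A = Suc q" using T l card_Suc_Diff1[of A ?l] by (auto simp: Tk_def)
    moreover have "?l \<in> {1..m}" "keys t \<subseteq> {1..m}" using T by (auto simp: Tk_def keys_plus_mon)
    ultimately show ?thesis using T by (auto simp: Tk_def mon_degree_add)
  qed
  obtain y where y: "y \<in> csup (Tk m B g d (Suc q))" and yc: "\<And>A b t. coef (y A) b t = c A b t"
    using csup_ex[OF fin, of c] cT by blast
  have "coef (kosz m y A) b t = coef (x A) b t" for A b t
  proof (cases "A \<subseteq> {1..m} \<and> keys t \<subseteq> {1..m}")
    case False
    then have "(A, b, t) \<notin> Tk m B g d q" by (auto simp: Tk_def)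
    then show ?thesis using csupD[OF x] csupD[OF kosz_csup[OF y]] by simp
  next
    case True
    then have finA: "finite A" using finite_subset by auto
    show ?thesis
    \<comment> \<open>Here there is no index to move: this coefficient is the obstruction coming
      from the augmentation, and \<open>c0\<close> says that it vanishes.\<close>
    proof (cases "A = {} \<and> t = 0")
      case True
      then show ?thesis using c0 by (simp add: coef_kosz)
    next
      case ne: False
      let ?l = "mu A t"
      have "A \<union> keys t \<noteq> {}" using ne by (auto simp: in_keys_iff intro: poly_mapping_eqI)
      then have l: "?l \<in> A \<union> keys t" unfolding mu_def using finA by (intro Min_in) auto
      have lmin: "?l \<le> i" if "i \<in> A \<union> keys t" for i unfolding mu_def using finA that by (intro Min_le) auto
      let ?S = "({1..m} - A) \<inter> keys t"
      \<comment> \<open>Moving \<open>r\<close> from the monomial to the exterior part keeps the set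
        of occurring indices and hence its minimum.\<close>
      have mu: "mu (insert r A) (t - single r 1) = ?l" if "r \<in> ?S" for r
        unfolding mu_def using keys_minus_mon[of r t] that by (intro arg_cong[where f = Min]) auto
      have k: "coef (kosz m y A) b t = (\<Sum>r\<in>?S. sgn_ins r A * (if ?l \<in> insert r A
          then coef (x (insert r A - {?l})) b (t - single r 1 + single ?l 1) else 0))"
        unfolding coef_kosz yc c_def by (rule sum.cong[OF refl]) (simp only: mu)
      show ?thesis
      proof (cases "?l \<in> A")
        case False
        then have lt: "?l \<in> keys t" using l by blast
        then have lS: "?l \<in> ?S" using False True by auto
        have sg: "sgn_ins ?l A = (1 :: 'k)"
        proof -
          have "{a \<in> A. a < ?l} = {}" using lmin by force
          then show ?thesis by (simp only: sgn_ins_def card.empty power_0)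
        qed
        \<comment> \<open>For other \<open>r\<close> the minimum \<open>?l\<close> is not in
          \<open>insert r A\<close>, so the contraction contributes nothing. The remaining sign is
          1, as no element of \<open>A\<close> is smaller than \<open>?l\<close>.\<close>
        have "coef (kosz m y A) b t = (\<Sum>r\<in>?S. if r = ?l then coef (x A) b t else 0)"
          unfolding k using False sg mon_split[OF lt] by (intro sum.cong) (auto simp: add.commute)
        then show ?thesis using lS by (simp add: sum.delta)
      next
        case lA: True
        let ?A = "A - {?l}"
        have lm: "?l \<in> {1..m}" using lA True by auto
        \<comment> \<open>The cycle condition is evaluated with the minimum moved back into the
          monomial. One of its terms is the coefficient sought; the others are the terms of
          \<open>k\<close> up to sign.\<close>
        have "coef (kosz m x ?A) b (t + single ?l 1) = 0" by (simp add: cyc)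
        moreover have "({1..m} - ?A) \<inter> keys (t + single ?l 1) = insert ?l ?S"
          using lA lm by (auto simp: keys_plus_mon)
        ultimately have "0 = (\<Sum>r\<in>insert ?l ?S. sgn_ins r ?A * coef (x (insert r ?A)) b (t + single ?l 1 - single r 1))"
          by (simp add: coef_kosz)
        also have "\<dots> = sgn_ins ?l ?A * coef (x (insert ?l ?A)) b (t + single ?l 1 - single ?l 1)
            + (\<Sum>r\<in>?S. sgn_ins r ?A * coef (x (insert r ?A)) b (t + single ?l 1 - single r 1))"
          using lA by (intro sum.insert) auto
        also have "sgn_ins ?l ?A * coef (x (insert ?l ?A)) b (t + single ?l 1 - single ?l 1) = coef (x A) b t"
        proof -
          have "{a \<in> ?A. a < ?l} = {}" using lmin by force
          then have "sgn_ins ?l ?A = (1 :: 'k)" by (simp only: sgn_ins_def card.empty power_0)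
          moreover have "t + single ?l 1 - single ?l 1 = t" by simp
          ultimately show ?thesis using lA by (simp add: insert_absorb)
        qed
        also have "(\<Sum>r\<in>?S. sgn_ins r ?A * coef (x (insert r ?A)) b (t + single ?l 1 - single r 1))
          = - (\<Sum>r\<in>?S. sgn_ins r A * coef (x (insert r A - {?l})) b (t - single r 1 + single ?l 1))"
          unfolding sum_negf[symmetric]
        proof (rule sum.cong[OF refl])
          fix r assume r: "r \<in> ?S"
          have "?l < r" using lmin[of r] r lA by (auto simp: order.order_iff_strict)
          then have "sgn_ins r (insert ?l ?A) = - (sgn_ins r ?A :: 'k)" using finA by (subst sgn_ins_insert) auto
          then have s: "sgn_ins r A = - (sgn_ins r ?A :: 'k)" using lA by (simp add: insert_absorb)
          have "insert r A - {?l} = insert r ?A" using r lA by auto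
          moreover have "t + single ?l 1 - single r 1 = t - single r 1 + single ?l 1"
          proof -
            have "t + single ?l 1 = single r 1 + (t - single r 1 + single ?l 1)"
              using mon_split[of r t] r by (simp add: add.assoc[symmetric])
            then show ?thesis by simp
          qed
          ultimately show "sgn_ins r ?A * coef (x (insert r ?A)) b (t + single ?l 1 - single r 1)
            = - (sgn_ins r A * coef (x (insert r A - {?l})) b (t - single r 1 + single ?l 1))"
            unfolding s by simp
        qed
        finally have "coef (x A) b t = (\<Sum>r\<in>?S. sgn_ins r A * coef (x (insert r A - {?l})) b (t - single r 1 + single ?l 1))"
          by simp
        then show ?thesis unfolding k using lA by simp
      qed
    qed
  qed
  then have "kosz m y = x" by (intro ext coef_eqI) auto
  then show ?thesis using y by blast
qed

lemma lookup_mult_0: "lookup (p * q) 0 = lookup p 0 * lookup q (0 :: mon)" for p q :: "'k::field mpoly"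
proof -
  have "(lookup q u when (0 :: mon) = l + u) = ((lookup q u when u = 0) when l = 0)" for l u :: mon
  proof -
    have "(0 :: mon) = l + u \<longleftrightarrow> l = 0 \<and> u = 0"
      by (metis add.right_neutral keys_eq_empty keys_plus_mon sup_eq_bot_iff)
    then show ?thesis by (auto simp: when_def)
  qed
  then have "(\<Sum>u. lookup q u when (0 :: mon) = l + u) = (lookup q 0 when l = 0)" for l
    by (cases "l = 0") (simp_all add: when_def)
  then show ?thesis by (simp add: lookup_mult mult_when)
qed

definition cst :: "(nat \<Rightarrow>\<^sub>0 'k::field mpoly) \<Rightarrow> (nat \<Rightarrow>\<^sub>0 'k mpoly)" where
  "cst = filt (\<lambda>b t. t = 0)"

lemma coef_lin_ext:
  assumes "finite B" "keys x \<subseteq> B"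
  shows "coef (lin_ext D x) c t = (\<Sum>b\<in>B. lookup (lookup x b * lookup (D b) c) t)"
  unfolding lin_ext_superset[OF assms] coef_sum by (simp add: coef_def lookup_pm_scale)

lemma coef_lin_ext_0:
  fixes D :: "nat \<Rightarrow> (nat \<Rightarrow>\<^sub>0 'k::field mpoly)"
  shows "coef (lin_ext D x) c 0 = (\<Sum>b\<in>keys x. coef x b 0 * coef (D b) c 0)"
  unfolding coef_lin_ext[OF finite_keys subset_refl] lookup_mult_0 unfolding coef_def ..

text \<open>The constant term of a product is the product of the constant terms, so reducing the
  argument modulo the variables first makes no difference. This is the commutation of the squares at
  the bottom row.\<close>

lemma cst_lin_ext: "cst (lin_ext D (cst x)) = cst (lin_ext D x)"
proof (rule coef_eqI)
  fix c t
  have "coef (lin_ext D (cst x)) c 0 = (\<Sum>b\<in>keys x. lookup (lookup (cst x) b * lookup (D b) c) 0)"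
    unfolding cst_def by (rule coef_lin_ext) (auto intro: keys_filt[THEN subsetD])
  also have "\<dots> = (\<Sum>b\<in>keys x. coef (cst x) b 0 * coef (D b) c 0)"
    by (simp add: lookup_mult_0) (simp add: coef_def)
  also have "\<dots> = coef (lin_ext D x) c 0" by (simp add: cst_def coef_lin_ext_0)
  finally show "coef (cst (lin_ext D (cst x))) c t = coef (cst (lin_ext D x)) c t" by (simp add: cst_def)
qed

lemma lin_ext_kosz: "lin_ext D (kosz m x A) = kosz m (\<lambda>A. lin_ext D (x A)) A"
  by (simp add: kosz_def lin_ext_sum lin_ext_pm_scale)

lemma kosz_add: "kosz m (x + y) = kosz m x + kosz m y"
  by (intro ext) (simp add: kosz_def pm_scale_add_right sum.distrib)

lemma kosz_cscale: "kosz m (cscale c x) = cscale c (kosz m x)"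
  by (intro ext coef_eqI) (simp add: cscale_def coef_kosz sum_distrib_left mult.left_commute)

section \<open>The double complex of a resolution of the face ring\<close>

locale face_resolution =
  fixes m :: nat and K :: "nat set set" and R :: "'k::field free_cplx"
  assumes res: "graded_free_resolution m (nonface_part m K) R"
    and K: "\<And>I J. I \<in> K \<Longrightarrow> J \<subseteq> I \<Longrightarrow> J \<in> K" and KV: "\<And>I. I \<in> K \<Longrightarrow> I \<subseteq> {1..m}"
begin

lemmas res_conj = res[unfolded graded_free_resolution_def]
lemmas res_aug = res_conj[THEN conjunct2, THEN conjunct1]
lemmas res_bd = res_conj[THEN conjunct2, THEN conjunct2, THEN conjunct1]
lemmas res_surj = res_conj[THEN conjunct2, THEN conjunct2, THEN conjunct2, THEN conjunct1]
lemmas res_exact0 = res_conj[THEN conjunct2, THEN conjunct2, THEN conjunct2, THEN conjunct2, THEN conjunct1]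
lemmas res_exact = res_conj[THEN conjunct2, THEN conjunct2, THEN conjunct2, THEN conjunct2, THEN conjunct2, rule_format]

lemma finite_gens: "finite {b \<in> gens R i. gdeg R i b = d}"
  using res by (simp add: graded_free_resolution_def)

lemma graded_map_bd: "graded_map m (gens R (Suc i)) (gdeg R (Suc i)) (gens R i) (gdeg R i) (bd R (Suc i))"
proof -
  have "bd R (Suc i) b \<in> free_mod m (gens R i) \<and> (\<forall>c. \<forall>t\<in>keys (lookup (bd R (Suc i) b) c).
           mon_degree t + gdeg R i c = gdeg R (Suc i) b)" if "b \<in> gens R (Suc i)" for b
    using res_bd that by blast
  then show ?thesis by (auto simp: graded_map_def homog_def coef_def in_keys_iff)
qed

text \<open>The augmentation as a map into the free module on the single generator 0, so that the
  results on \<open>lin_ext\<close> and \<open>hcomp\<close> cover it too.\<close>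

definition "E b = single 0 (aug R b)"

lemma graded_map_E: "graded_map m (gens R 0) (gdeg R 0) {0} (\<lambda>_. 0) E"
proof -
  have 1: "aug R b \<in> carrier (poly_ring m)" "\<And>t. t \<in> keys (aug R b) \<Longrightarrow> mon_degree t = gdeg R 0 b" if "b \<in> gens R 0" for b
    using res_aug that by auto
  have "E b \<in> free_mod m {0}" if "b \<in> gens R 0" for b
    using 1(1)[OF that] by (simp add: E_def free_mod_def lookup_single when_def)
  moreover have "homog (\<lambda>_. 0) (gdeg R 0 b) (E b)" if "b \<in> gens R 0" for b
    using 1(2)[OF that] by (auto simp: homog_def E_def coef_def lookup_single when_def in_keys_iff)
  ultimately show ?thesis by (simp add: graded_map_def)
qed

lemma graded_map_shift:
  "graded_map m B g B' g' D \<Longrightarrow> graded_map m B (\<lambda>b. g b + s) B' (\<lambda>b. g' b + s) D"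
  by (auto simp: graded_map_def homog_def)

text \<open>Normal form modulo the face ideal: monomials supported on nonfaces are dropped.\<close>

definition "fK = filt (\<lambda>b t. keys t \<in> K)"
definition "auge x = fK (lin_ext E x)"
text \<open>The part of total degree \<open>d\<close> when the exterior factor already contributes
  the degree \<open>s\<close>.\<close>

definition "pc B g s d = {x \<in> free_mod m B. homog (\<lambda>b. g b + s) d x}"
definition "pcN s d = {x. \<forall>b t. coef x b t \<noteq> 0 \<longrightarrow> b = 0 \<and> keys t \<in> K \<and> mon_degree t + s = d}"

lemma hcomp_pc: "x \<in> free_mod m B \<Longrightarrow> hcomp (\<lambda>b. g b + s) d x \<in> pc B g s d"
  by (simp add: pc_def free_mod_filt homog_hcomp)

lemma pc_free: "x \<in> pc B g s d \<Longrightarrow> x \<in> free_mod m B"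
  by (simp add: pc_def)

lemma pc_keys: "x \<in> free_mod m B \<Longrightarrow> keys x \<subseteq> B"
  by (simp add: free_mod_def)

lemma lin_ext_pc:
  assumes "graded_map m B g B' g' D" "x \<in> pc B g s d"
  shows "lin_ext D x \<in> pc B' g' s d"
  using assms free_mod_lin_ext[OF assms(1)] homog_lin_ext[OF graded_map_shift[OF assms(1)], of x s d]
  by (auto simp: pc_def free_mod_def)

text \<open>A preimage of a homogeneous element may be replaced by its homogeneous component, so
  exactness passes to the graded pieces.\<close>

lemma pc_lift:
  assumes D: "graded_map m B g B' g' D" and y: "y \<in> free_mod m B" and x: "lin_ext D y \<in> pc B' g' s d"
  shows "lin_ext D (hcomp (\<lambda>b. g b + s) d y) = lin_ext D y"
proof -
  have "lin_ext D (hcomp (\<lambda>b. g b + s) d y) = hcomp (\<lambda>b. g' b + s) d (lin_ext D y)"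
    using hcomp_lin_ext[OF graded_map_shift[OF D], of y s d] pc_keys[OF y] by simp
  also have "\<dots> = lin_ext D y" using x by (subst hcomp_homog[where e = d]) (auto simp: pc_def)
  finally show ?thesis .
qed

lemma pc_exact:
  "lin_ext (bd R (Suc (Suc i))) ` pc (gens R (Suc (Suc i))) (gdeg R (Suc (Suc i))) s d
    = {x \<in> pc (gens R (Suc i)) (gdeg R (Suc i)) s d. lin_ext (bd R (Suc i)) x = 0}"
proof -
  have ex: "{x \<in> free_mod m (gens R (Suc i)). lin_ext (bd R (Suc i)) x = 0} =
       lin_ext (bd R (Suc (Suc i))) ` free_mod m (gens R (Suc (Suc i)))"
    by (rule res_exact)
  show ?thesis
  proof (intro equalityI subsetI)
    fix x assume "x \<in> lin_ext (bd R (Suc (Suc i))) ` pc (gens R (Suc (Suc i))) (gdeg R (Suc (Suc i))) s d"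
    then obtain y where y: "x = lin_ext (bd R (Suc (Suc i))) y" "y \<in> pc (gens R (Suc (Suc i))) (gdeg R (Suc (Suc i))) s d" by blast
    then have "x \<in> {x \<in> free_mod m (gens R (Suc i)). lin_ext (bd R (Suc i)) x = 0}"
      unfolding ex using pc_free by blast
    then show "x \<in> {x \<in> pc (gens R (Suc i)) (gdeg R (Suc i)) s d. lin_ext (bd R (Suc i)) x = 0}"
      using lin_ext_pc[OF graded_map_bd y(2)] y(1) by simp
  next
    fix x assume x: "x \<in> {x \<in> pc (gens R (Suc i)) (gdeg R (Suc i)) s d. lin_ext (bd R (Suc i)) x = 0}"
    then have "x \<in> {x \<in> free_mod m (gens R (Suc i)). lin_ext (bd R (Suc i)) x = 0}" by (simp add: pc_def)
    then obtain y where y: "y \<in> free_mod m (gens R (Suc (Suc i)))" "x = lin_ext (bd R (Suc (Suc i))) y"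
      unfolding ex by blast
    then have "x = lin_ext (bd R (Suc (Suc i))) (hcomp (\<lambda>b. gdeg R (Suc (Suc i)) b + s) d y)"
      using pc_lift[OF graded_map_bd y(1), of s d] x by simp
    then show "x \<in> lin_ext (bd R (Suc (Suc i))) ` pc (gens R (Suc (Suc i))) (gdeg R (Suc (Suc i))) s d"
      using hcomp_pc[OF y(1)] by (rule image_eqI)
  qed
qed

lemma lookup_lin_ext_E: "lookup (lin_ext E x) b = (if b = 0 then aug_poly (aug R) x else 0)"
  by (auto simp: lookup_lin_ext E_def aug_poly_def lookup_single when_def)

lemma auge_zero_iff:
  assumes "x \<in> free_mod m (gens R 0)"
  shows "auge x = 0 \<longleftrightarrow> aug_poly (aug R) x \<in> nonface_part m K"
proof -
  have "lin_ext E x \<in> free_mod m {0}" using free_mod_lin_ext[OF graded_map_E assms] .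
  then have c: "aug_poly (aug R) x \<in> carrier (poly_ring m)"
    by (metis (mono_tags, lifting) free_mod_def lookup_lin_ext_E mem_Collect_eq)
  have "auge x = 0 \<longleftrightarrow> (\<forall>b t. coef (auge x) b t = 0)" using coef_eqI[of "auge x" 0] by auto
  also have "\<dots> \<longleftrightarrow> (\<forall>t. keys t \<in> K \<longrightarrow> lookup (aug_poly (aug R) x) t = 0)"
    by (auto simp: auge_def fK_def coef_def[of "lin_ext E x"] lookup_lin_ext_E)
  also have "\<dots> \<longleftrightarrow> aug_poly (aug R) x \<in> nonface_part m K"
    using c by (auto simp: nonface_part_def in_keys_iff)
  finally show ?thesis .
qed

lemma fK_hcomp: "fK (filt S x) = filt S (fK x)"
  by (rule coef_eqI) (simp add: fK_def)

lemma pc_exact0: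
  "lin_ext (bd R (Suc 0)) ` pc (gens R (Suc 0)) (gdeg R (Suc 0)) s d
    = {x \<in> pc (gens R 0) (gdeg R 0) s d. auge x = 0}"
proof -
  have "{x \<in> free_mod m (gens R 0). aug_map m (nonface_part m K) (aug R) x = \<zero>\<^bsub>poly_ring m Quot nonface_part m K\<^esub>} =
       lin_ext (bd R 1) ` free_mod m (gens R 1)"
    by (rule res_exact0)
  then have ex: "{x \<in> free_mod m (gens R 0). auge x = 0} = lin_ext (bd R (Suc 0)) ` free_mod m (gens R (Suc 0))"
    using auge_zero_iff by (auto simp: aug_map_zero_iff)
  show ?thesis
  proof (intro equalityI subsetI)
    fix x assume "x \<in> lin_ext (bd R (Suc 0)) ` pc (gens R (Suc 0)) (gdeg R (Suc 0)) s d"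
    then obtain y where y: "x = lin_ext (bd R (Suc 0)) y" "y \<in> pc (gens R (Suc 0)) (gdeg R (Suc 0)) s d" by blast
    then have "x \<in> {x \<in> free_mod m (gens R 0). auge x = 0}"
      unfolding ex using pc_free by blast
    then show "x \<in> {x \<in> pc (gens R 0) (gdeg R 0) s d. auge x = 0}"
      using lin_ext_pc[OF graded_map_bd y(2)] y(1) by simp
  next
    fix x assume x: "x \<in> {x \<in> pc (gens R 0) (gdeg R 0) s d. auge x = 0}"
    then have "x \<in> {x \<in> free_mod m (gens R 0). auge x = 0}" by (simp add: pc_def)
    then obtain y where y: "y \<in> free_mod m (gens R (Suc 0))" "x = lin_ext (bd R (Suc 0)) y"
      unfolding ex by blast
    then have "x = lin_ext (bd R (Suc 0)) (hcomp (\<lambda>b. gdeg R (Suc 0) b + s) d y)"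
      using pc_lift[OF graded_map_bd y(1), of s d] x by simp
    then show "x \<in> lin_ext (bd R (Suc 0)) ` pc (gens R (Suc 0)) (gdeg R (Suc 0)) s d"
      using hcomp_pc[OF y(1)] by (rule image_eqI)
  qed
qed

lemma auge_pc: "auge ` pc (gens R 0) (gdeg R 0) s d = pcN s d"
proof (intro equalityI subsetI)
  fix x assume "x \<in> auge ` pc (gens R 0) (gdeg R 0) s d"
  then obtain y where y: "x = auge y" "y \<in> pc (gens R 0) (gdeg R 0) s d" by blast
  have "lin_ext E y \<in> pc {0} (\<lambda>_. 0) s d" by (rule lin_ext_pc[OF graded_map_E y(2)])
  then show "x \<in> pcN s d"
    unfolding y(1) auge_def fK_def pcN_def by (auto simp: pc_def homog_def free_mod_coef)
next
  fix x :: "nat \<Rightarrow>\<^sub>0 'k mpoly" assume x: "x \<in> pcN s d"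
  then have z: "coef x b t = 0" if "\<not> (b = 0 \<and> keys t \<in> K \<and> mon_degree t + s = d)" for b t
    using that unfolding pcN_def by blast
  have x0: "x \<in> free_mod m {0}" using x KV by (auto simp: pcN_def free_mod_coef)
  have hx: "hcomp (\<lambda>_. 0 + s) d x = x" by (rule coef_eqI) (use z in auto)
  have p: "lookup x 0 \<in> carrier (poly_ring m)" using x0 by (simp add: free_mod_def)
  have "aug_map m (nonface_part m K) (aug R) ` free_mod m (gens R 0) = carrier (poly_ring m Quot nonface_part m K)"
    by (rule res_surj)
  then have "(\<lambda>h. h + lookup x 0) ` nonface_part m K \<in> aug_map m (nonface_part m K) (aug R) ` free_mod m (gens R 0)"
    using p by (auto simp: quot_carrier)
  then obtain y where y: "y \<in> free_mod m (gens R 0)"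
      "(\<lambda>h. h + lookup x 0) ` nonface_part m K = (\<lambda>h. h + aug_poly (aug R) y) ` nonface_part m K"
    by (auto simp: aug_map_eq)
  then have dif: "lookup x 0 - aug_poly (aug R) y \<in> nonface_part m K" using nonface_coset_eq_iff by blast
  have "x = auge y"
  proof (rule coef_eqI)
    fix b t
    show "coef x b t = coef (auge y) b t"
    proof (cases "b = 0 \<and> keys t \<in> K")
      case True
      then have "t \<notin> keys (lookup x 0 - aug_poly (aug R) y)" using dif by (auto simp: nonface_part_def)
      then have "lookup (lookup x 0) t = lookup (aug_poly (aug R) y) t" by (simp add: in_keys_iff lookup_minus)
      then show ?thesis using True by (simp add: auge_def fK_def coef_def[of "lin_ext E y"] lookup_lin_ext_E coef_def[of x])
    next
      case False
      then have "coef x b t = 0" using x by (auto simp: pcN_def)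
      moreover have "coef (auge y) b t = 0" using False by (auto simp: auge_def fK_def coef_def[of "lin_ext E y"] lookup_lin_ext_E)
      ultimately show ?thesis by simp
    qed
  qed
  moreover have "auge (hcomp (\<lambda>b. gdeg R 0 b + s) d y) = hcomp (\<lambda>_. 0 + s) d (auge y)"
    unfolding auge_def fK_hcomp[symmetric] using hcomp_lin_ext[OF graded_map_shift[OF graded_map_E], of y s d] pc_keys[OF y(1)]
    by simp
  ultimately have "x = auge (hcomp (\<lambda>b. gdeg R 0 b + s) d y)" using hx by simp
  then show "x \<in> auge ` pc (gens R 0) (gdeg R 0) s d" using hcomp_pc[OF y(1)] by blast
qed

text \<open>The double complex is the resolution tensored with the Koszul complex, extended by one row and one
  column. Row \<open>q = 0\<close> is the resolution tensored with the field, column \<open>p = 0\<close> is the Koszul complex of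
  the face ring; \<open>p\<close> and \<open>q\<close> are shifted by one. The module at \<open>(p, q)\<close> is spanned by the basis elements
  in \<open>Tc d p q\<close>, and the face ring is represented by the polynomials supported on faces.\<close>

definition Tc :: "nat \<Rightarrow> nat \<Rightarrow> nat \<Rightarrow> (nat set \<times> nat \<times> mon) set" where
  "Tc d p q = (case p of
      0 \<Rightarrow> (case q of 0 \<Rightarrow> {} | Suc q \<Rightarrow> {(A, b, t). A \<subseteq> {1..m} \<and> card A = q \<and> b = 0 \<and> keys t \<in> K \<and> mon_degree t + 2 * q = d})
    | Suc p \<Rightarrow> (case q of 0 \<Rightarrow> {(A, b, t). A = {} \<and> b \<in> gens R p \<and> t = 0 \<and> gdeg R p b = d}
        | Suc q \<Rightarrow> Tk m (gens R p) (gdeg R p) d q))"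

definition d1 :: "nat \<Rightarrow> nat \<Rightarrow> (nat set \<Rightarrow> (nat \<Rightarrow>\<^sub>0 'k mpoly)) \<Rightarrow> nat set \<Rightarrow> (nat \<Rightarrow>\<^sub>0 'k mpoly)" where
  "d1 p q x = (case p of
      0 \<Rightarrow> (case q of 0 \<Rightarrow> (\<lambda>A. 0) | Suc q \<Rightarrow> (\<lambda>A. auge (x A)))
    | Suc p \<Rightarrow> (case q of 0 \<Rightarrow> (\<lambda>A. cst (lin_ext (bd R (Suc p)) (x A)))
        | Suc q \<Rightarrow> (\<lambda>A. lin_ext (bd R (Suc p)) (x A))))"

text \<open>In column 0 the product of a face monomial with a variable may have a nonface as
  support, hence the reduction by \<open>fK\<close>. Into the bottom row the map takes constant
  terms.\<close>

definition d2 :: "nat \<Rightarrow> nat \<Rightarrow> (nat set \<Rightarrow> (nat \<Rightarrow>\<^sub>0 'k mpoly)) \<Rightarrow> nat set \<Rightarrow> (nat \<Rightarrow>\<^sub>0 'k mpoly)" where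
  "d2 p q x = (case p of
      0 \<Rightarrow> (case q of 0 \<Rightarrow> (\<lambda>A. 0) | Suc q \<Rightarrow> (\<lambda>A. fK (kosz m x A)))
    | Suc p \<Rightarrow> (case q of 0 \<Rightarrow> (\<lambda>A. cst (x A)) | Suc q \<Rightarrow> kosz m x))"

abbreviation "CC d p q \<equiv> csup (Tc d p q) :: (nat set \<Rightarrow> (nat \<Rightarrow>\<^sub>0 'k mpoly)) set"

lemma finite_Tc: "finite (Tc d p q)"
proof (cases p)
  case 0
  have "{(A, b, t). A \<subseteq> {1..m} \<and> card A = r \<and> b = (0::nat) \<and> keys t \<in> K \<and> mon_degree t + 2 * r = d}
      \<subseteq> Pow {1..m} \<times> {0} \<times> {t. keys t \<subseteq> {1..m} \<and> mon_degree t \<le> d}" for r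
    using KV by auto
  moreover have "finite (Pow {1..m} \<times> {0::nat} \<times> {t. keys t \<subseteq> {1..m} \<and> mon_degree t \<le> d})"
    using finite_mons by simp
  ultimately have "finite {(A, b, t). A \<subseteq> {1..m} \<and> card A = r \<and> b = (0::nat) \<and> keys t \<in> K \<and> mon_degree t + 2 * r = d}" for r
    by (rule finite_subset)
  then show ?thesis using 0 by (cases q) (simp_all add: Tc_def)
next
  case (Suc p')
  have e: "{(A, b, t). A = {} \<and> b \<in> gens R p' \<and> t = 0 \<and> gdeg R p' b = d} = {{}} \<times> {b \<in> gens R p'. gdeg R p' b = d} \<times> {0}"
    by auto
  have "finite {(A, b, t). A = ({} :: nat set) \<and> b \<in> gens R p' \<and> t = (0 :: mon) \<and> gdeg R p' b = d}"
    unfolding e using finite_gens[of p' d] by (intro finite_cartesian_product) auto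
  then show ?thesis using Suc finite_Tk[OF finite_gens] by (cases q) (simp_all add: Tc_def)
qed

lemma cst_add: "cst (x + y) = cst x + cst y" and cst_kscale: "cst (kscale c x) = kscale c (cst x)"
  by (simp_all add: cst_def filt_add filt_kscale)

lemma fK_add: "fK (x + y) = fK x + fK y" and fK_kscale: "fK (kscale c x) = kscale c (fK x)"
  by (simp_all add: fK_def filt_add filt_kscale)

lemma linear_d1: "Vector_Spaces.linear cscale cscale (d1 p q)"
  unfolding Vector_Spaces.linear_iff d1_def
  using cv.vector_space_axioms
  by (auto split: nat.splits simp: fun_eq_iff cscale_def lin_ext_add lin_ext_kscale cst_add cst_kscale fK_add fK_kscale auge_def)

lemma linear_d2: "Vector_Spaces.linear cscale cscale (d2 p q)"
  unfolding Vector_Spaces.linear_iff d2_def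
  using cv.vector_space_axioms
  by (auto split: nat.splits simp: fun_eq_iff kosz_add kosz_cscale cst_add cst_kscale fK_add fK_kscale)
    (auto simp: cscale_def cst_kscale fK_kscale)

text \<open>Divisors of a monomial supported on a face are again supported on faces, so monomials
  dropped beforehand cannot reach a face monomial. In other words, the Koszul differential descends
  to the face ring.\<close>

lemma fK_kosz_fK: "fK (kosz m (\<lambda>A. fK (z A)) A) = fK (kosz m z A)"
proof (rule coef_eqI)
  fix b t
  show "coef (fK (kosz m (\<lambda>A. fK (z A)) A)) b t = coef (fK (kosz m z A)) b t"
  proof (cases "keys t \<in> K")
    case True
    have "keys (t - single l 1) \<in> K" for l
      by (rule K[OF True]) (auto simp: in_keys_iff lookup_minus)
    then show ?thesis unfolding fK_def coef_filt coef_kosz by simp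
  qed (simp add: fK_def)
qed

lemma d1_d2: "d1 p q (d2 (Suc p) q x) = d2 p q (d1 p (Suc q) x)"
proof (cases p; cases q)
  fix q' assume "p = 0" "q = Suc q'"
  then show ?thesis by (intro ext) (simp add: d1_def d2_def auge_def lin_ext_kosz fK_kosz_fK)
next
  fix p' assume "p = Suc p'" "q = 0"
  then show ?thesis by (intro ext) (simp add: d1_def d2_def cst_lin_ext)
next
  fix p' q' assume "p = Suc p'" "q = Suc q'"
  then show ?thesis by (intro ext) (simp add: d1_def d2_def lin_ext_kosz)
qed (simp add: d1_def d2_def)

lemma csup_pointwise: "x \<in> csup T \<longleftrightarrow> (\<forall>A. x A \<in> {y. \<forall>b t. coef y b t \<noteq> 0 \<longrightarrow> (A, b, t) \<in> T})"
  by (auto simp: csup_def)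

lemma pointwise_image:
  assumes "\<And>A. f ` W A = W' A"
  shows "(\<lambda>x A. f (x A)) ` {x. \<forall>A. x A \<in> W A} = {y. \<forall>A. y A \<in> W' A}"
proof (intro equalityI subsetI)
  fix y assume "y \<in> {y. \<forall>A. y A \<in> W' A}"
  then have "\<forall>A. \<exists>z\<in>W A. y A = f z" using assms by blast
  then obtain x where "\<forall>A. x A \<in> W A \<and> y A = f (x A)" by metis
  then show "y \<in> (\<lambda>x A. f (x A)) ` {x. \<forall>A. x A \<in> W A}" by (intro image_eqI[of _ _ x]) auto
qed (use assms in blast)

text \<open>Row differentials act on each exterior set \<open>A\<close> separately, so exactness of
  a row can be checked one \<open>A\<close> at a time and reassembled by
  \<open>pointwise_image\<close>.\<close>

definition slc :: "nat set \<Rightarrow> nat \<Rightarrow> (nat \<Rightarrow>\<^sub>0 'k mpoly) set \<Rightarrow> (nat \<Rightarrow>\<^sub>0 'k mpoly) set" where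
  "slc A q W = (if A \<subseteq> {1..m} \<and> card A = q then W else {0})"

lemma CC_Suc_Suc: "CC d (Suc p) (Suc q) = {x. \<forall>A. x A \<in> slc A q (pc (gens R p) (gdeg R p) (2 * q) d)}"
proof -
  have "{y. \<forall>b t. coef y b t \<noteq> 0 \<longrightarrow> (A, b, t) \<in> Tk m (gens R p) (gdeg R p) d q}
      = slc A q (pc (gens R p) (gdeg R p) (2 * q) d)" for A
  proof (cases "A \<subseteq> {1..m} \<and> card A = q")
    case True
    then show ?thesis unfolding slc_def pc_def Tk_def homog_def free_mod_coef by (simp add: add.assoc) blast
  next
    case False
    then have "(A, b, t) \<notin> Tk m (gens R p) (gdeg R p) d q" for b t by (auto simp: Tk_def)
    then show ?thesis using False by (auto simp: slc_def intro!: coef_eqI)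
  qed
  then show ?thesis by (auto simp: csup_pointwise Tc_def)
qed

lemma CC_0_Suc: "CC d 0 (Suc q) = {x. \<forall>A. x A \<in> slc A q (pcN (2 * q) d)}"
proof -
  have "{y. \<forall>b t. coef y b t \<noteq> 0 \<longrightarrow> (A, b, t) \<in> Tc d 0 (Suc q)}
      = slc A q (pcN (2 * q) d)" for A
  proof (cases "A \<subseteq> {1..m} \<and> card A = q")
    case True
    then show ?thesis by (auto simp: slc_def pcN_def Tc_def)
  next
    case False
    then have "(A, b, t) \<notin> Tc d 0 (Suc q)" for b t by (auto simp: Tc_def)
    then show ?thesis using False by (auto simp: slc_def intro!: coef_eqI)
  qed
  then show ?thesis by (auto simp: csup_pointwise)
qed

lemma auge_0: "auge 0 = 0"
  by (simp add: auge_def fK_def)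

text \<open>Above the bottom, a row consists of copies of the augmented resolution in shifted
  degree, one for each exterior set of the given size. The bottom row is excluded: its homology is
  Tor.\<close>

lemma d1_rows:
  assumes "q > 0"
  shows "d1 p q ` CC d (Suc p) q = row_cycles (CC d) d1 p q"
proof -
  obtain r where q: "q = Suc r" using assms by (cases q) auto
  show ?thesis
  proof (cases p)
    case 0
    have "auge ` slc A r (pc (gens R 0) (gdeg R 0) (2 * r) d) = slc A r (pcN (2 * r) d)" for A
      using auge_pc auge_0 by (auto simp: slc_def)
    from pointwise_image[where W = "\<lambda>A. slc A r (pc (gens R 0) (gdeg R 0) (2 * r) d)" and W' = "\<lambda>A. slc A r (pcN (2 * r) d)", OF this]
    moreover have "d1 0 (Suc r) = (\<lambda>x A. auge (x A))" by (intro ext) (simp add: d1_def)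
    moreover have "row_cycles (CC d) d1 0 (Suc r) = CC d 0 (Suc r)" by (simp add: row_cycles_def)
    ultimately show ?thesis unfolding 0 q CC_Suc_Suc CC_0_Suc by (simp only:)
  next
    case (Suc i)
    let ?ker = "if i = 0 then auge else lin_ext (bd R i)"
    have "lin_ext (bd R (Suc i)) ` pc (gens R (Suc i)) (gdeg R (Suc i)) s d = {x \<in> pc (gens R i) (gdeg R i) s d. ?ker x = 0}" for s
      using pc_exact pc_exact0 by (cases i) auto
    then have "lin_ext (bd R (Suc i)) ` slc A r (pc (gens R (Suc i)) (gdeg R (Suc i)) (2 * r) d)
        = {x \<in> slc A r (pc (gens R i) (gdeg R i) (2 * r) d). ?ker x = 0}" for A
      using auge_0 by (auto simp: slc_def)
    from pointwise_image[where W = "\<lambda>A. slc A r (pc (gens R (Suc i)) (gdeg R (Suc i)) (2 * r) d)"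
        and W' = "\<lambda>A. {x \<in> slc A r (pc (gens R i) (gdeg R i) (2 * r) d). ?ker x = 0}", OF this]
    moreover have "{y. \<forall>A. y A \<in> {x \<in> slc A r (pc (gens R i) (gdeg R i) (2 * r) d). ?ker x = 0}}
        = {x \<in> CC d (Suc i) (Suc r). \<forall>A. ?ker (x A) = 0}"
      unfolding CC_Suc_Suc by blast
    moreover have "d1 i (Suc r) x = 0 \<longleftrightarrow> (\<forall>A. ?ker (x A) = 0)" for x
      by (cases i) (simp_all add: d1_def fun_eq_iff)
    then have "row_cycles (CC d) d1 (Suc i) (Suc r) = {x \<in> CC d (Suc i) (Suc r). \<forall>A. ?ker (x A) = 0}"
      by (simp only: row_cycles_def nat.distinct if_False diff_Suc_1)
    moreover have "d1 (Suc i) (Suc r) = (\<lambda>x A. lin_ext (bd R (Suc i)) (x A))" by (intro ext) (simp add: d1_def)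
    ultimately show ?thesis unfolding Suc q by (simp only: CC_Suc_Suc[of d "Suc i"])
  qed
qed

lemma CC_Suc_0: "x \<in> CC d (Suc p) 0 \<longleftrightarrow> x \<in> CC d (Suc p) (Suc 0) \<and> (\<lambda>A. cst (x A)) = x"
proof
  assume x: "x \<in> CC d (Suc p) 0"
  then have z: "coef (x A) b t \<noteq> 0 \<Longrightarrow> A = {} \<and> b \<in> gens R p \<and> t = 0 \<and> gdeg R p b = d" for A b t
    by (auto simp: csup_def Tc_def)
  have "cst (x A) = x A" for A using z by (intro coef_eqI) (auto simp: cst_def)
  then have e: "(\<lambda>A. cst (x A)) = x" by (rule ext)
  have "x \<in> CC d (Suc p) (Suc 0)"
    unfolding csup_def
  proof (intro CollectI allI impI)
    fix A b t assume "coef (x A) b t \<noteq> 0"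
    from z[OF this] show "(A, b, t) \<in> Tc d (Suc p) (Suc 0)" by (simp add: Tc_def Tk_def)
  qed
  then show "x \<in> CC d (Suc p) (Suc 0) \<and> (\<lambda>A. cst (x A)) = x" using e by (rule conjI)
next
  assume x: "x \<in> CC d (Suc p) (Suc 0) \<and> (\<lambda>A. cst (x A)) = x"
  show "x \<in> CC d (Suc p) 0"
    unfolding csup_def
  proof (intro CollectI allI impI)
    fix A b t assume nz: "coef (x A) b t \<noteq> 0"
    then have "coef (cst (x A)) b t \<noteq> 0" using x by metis
    then have "t = 0" by (auto simp: cst_def split: if_splits)
    moreover have "(A, b, t) \<in> Tk m (gens R p) (gdeg R p) d 0" using x nz by (auto simp: csup_def Tc_def)
    moreover have "finite A" using calculation finite_subset[of A "{1..m}"] by (auto simp: Tk_def)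
    ultimately show "(A, b, t) \<in> Tc d (Suc p) 0" by (auto simp: Tc_def Tk_def)
  qed
qed

lemma csup_Tk_outside:
  assumes "x \<in> csup (Tk m B g d r)" "\<not> (finite A \<and> card A = r)"
  shows "coef (x A) b u = 0"
proof -
  have "A \<subseteq> {1..m} \<and> card A = r" if "(A, b, u) \<in> Tk m B g d r" using that by (simp add: Tk_def)
  then have "(A, b, u) \<notin> Tk m B g d r" using assms(2) finite_subset[of A "{1..m}"] by blast
  then show ?thesis using assms(1) unfolding csup_def by blast
qed

lemma image_fixed: "y \<in> A \<Longrightarrow> f y = y \<Longrightarrow> y \<in> f ` A"
  by (rule image_eqI[of _ _ y]) simp_all

text \<open>Column \<open>p > 0\<close> is the Koszul complex of a free module followed by the
  constant-term map; it is exact by the contraction of \<open>kosz_exact\<close>.\<close>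

lemma d2_cols:
  assumes "p > 0"
  shows "d2 p q ` CC d p (Suc q) = col_cycles (CC d) d2 p q"
proof -
  obtain i where p: "p = Suc i" using assms by (cases p) auto
  let ?T = "Tk m (gens R i) (gdeg R i) d"
  have CS: "CC d p (Suc q) = csup (?T q)" for q by (simp add: p Tc_def)
  show ?thesis
  proof (cases q)
    case 0
    have "(\<lambda>x A. cst (x A)) ` CC d p (Suc 0) = CC d p 0"
    proof (intro equalityI subsetI)
      fix y assume "y \<in> (\<lambda>x A. cst (x A)) ` CC d p (Suc 0)"
      then obtain x where x: "y = (\<lambda>A. cst (x A))" "x \<in> csup (?T 0)" using CS by blast
      have e: "(\<lambda>A. cst (y A)) = y" unfolding x(1) by (intro ext coef_eqI) (simp add: cst_def)
      have "y \<in> csup (?T 0)" using x(2) unfolding x(1) by (auto simp: csup_def cst_def)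
      then have "y \<in> CC d p (Suc 0)" by (simp only: CS)
      then show "y \<in> CC d p 0" using e unfolding p CC_Suc_0 by (rule conjI)
    next
      fix y assume "y \<in> CC d p 0"
      then have y: "y \<in> CC d p (Suc 0) \<and> (\<lambda>A. cst (y A)) = y" unfolding p CC_Suc_0 .
      show "y \<in> (\<lambda>x A. cst (x A)) ` CC d p (Suc 0)"
        by (rule image_fixed[OF conjunct1[OF y]]) (rule conjunct2[OF y])
    qed
    moreover have "d2 p 0 = (\<lambda>x A. cst (x A))" by (intro ext) (simp add: d2_def p)
    moreover have "col_cycles (CC d) d2 p 0 = CC d p 0" by (simp add: col_cycles_def)
    ultimately show ?thesis unfolding 0 by (simp only:)
  next
    case (Suc r)
    \<comment> \<open>In exterior degree 0 the outgoing map takes constant terms while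
      \<open>kosz\<close> vanishes by itself; in higher degrees the coefficient at the empty set
      vanishes by itself. So the cycle condition always amounts to both hypotheses of
      \<open>kosz_exact\<close>.\<close>
    have cyc: "d2 p r x = 0 \<longleftrightarrow> kosz m x = 0 \<and> (\<forall>b. coef (x {}) b 0 = 0)" if x: "x \<in> csup (?T r)" for x
    proof (cases r)
      case 0
      have "kosz m x = 0"
      proof (intro ext coef_eqI)
        fix A b t
        have "coef (x (insert l A)) b u = 0" for l u
          by (rule csup_Tk_outside[OF x]) (use 0 in \<open>auto simp: card_gt_0_iff\<close>)
        then show "coef (kosz m x A) b t = coef (0 A) b t" by (simp add: coef_kosz)
      qed
      moreover have "d2 p 0 x = 0 \<longleftrightarrow> (\<forall>b. coef (x {}) b 0 = 0)"
      proof -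
        have "d2 p 0 x = 0 \<longleftrightarrow> (\<forall>A b. coef (x A) b 0 = 0)"
        proof -
          have "d2 p 0 x = 0 \<longleftrightarrow> (\<forall>A. cst (x A) = 0)" by (simp add: d2_def p fun_eq_iff)
          also have "\<dots> \<longleftrightarrow> (\<forall>A b. coef (x A) b 0 = 0)"
          proof
            assume z: "\<forall>A. cst (x A) = 0"
            show "\<forall>A b. coef (x A) b 0 = 0"
            proof (intro allI)
              fix A b
              have "coef (cst (x A)) b 0 = 0" using z by simp
              then show "coef (x A) b 0 = 0" by (simp add: cst_def)
            qed
          qed (auto intro!: coef_eqI simp: cst_def)
          finally show ?thesis .
        qed
        moreover have "coef (x A) b 0 = 0" if "A \<noteq> {}" for A b
          by (rule csup_Tk_outside[OF x]) (use 0 that in \<open>auto simp: card_gt_0_iff\<close>)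
        ultimately show ?thesis by metis
      qed
      ultimately show ?thesis using 0 by simp
    next
      case (Suc r')
      have "coef (x {}) b 0 = 0" for b by (rule csup_Tk_outside[OF x]) (use Suc in simp)
      then show ?thesis using Suc by (simp add: d2_def p)
    qed
    have "kosz m ` csup (?T (Suc r)) = {x \<in> csup (?T r). d2 p r x = 0}"
    proof (intro equalityI subsetI)
      fix x :: "nat set \<Rightarrow> (nat \<Rightarrow>\<^sub>0 'k mpoly)" assume "x \<in> kosz m ` csup (?T (Suc r))"
      then obtain y where y: "x = kosz m y" "y \<in> csup (?T (Suc r))" by blast
      have x: "x \<in> csup (?T r)" unfolding y(1) by (rule kosz_csup[OF y(2)])
      have "kosz m x A = 0" for A
      proof (cases "finite A")
        case True
        then show ?thesis unfolding y(1) by (rule kosz_kosz)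
      next
        case False
        show ?thesis
        proof (rule coef_eqI)
          fix b t
          have "coef (x (insert l A)) b u = 0" for l u
            by (rule csup_Tk_outside[OF x]) (use False in simp)
          then show "coef (kosz m x A) b t = coef 0 b t" by (simp add: coef_kosz)
        qed
      qed
      moreover have "coef (x {}) b 0 = 0" for b by (simp add: y(1) coef_kosz)
      ultimately show "x \<in> {x \<in> csup (?T r). d2 p r x = 0}" using cyc[OF x] x by auto
    next
      fix x :: "nat set \<Rightarrow> (nat \<Rightarrow>\<^sub>0 'k mpoly)" assume x: "x \<in> {x \<in> csup (?T r). d2 p r x = 0}"
      then have "kosz m x = 0" "\<And>b. coef (x {}) b 0 = 0" using cyc[of x] by auto
      then have "\<exists>y\<in>csup (?T (Suc r)). kosz m y = x"
        using x by (intro kosz_exact finite_Tk[OF finite_gens]) auto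
      then show "x \<in> kosz m ` csup (?T (Suc r))" by blast
    qed
    moreover have "d2 p (Suc r) = kosz m" by (intro ext) (simp add: d2_def p)
    moreover have "col_cycles (CC d) d2 p (Suc r) = {x \<in> csup (?T r). d2 p r x = 0}"
      unfolding col_cycles_def CS by simp
    ultimately show ?thesis unfolding Suc CS by (simp only:)
  qed
qed

lemma resolution_eq_koszul:
  "int (cv.dim (row_cycles (CC d) d1 (Suc i) 0)) - int (cv.dim (d1 (Suc i) 0 ` CC d (Suc (Suc i)) 0))
   = int (cv.dim (col_cycles (CC d) d2 0 (Suc i))) - int (cv.dim (d2 0 (Suc i) ` CC d 0 (Suc (Suc i))))"
  by (rule double_complex_edges[OF linear_d1 linear_d2 subspace_csup fin_span_csup[OF finite_Tc] d1_d2 d1_rows d2_cols])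

end

section \<open>Hochster's formula\<close>

text \<open>A direct sum encoded as functions on pairs, with the slice at \<open>u\<close> as the
  component in \<open>V u\<close>. It is used to split the Koszul complex by multidegree.\<close>

definition dsum :: "'u set \<Rightarrow> ('u \<Rightarrow> ('t \<Rightarrow> 'k::field) set) \<Rightarrow> ('u \<times> 't \<Rightarrow> 'k) set" where
  "dsum M V = {f. \<forall>u. (\<lambda>t. f (u, t)) \<in> (if u \<in> M then V u else {0})}"

lemma subspace_dsum:
  assumes "\<And>u. u \<in> M \<Longrightarrow> fv.subspace (V u)"
  shows "fv.subspace (dsum M V)"
proof -
  have V: "fv.subspace (if u \<in> M then V u else {0})" for u using assms by (simp add: fv.subspace_single_0)
  show ?thesis
  proof (rule fv.subspaceI)
    show "0 \<in> dsum M V" using fv.subspace_0[OF V] by (auto simp: dsum_def zero_fun_def)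
    fix f g assume "f \<in> dsum M V" "g \<in> dsum M V"
    then show "f + g \<in> dsum M V" using fv.subspace_add[OF V] by (fastforce simp: dsum_def plus_fun_def)
  next
    fix c f assume "f \<in> dsum M V"
    then show "fscale c f \<in> dsum M V" using fv.subspace_scale[OF V] by (fastforce simp: dsum_def fscale_def)
  qed
qed

text \<open>Projection to one slice has that summand as image and the sum of the others as
  kernel.\<close>

lemma dim_dsum:
  fixes V :: "'u \<Rightarrow> ('t \<Rightarrow> 'k::field) set"
  assumes "finite M" "\<And>u. u \<in> M \<Longrightarrow> fv.subspace (V u)" "\<And>u. u \<in> M \<Longrightarrow> finite (S u) \<and> V u \<subseteq> fsupp (S u)"
  shows "fv.dim (dsum M V) = (\<Sum>u\<in>M. fv.dim (V u))"
  using assms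
proof (induction M rule: finite_induct)
  case empty
  have "dsum {} V = {0}" by (auto simp: dsum_def fun_eq_iff)
  moreover have "fv.dim ({0} :: ('u \<times> 't \<Rightarrow> 'k) set) = 0" using fv.dim_le_card[of "{0}" "{}"] by simp
  ultimately show ?case by (simp only: sum.empty)
next
  case (insert v M)
  let ?p = "\<lambda>f :: 'u \<times> 't \<Rightarrow> 'k. \<lambda>t. f (v, t)"
  have lin: "Vector_Spaces.linear fscale fscale ?p"
    by (auto simp: Vector_Spaces.linear_iff fun_eq_iff intro: fv.vector_space_axioms)
  have sub: "fv.subspace (dsum (insert v M) V)" using insert.prems(1) by (rule subspace_dsum)
  have "dsum (insert v M) V \<subseteq> fsupp (Sigma (insert v M) S)"
  proof
    fix f assume f: "f \<in> dsum (insert v M) V"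
    have "f (u, t) = 0" if "(u, t) \<notin> Sigma (insert v M) S" for u t
    proof (cases "u \<in> insert v M")
      case True
      then have "(\<lambda>t. f (u, t)) \<in> fsupp (S u)" using f insert.prems(2)[OF True] by (auto simp: dsum_def split: if_splits)
      then show ?thesis using that True by (auto simp: fsupp_def)
    next
      case False
      then have "(\<lambda>t. f (u, t)) = 0" using f unfolding dsum_def by (metis (mono_tags, lifting) mem_Collect_eq singletonD)
      then show ?thesis by (metis zero_fun_apply)
    qed
    then show "f \<in> fsupp (Sigma (insert v M) S)" by (auto simp: fsupp_def)
  qed
  moreover have "finite (Sigma (insert v M) S)" using insert by (intro finite_SigmaI) auto
  ultimately have fin: "fin_span fscale (dsum (insert v M) V)" by (rule fin_span_mono[OF fin_span_fsupp, rotated])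
  have "?p ` dsum (insert v M) V = V v"
  proof (intro equalityI subsetI)
    fix g assume "g \<in> ?p ` dsum (insert v M) V"
    then obtain f where f: "f \<in> dsum (insert v M) V" "g = ?p f" by blast
    have "?p f \<in> (if v \<in> insert v M then V v else {0})" using f(1) unfolding dsum_def by blast
    then show "g \<in> V v" using f(2) by simp
  next
    fix g assume g: "g \<in> V v"
    have V0: "0 \<in> V u" if "u \<in> insert v M" for u by (rule fv.subspace_0[OF insert.prems(1)[OF that]])
    define f where "f = (\<lambda>(u, t). if u = v then g t else 0)"
    have "(\<lambda>t. f (u, t)) = (if u = v then g else 0)" for u by (auto simp: f_def fun_eq_iff)
    then have "f \<in> dsum (insert v M) V"
      using g V0 by (simp add: dsum_def)
    moreover have "?p f = g" by (simp add: f_def)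
    ultimately show "g \<in> ?p ` dsum (insert v M) V" by blast
  qed
  moreover have "{f \<in> dsum (insert v M) V. ?p f = 0} = dsum M V"
  proof (intro equalityI subsetI)
    fix f assume f: "f \<in> {f \<in> dsum (insert v M) V. ?p f = 0}"
    have "(\<lambda>t. f (u, t)) \<in> (if u \<in> M then V u else {0})" for u
    proof (cases "u = v")
      case True
      then show ?thesis using f insert.hyps(2) by auto
    next
      case False
      have "(\<lambda>t. f (u, t)) \<in> (if u \<in> insert v M then V u else {0})" using f unfolding dsum_def by blast
      then show ?thesis using False by simp
    qed
    then show "f \<in> dsum M V" by (simp add: dsum_def)
  next
    fix f assume f: "f \<in> dsum M V"
    then have fu: "(\<lambda>t. f (u, t)) \<in> (if u \<in> M then V u else {0})" for u unfolding dsum_def by blast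
    have fv0: "?p f = 0" using fu[of v] insert.hyps(2) by simp
    have "(\<lambda>t. f (u, t)) \<in> (if u \<in> insert v M then V u else {0})" for u
    proof (cases "u = v")
      case True
      then show ?thesis using fv0 fv.subspace_0[OF insert.prems(1)[of v]] by simp
    qed (use fu[of u] in simp)
    then show "f \<in> {f \<in> dsum (insert v M) V. ?p f = 0}" using fv0 by (simp add: dsum_def)
  qed
  ultimately have "fv.dim (dsum (insert v M) V) = fv.dim (V v) + fv.dim (dsum M V)"
    using rank_nullity[OF lin sub fin] by (simp only:)
  moreover have "fv.dim (dsum M V) = (\<Sum>u\<in>M. fv.dim (V u))"
    by (rule insert.IH) (use insert.prems in blast)+
  ultimately show ?case by (simp only: sum.insert[OF insert.hyps])
qed

lemma dsum_image:
  assumes "\<And>u. u \<in> M \<Longrightarrow> F u ` V u = W u" "\<And>u. u \<notin> M \<Longrightarrow> F u 0 = 0"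
  shows "(\<lambda>f (u, t). F u (\<lambda>t. f (u, t)) t) ` dsum M V = dsum M W"
proof (intro equalityI subsetI)
  fix g assume "g \<in> (\<lambda>f (u, t). F u (\<lambda>t. f (u, t)) t) ` dsum M V"
  then obtain f where f: "f \<in> dsum M V" "g = (\<lambda>(u, t). F u (\<lambda>t. f (u, t)) t)" by blast
  have fu: "(\<lambda>t. f (u, t)) \<in> (if u \<in> M then V u else {0})" for u using f(1) unfolding dsum_def by blast
  have "F u (\<lambda>t. f (u, t)) \<in> (if u \<in> M then W u else {0})" for u
  proof (cases "u \<in> M")
    case True
    then show ?thesis using fu[of u] assms(1)[OF True] by auto
  next
    case False
    then have "(\<lambda>t. f (u, t)) = 0" using fu[of u] by simp
    then show ?thesis using assms(2)[OF False] False by simp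
  qed
  moreover have "(\<lambda>t. g (u, t)) = F u (\<lambda>t. f (u, t))" for u by (simp add: f(2))
  ultimately show "g \<in> dsum M W" by (simp add: dsum_def)
next
  fix g assume g: "g \<in> dsum M W"
  then have gu: "(\<lambda>t. g (u, t)) \<in> (if u \<in> M then W u else {0})" for u unfolding dsum_def by blast
  have "\<exists>h. h \<in> (if u \<in> M then V u else {0}) \<and> F u h = (\<lambda>t. g (u, t))" for u
  proof (cases "u \<in> M")
    case True
    then have "(\<lambda>t. g (u, t)) \<in> F u ` V u" using gu[of u] assms(1)[OF True] by simp
    then show ?thesis using True by auto
  next
    case False
    then show ?thesis using gu[of u] assms(2)[OF False] by auto
  qed
  then obtain h where h: "\<And>u. h u \<in> (if u \<in> M then V u else {0})" "\<And>u. F u (h u) = (\<lambda>t. g (u, t))" by metis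
  let ?f = "\<lambda>(u, t). h u t"
  have "?f \<in> dsum M V" using h(1) by (simp add: dsum_def)
  moreover have "g = (\<lambda>(u, t). F u (\<lambda>t. ?f (u, t)) t)" using h(2) by (auto simp: fun_eq_iff)
  ultimately show "g \<in> (\<lambda>f (u, t). F u (\<lambda>t. f (u, t)) t) ` dsum M V" by (rule_tac image_eqI)
qed

text \<open>The sign that turns the Koszul differential on \<open>U - \<tau>\<close> into the coboundary on \<open>\<tau>\<close>.\<close>

definition psgn :: "nat set \<Rightarrow> nat set \<Rightarrow> 'k::field" where
  "psgn U \<tau> = (\<Prod>a\<in>\<tau>. sgn_ins a U)"

lemma sgn_ins_nz [simp]: "sgn_ins l A \<noteq> (0 :: 'k::field)"
  by (simp add: sgn_ins_def)

lemma psgn_nz: "psgn U \<tau> \<noteq> (0 :: 'k::field)"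
  by (cases "finite \<tau>") (simp_all add: psgn_def)

text \<open>The elements of \<open>U\<close> below \<open>l\<close> split into those in
  \<open>U - \<tau>\<close> and those in \<open>\<tau> - {l}\<close>. The two resulting signs are
  the Koszul sign and the coboundary sign.\<close>

lemma psgn_remove:
  assumes "finite U" "\<tau> \<subseteq> U" "l \<in> \<tau>"
  shows "psgn U \<tau> * sgn_ins l (U - \<tau>) = (sgn_ins l (\<tau> - {l}) * psgn U (\<tau> - {l}) :: 'k::field)"
proof -
  have "finite \<tau>" using assms finite_subset by blast
  then have "psgn U \<tau> = sgn_ins l U * (psgn U (\<tau> - {l}) :: 'k)"
    unfolding psgn_def by (rule prod.remove[OF _ assms(3)])
  moreover have "sgn_ins l U = sgn_ins l (U - \<tau>) * (sgn_ins l (\<tau> - {l}) :: 'k)"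
  proof -
    have "{a \<in> U. a < l} = {a \<in> U - \<tau>. a < l} \<union> {a \<in> \<tau> - {l}. a < l}" using assms by auto
    moreover have "{a \<in> U - \<tau>. a < l} \<inter> {a \<in> \<tau> - {l}. a < l} = {}" by auto
    ultimately have "card {a \<in> U. a < l} = card {a \<in> U - \<tau>. a < l} + card {a \<in> \<tau> - {l}. a < l}"
      using assms(1) \<open>finite \<tau>\<close> by (simp add: card_Un_disjoint)
    then show ?thesis by (simp add: sgn_ins_def power_add)
  qed
  ultimately have "psgn U \<tau> * sgn_ins l (U - \<tau>)
      = (sgn_ins l (U - \<tau>) * sgn_ins l (U - \<tau>)) * (sgn_ins l (\<tau> - {l}) * psgn U (\<tau> - {l}) :: 'k)"
    by (simp only: ac_simps)
  then show ?thesis by simp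
qed

context face_resolution begin

text \<open>In multidegree \<open>u\<close>, the exterior part \<open>A\<close> of a Koszul basis element is encoded by its complement
  \<open>\<tau> = keys u - A\<close>. Then \<open>\<tau>\<close> ranges over the simplicial complex \<open>strand u\<close> and the Koszul differential
  becomes the coboundary.\<close>

definition mons :: "nat \<Rightarrow> mon set" where
  "mons d = {u. keys u \<subseteq> {1..m} \<and> mon_degree u = d}"

definition strand :: "mon \<Rightarrow> nat set set" where
  "strand u = {\<tau>. \<tau> \<subseteq> keys u \<and> keys (u - ind (keys u - \<tau>)) \<in> K}"

definition toS :: "nat \<Rightarrow> (nat set \<Rightarrow> (nat \<Rightarrow>\<^sub>0 'k mpoly)) \<Rightarrow> mon \<times> nat set \<Rightarrow> 'k" where
  "toS d x = (\<lambda>(u, \<tau>). if u \<in> mons d \<and> \<tau> \<subseteq> keys u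
     then psgn (keys u) \<tau> * coef (x (keys u - \<tau>)) 0 (u - ind (keys u - \<tau>)) else 0)"

lemma finite_mons': "finite (mons d)"
  by (rule finite_subset[OF _ finite_mons[of m d]]) (auto simp: mons_def)

text \<open>Taking away one copy of each variable outside \<open>\<tau>\<close> removes those that
  occur once; repeated variables stay in the support.\<close>

lemma keys_minus_ind:
  assumes "\<tau> \<subseteq> keys u"
  shows "keys (u - ind (keys u - \<tau>)) = \<tau> \<union> {l. lookup u l \<ge> 2}"
proof -
  have "finite (keys u - \<tau>)" by simp
  then show ?thesis
    using assms by (auto simp: in_keys_iff lookup_minus lookup_ind split: if_splits)
qed

lemma cplx_strand:
  assumes "u \<in> mons d"
  shows "cplx (strand u)"
  unfolding cplx_def
proof (intro conjI ballI)
  show "finite (strand u)" by (rule finite_subset[of _ "Pow (keys u)"]) (auto simp: strand_def)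
  fix \<tau> assume t: "\<tau> \<in> strand u"
  then show "finite \<tau>" using finite_subset[of \<tau> "keys u"] by (simp add: strand_def)
  show "Pow \<tau> \<subseteq> strand u"
  proof
    fix \<rho> assume r: "\<rho> \<in> Pow \<tau>"
    then have s: "\<rho> \<subseteq> keys u" using t by (auto simp: strand_def)
    have "keys (u - ind (keys u - \<tau>)) \<in> K" "\<tau> \<subseteq> keys u" using t by (auto simp: strand_def)
    then have "keys (u - ind (keys u - \<rho>)) \<in> K"
      by (elim K) (use r s keys_minus_ind in auto)
    then show "\<rho> \<in> strand u" using s by (simp add: strand_def)
  qed
qed

lemma ind_split: "A \<subseteq> keys u \<Longrightarrow> (u - ind A) + ind A = (u :: mon)"
proof (rule poly_mapping_eqI)
  fix i assume A: "A \<subseteq> keys u"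
  then have "finite A" by (rule finite_subset) simp
  moreover have "i \<in> A \<Longrightarrow> lookup u i \<ge> 1" using A by (auto simp: in_keys_iff)
  ultimately show "lookup ((u - ind A) + ind A) i = lookup u i"
    by (auto simp: lookup_add lookup_minus lookup_ind)
qed

lemma mon_degree_ind: "finite A \<Longrightarrow> mon_degree (ind A) = 2 * card A"
  unfolding mon_degree_def by (simp add: keys_ind lookup_ind)

lemma strand_Tc:
  assumes "u \<in> mons d" "\<tau> \<subseteq> keys u"
  shows "(keys u - \<tau>, 0, u - ind (keys u - \<tau>)) \<in> Tc d 0 (Suc i) \<longleftrightarrow> \<tau> \<in> strand u \<and> card \<tau> + i = card (keys u)"
proof -
  let ?A = "keys u - \<tau>"
  have fA: "finite ?A" by simp
  have "card ?A + card \<tau> = card (keys u)"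
    using assms(2) finite_subset[OF assms(2)] card_mono[OF finite_keys assms(2)] by (simp add: card_Diff_subset)
  moreover have "mon_degree (u - ind ?A) + 2 * card ?A = d"
    using ind_split[of ?A u] mon_degree_add[of "u - ind ?A" "ind ?A"] mon_degree_ind[OF fA] assms(1) by (simp add: mons_def)
  moreover have "?A \<subseteq> {1..m}" using assms(1) by (auto simp: mons_def)
  ultimately show ?thesis using assms(2) by (auto simp: Tc_def strand_def)
qed

lemma linear_toS: "Vector_Spaces.linear cscale fscale (toS d)"
  by (auto simp: Vector_Spaces.linear_iff toS_def fun_eq_iff cscale_def algebra_simps
      intro: cv.vector_space_axioms fv.vector_space_axioms)

text \<open>Exterior degree \<open>i\<close> corresponds to sets of cardinality
  \<open>card (keys u) - i\<close>; the guard gives the zero space where this difference would be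
  negative.\<close>

definition layerS :: "nat \<Rightarrow> mon \<Rightarrow> (nat set \<Rightarrow> 'k) set" where
  "layerS i u = (if i \<le> card (keys u) then fsupp (layer (strand u) (card (keys u) - i)) else {0})"

lemma toS_image: "toS d ` CC d 0 (Suc i) = dsum (mons d) (layerS i)"
proof (intro equalityI subsetI)
  fix f assume "f \<in> toS d ` CC d 0 (Suc i)"
  then obtain x where x: "x \<in> CC d 0 (Suc i)" "f = toS d x" by blast
  have "(\<lambda>\<tau>. f (u, \<tau>)) \<in> (if u \<in> mons d then layerS i u else {0})" for u
  proof (cases "u \<in> mons d")
    case True
    have z: "f (u, \<tau>) = 0" if "\<not> (\<tau> \<in> strand u \<and> card \<tau> + i = card (keys u))" for \<tau>
    proof (cases "\<tau> \<subseteq> keys u")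
      case sub: True
      then have "coef (x (keys u - \<tau>)) 0 (u - ind (keys u - \<tau>)) = 0"
        using csupD[OF x(1)] strand_Tc[OF True sub] that by blast
      then show ?thesis by (simp add: x(2) toS_def)
    qed (simp add: x(2) toS_def)
    show ?thesis
    proof (cases "i \<le> card (keys u)")
      case le: True
      have "f (u, \<tau>) = 0" if "\<tau> \<notin> layer (strand u) (card (keys u) - i)" for \<tau>
        by (rule z) (use that le in \<open>auto simp: layer_def\<close>)
      then show ?thesis using True le by (simp add: layerS_def fsupp_def)
    next
      case False
      then have "f (u, \<tau>) = 0" for \<tau> by (intro z) auto
      then have "(\<lambda>\<tau>. f (u, \<tau>)) = 0" by (simp add: fun_eq_iff)
      then show ?thesis using True False by (simp add: layerS_def)
    qed
  next
    case False
    then have "(\<lambda>\<tau>. f (u, \<tau>)) = 0" by (simp add: x(2) toS_def fun_eq_iff)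
    then show ?thesis using False by simp
  qed
  then show "f \<in> dsum (mons d) (layerS i)" by (simp add: dsum_def)
next
  fix f assume f: "f \<in> dsum (mons d) (layerS i)"
  have fz: "u \<in> mons d \<and> \<tau> \<in> strand u \<and> card \<tau> + i = card (keys u)" if nz: "f (u, \<tau>) \<noteq> 0" for u \<tau>
  proof -
    have fu: "(\<lambda>\<tau>. f (u, \<tau>)) \<in> (if u \<in> mons d then layerS i u else {0})" using f unfolding dsum_def by blast
    have n0: "(\<lambda>\<tau>. f (u, \<tau>)) \<noteq> 0" using nz by (auto simp: fun_eq_iff)
    then have u: "u \<in> mons d" using fu by (auto split: if_splits)
    then have le: "i \<le> card (keys u)" and "(\<lambda>\<tau>. f (u, \<tau>)) \<in> fsupp (layer (strand u) (card (keys u) - i))"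
      using fu n0 by (auto simp: layerS_def split: if_splits)
    then have "\<tau> \<in> layer (strand u) (card (keys u) - i)" using nz by (auto simp: fsupp_def)
    then show ?thesis using u le by (auto simp: layer_def)
  qed
  \<comment> \<open>The inverse of \<open>toS\<close>: a basis element determines its multidegree
    \<open>t + ind A\<close>, and \<open>\<tau>\<close> is the complement of \<open>A\<close> in the
    support of the latter.\<close>
  define c where "c A b t = (if b = (0::nat) \<and> A \<inter> keys (t + ind A) = A \<and> finite A
      then f (t + ind A, keys (t + ind A) - A) / psgn (keys (t + ind A)) (keys (t + ind A) - A) else 0)" for A b and t :: mon
  have cT: "(A, b, t) \<in> Tc d 0 (Suc i)" if nz: "c A b t \<noteq> 0" for A b t
  proof -
    let ?u = "t + ind A"
    have A: "b = 0" "A \<subseteq> keys ?u" "f (?u, keys ?u - A) \<noteq> 0" using nz by (auto simp: c_def split: if_splits)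
    have e: "keys ?u - (keys ?u - A) = A" using A by auto
    show ?thesis using strand_Tc[of ?u d "keys ?u - A" i] fz[OF A(3)] unfolding e by (auto simp: A(1))
  qed
  obtain x where x: "x \<in> CC d 0 (Suc i)" and xc: "\<And>A b t. coef (x A) b t = c A b t"
    using csup_ex[OF finite_Tc, of c d 0 "Suc i"] cT by blast
  have "toS d x (u, \<tau>) = f (u, \<tau>)" for u \<tau>
  proof (cases "u \<in> mons d \<and> \<tau> \<subseteq> keys u")
    case True
    let ?A = "keys u - \<tau>"
    have "(u - ind ?A) + ind ?A = u" by (rule ind_split) auto
    moreover have "keys u - ?A = \<tau>" using True by auto
    moreover have "?A \<inter> keys u = ?A" by auto
    ultimately have "c ?A 0 (u - ind ?A) = f (u, \<tau>) / psgn (keys u) \<tau>" by (simp add: c_def)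
    then show ?thesis using True psgn_nz[of "keys u" \<tau>, where 'k='k] by (simp add: toS_def xc)
  next
    case False
    then have "f (u, \<tau>) = 0" using fz[of u \<tau>] by (auto simp: strand_def)
    then show ?thesis using False by (auto simp: toS_def)
  qed
  then have "f = toS d x" by (auto simp: fun_eq_iff)
  then show "f \<in> toS d ` CC d 0 (Suc i)" using x by blast
qed

lemma toS_inj:
  assumes x: "x \<in> CC d 0 (Suc i)" and z: "toS d x = 0"
  shows "x = 0"
proof (intro ext coef_eqI)
  fix A b t
  show "coef (x A) b t = coef (0 A) b t"
  proof (cases "(A, b, t) \<in> Tc d 0 (Suc i)")
    case False
    then show ?thesis using csupD[OF x] by simp
  next
    case True
    then have A: "A \<subseteq> {1..m}" "card A = i" "b = 0" "keys t \<in> K" "mon_degree t + 2 * i = d" by (auto simp: Tc_def)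
    then have fA: "finite A" using finite_subset by auto
    let ?u = "t + ind A"
    have k: "keys ?u = keys t \<union> A" by (simp add: keys_plus_mon keys_ind[OF fA])
    have u: "?u \<in> mons d" using A KV[OF A(4)] by (auto simp: mons_def k mon_degree_add mon_degree_ind[OF fA])
    have "toS d x (?u, keys ?u - A) = 0" using z by simp
    moreover have "keys ?u - (keys ?u - A) = A" using k by auto
    ultimately have "coef (x A) 0 t = 0"
      using u psgn_nz[of "keys ?u" "keys ?u - A", where 'k='k] by (simp add: toS_def)
    then show ?thesis using A(3) by simp
  qed
qed

lemma toS_d2: "toS d (d2 0 (Suc i) x) (u, \<tau>) = cob (strand u) (\<lambda>\<tau>. toS d x (u, \<tau>)) \<tau>"
proof (cases "u \<in> mons d \<and> \<tau> \<subseteq> keys u")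
  case False
  then show ?thesis by (auto simp: toS_def cob_def strand_def)
next
  case True
  let ?U = "keys u"
  let ?A = "?U - \<tau>"
  let ?t = "u - ind ?A"
  have kt: "keys ?t = \<tau> \<union> {l. lookup u l \<ge> 2}" using True by (intro keys_minus_ind) auto
  have ex: "{l. lookup u l \<ge> 2} \<subseteq> ?U" by (auto simp: in_keys_iff)
  \<comment> \<open>The Koszul sum runs over the indices outside \<open>?A\<close> that divide the
    monomial. Repeated variables outside \<open>\<tau>\<close> divide it too, but they belong to
    \<open>?A\<close>.\<close>
  have idx: "({1..m} - ?A) \<inter> keys ?t = \<tau>" using True ex by (auto simp: kt mons_def)
  have strand: "\<tau> \<in> strand u \<longleftrightarrow> keys ?t \<in> K" using True by (simp add: strand_def)
  have step: "insert l ?A = ?U - (\<tau> - {l}) \<and> ?t - single l 1 = u - ind (?U - (\<tau> - {l}))" if l: "l \<in> \<tau>" for l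
  proof
    show e: "insert l ?A = ?U - (\<tau> - {l})" using l True by auto
    have "ind (insert l ?A) = single l 1 + ind ?A" using l by (simp add: ind_def)
    then show "?t - single l 1 = u - ind (?U - (\<tau> - {l}))" unfolding e[symmetric] by (simp add: diff_diff_add add.commute)
  qed
  have "coef (kosz m x ?A) 0 ?t = (\<Sum>l\<in>\<tau>. sgn_ins l ?A * coef (x (?U - (\<tau> - {l}))) 0 (u - ind (?U - (\<tau> - {l}))))"
    unfolding coef_kosz idx using step by (intro sum.cong) auto
  then have "toS d (d2 0 (Suc i) x) (u, \<tau>) = (if \<tau> \<in> strand u then
      (\<Sum>l\<in>\<tau>. psgn ?U \<tau> * sgn_ins l ?A * coef (x (?U - (\<tau> - {l}))) 0 (u - ind (?U - (\<tau> - {l})))) else 0)"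
    using True strand by (simp add: toS_def d2_def fK_def sum_distrib_left mult.assoc)
  also have "(\<Sum>l\<in>\<tau>. psgn ?U \<tau> * sgn_ins l ?A * coef (x (?U - (\<tau> - {l}))) 0 (u - ind (?U - (\<tau> - {l}))))
    = (\<Sum>l\<in>\<tau>. sgn_ins l (\<tau> - {l}) * toS d x (u, \<tau> - {l}))"
  proof (rule sum.cong[OF refl])
    fix l assume l: "l \<in> \<tau>"
    have s: "\<tau> - {l} \<subseteq> ?U" using True by auto
    have "psgn ?U \<tau> * sgn_ins l ?A = (sgn_ins l (\<tau> - {l}) * psgn ?U (\<tau> - {l}) :: 'k)"
      using True l by (intro psgn_remove) auto
    then show "psgn ?U \<tau> * sgn_ins l ?A * coef (x (?U - (\<tau> - {l}))) 0 (u - ind (?U - (\<tau> - {l})))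
      = sgn_ins l (\<tau> - {l}) * toS d x (u, \<tau> - {l})"
      using True s by (simp add: toS_def mult.assoc)
  qed
  finally show ?thesis by (simp add: cob_def)
qed

definition Zs :: "nat \<Rightarrow> mon \<Rightarrow> (nat set \<Rightarrow> 'k) set" where
  "Zs i u = (if i \<le> card (keys u) then cocycles (strand u) (card (keys u) - i) else {0})"

definition Bs :: "nat \<Rightarrow> mon \<Rightarrow> (nat set \<Rightarrow> 'k) set" where
  "Bs i u = (if i \<le> card (keys u) then coboundaries (strand u) (card (keys u) - i) else {0})"

lemma cob_0: "cob \<Phi> 0 = 0"
  by (simp add: cob_def fun_eq_iff)

lemma d2_col0:
  assumes x: "x \<in> CC d 0 (Suc (Suc i))"
  shows "d2 0 (Suc i) x \<in> CC d 0 (Suc i)"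
proof -
  have T: "Tc d 0 (Suc q) = {(A, b, t). (A, b, t) \<in> Tk m {0} (\<lambda>_. 0) d q \<and> keys t \<in> K}" for q
    using KV by (auto simp: Tc_def Tk_def)
  have "x \<in> csup (Tk m {0} (\<lambda>_. 0) d (Suc i))" using x by (auto simp: csup_def T)
  then have "kosz m x \<in> csup (Tk m {0} (\<lambda>_. 0) d i)" by (rule kosz_csup)
  then show ?thesis by (auto simp: csup_def d2_def fK_def T split: if_splits)
qed

lemma cycle_iff:
  assumes x: "x \<in> CC d 0 (Suc i)"
  shows "d2 0 i x = 0 \<longleftrightarrow> (\<forall>u. cob (strand u) (\<lambda>\<tau>. toS d x (u, \<tau>)) = 0)"
proof (cases i)
  case 0
  have "cob (strand u) (\<lambda>\<tau>. toS d x (u, \<tau>)) = 0" for u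
  proof (cases "u \<in> mons d")
    case True
    have "toS d x \<in> dsum (mons d) (layerS i)" using toS_image[of d i] x by blast
    then have "(\<lambda>\<tau>. toS d x (u, \<tau>)) \<in> (if u \<in> mons d then layerS i u else {0})" unfolding dsum_def by blast
    then have f: "(\<lambda>\<tau>. toS d x (u, \<tau>)) \<in> fsupp (layer (strand u) (card (keys u)))"
      using True 0 by (simp add: layerS_def)
    have "\<forall>\<tau>\<in>strand u. finite \<tau>" using cplx_strand[OF True] by (auto simp: cplx_def)
    from cob_layer[OF this f]
    have "cob (strand u) (\<lambda>\<tau>. toS d x (u, \<tau>)) \<in> fsupp (layer (strand u) (Suc (card (keys u))))" .
    \<comment> \<open>In exterior degree 0 the set \<open>\<tau>\<close> is the whole support and
      cannot grow, so every cochain is a cocycle, in agreement with \<open>d2 0 0\<close> being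
      zero.\<close>
    moreover have "layer (strand u) (Suc (card (keys u))) = {}"
    proof -
      have "card \<tau> \<le> card (keys u)" if "\<tau> \<in> strand u" for \<tau>
        using that by (intro card_mono) (auto simp: strand_def)
      then show ?thesis by (fastforce simp: layer_def)
    qed
    ultimately show ?thesis by (simp add: fsupp_def fun_eq_iff)
  next
    case False
    then have "(\<lambda>\<tau>. toS d x (u, \<tau>)) = 0" by (simp add: toS_def fun_eq_iff)
    then show ?thesis by (simp only: cob_0)
  qed
  then show ?thesis using 0 by (simp add: d2_def fun_eq_iff)
next
  case (Suc r)
  have e: "toS d (d2 0 i x) (u, \<tau>) = cob (strand u) (\<lambda>\<tau>. toS d x (u, \<tau>)) \<tau>" for u \<tau>
    using toS_d2 by (simp add: Suc)
  interpret S: Vector_Spaces.linear cscale fscale "toS d" by (rule linear_toS)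
  have "d2 0 i x \<in> CC d 0 (Suc r)" using d2_col0 x Suc by blast
  then have "d2 0 i x = 0 \<longleftrightarrow> toS d (d2 0 i x) = 0" using toS_inj S.zero by metis
  also have "\<dots> \<longleftrightarrow> (\<forall>u \<tau>. toS d (d2 0 i x) (u, \<tau>) = 0)" by (simp add: fun_eq_iff)
  also have "\<dots> \<longleftrightarrow> (\<forall>u. cob (strand u) (\<lambda>\<tau>. toS d x (u, \<tau>)) = 0)" unfolding e by (simp add: fun_eq_iff)
  finally show ?thesis .
qed

lemma cycle_image: "toS d ` {x \<in> CC d 0 (Suc i). d2 0 i x = 0} = dsum (mons d) (Zs i)"
proof -
  have Z: "Zs i u = {g \<in> layerS i u. cob (strand u) g = 0}" for u
    by (auto simp: Zs_def layerS_def cocycles_def cob_0)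
  have "toS d ` {x \<in> CC d 0 (Suc i). d2 0 i x = 0}
      = {f \<in> toS d ` CC d 0 (Suc i). \<forall>u. cob (strand u) (\<lambda>\<tau>. f (u, \<tau>)) = 0}"
    using cycle_iff by blast
  also have "\<dots> = {f \<in> dsum (mons d) (layerS i). \<forall>u. cob (strand u) (\<lambda>\<tau>. f (u, \<tau>)) = 0}"
    unfolding toS_image ..
  also have "\<dots> = dsum (mons d) (Zs i)"
  proof (intro equalityI subsetI)
    fix f assume f: "f \<in> {f \<in> dsum (mons d) (layerS i). \<forall>u. cob (strand u) (\<lambda>\<tau>. f (u, \<tau>)) = 0}"
    then have "(\<lambda>\<tau>. f (u, \<tau>)) \<in> (if u \<in> mons d then layerS i u else {0})" for u by (simp add: dsum_def)
    note fu = this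
    have "(\<lambda>\<tau>. f (u, \<tau>)) \<in> (if u \<in> mons d then Zs i u else {0})" for u
      using f fu[of u] unfolding Z by (cases "u \<in> mons d") simp_all
    then show "f \<in> dsum (mons d) (Zs i)" by (simp add: dsum_def)
  next
    fix f assume f: "f \<in> dsum (mons d) (Zs i)"
    have fu: "(\<lambda>\<tau>. f (u, \<tau>)) \<in> (if u \<in> mons d then Zs i u else {0})" for u using f unfolding dsum_def by blast
    have "(\<lambda>\<tau>. f (u, \<tau>)) \<in> (if u \<in> mons d then layerS i u else {0}) \<and> cob (strand u) (\<lambda>\<tau>. f (u, \<tau>)) = 0" for u
    proof (cases "u \<in> mons d")
      case True
      then show ?thesis using fu[of u] unfolding Z by simp
    next
      case False
      then have "(\<lambda>\<tau>. f (u, \<tau>)) = 0" using fu[of u] by simp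
      then show ?thesis using False cob_0 by simp
    qed
    then show "f \<in> {f \<in> dsum (mons d) (layerS i). \<forall>u. cob (strand u) (\<lambda>\<tau>. f (u, \<tau>)) = 0}" by (simp add: dsum_def)
  qed
  finally show ?thesis .
qed

lemma boundary_image: "toS d ` d2 0 (Suc i) ` CC d 0 (Suc (Suc i)) = dsum (mons d) (Bs i)"
proof -
  have "toS d (d2 0 (Suc i) x) = (\<lambda>(u, t). cob (strand u) (\<lambda>t. toS d x (u, t)) t)" for x
    by (rule ext) (auto simp: toS_d2)
  then have "toS d ` d2 0 (Suc i) ` CC d 0 (Suc (Suc i))
      = (\<lambda>f (u, t). cob (strand u) (\<lambda>t. f (u, t)) t) ` toS d ` CC d 0 (Suc (Suc i))"
    unfolding image_image by (intro image_cong) auto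
  also have "\<dots> = dsum (mons d) (Bs i)"
    unfolding toS_image
  proof (rule dsum_image)
    fix u assume "u \<in> mons d"
    consider "Suc i \<le> card (keys u)" | "i = card (keys u)" | "i > card (keys u)" by linarith
    then show "cob (strand u) ` layerS (Suc i) u = Bs i u"
    proof cases
      case 1
      then have "card (keys u) - i \<noteq> 0" "card (keys u) - i - 1 = card (keys u) - Suc i" by auto
      then show ?thesis using 1 by (simp add: layerS_def Bs_def coboundaries_def)
    next
      case 2
      then show ?thesis by (simp add: layerS_def Bs_def coboundaries_def cob_0)
    next
      case 3
      then show ?thesis by (simp add: layerS_def Bs_def cob_0)
    qed
  qed (rule cob_0)
  finally show ?thesis .
qed

lemma subspace_kernel_CC: "cv.subspace {x \<in> CC d p q. d2 p' q' x = 0}"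
proof -
  interpret L: Vector_Spaces.linear cscale cscale "d2 p' q'" by (rule linear_d2)
  show ?thesis
    using subspace_csup[of "Tc d p q"] by (auto simp: cv.subspace_def L.add L.scale L.zero)
qed

lemma column_dim:
  "int (cv.dim (col_cycles (CC d) d2 0 (Suc i))) - int (cv.dim (d2 0 (Suc i) ` CC d 0 (Suc (Suc i))))
   = (\<Sum>u\<in>mons d. if i \<le> card (keys u) then hcoh TYPE('k) (strand u) (card (keys u) - i) else 0)"
proof -
  interpret L: Vector_Spaces.linear cscale cscale "d2 0 (Suc i)" by (rule linear_d2)
  have z: "col_cycles (CC d) d2 0 (Suc i) = {x \<in> CC d 0 (Suc i). d2 0 i x = 0}" by (simp add: col_cycles_def)
  have fC: "fin_span cscale (CC d 0 q)" for q by (rule fin_span_csup[OF finite_Tc])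
  have sub1: "cv.subspace {x \<in> CC d 0 (Suc i). d2 0 i x = 0}" by (rule subspace_kernel_CC)
  have fin1: "fin_span cscale {x \<in> CC d 0 (Suc i). d2 0 i x = 0}" by (rule fin_span_mono[OF fC]) auto
  have "fv.dim (toS d ` {x \<in> CC d 0 (Suc i). d2 0 i x = 0}) = cv.dim {x \<in> CC d 0 (Suc i). d2 0 i x = 0}"
    by (rule dim_inj_image[OF linear_toS sub1 fin1]) (use toS_inj in blast)
  then have c: "cv.dim (col_cycles (CC d) d2 0 (Suc i)) = fv.dim (dsum (mons d) (Zs i))"
    unfolding z cycle_image by (rule sym)
  have sub2: "cv.subspace (d2 0 (Suc i) ` CC d 0 (Suc (Suc i)))" by (rule L.subspace_image[OF subspace_csup])
  have fin2: "fin_span cscale (d2 0 (Suc i) ` CC d 0 (Suc (Suc i)))" by (rule fin_span_image[OF linear_d2 fC])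
  have "fv.dim (toS d ` d2 0 (Suc i) ` CC d 0 (Suc (Suc i))) = cv.dim (d2 0 (Suc i) ` CC d 0 (Suc (Suc i)))"
    by (rule dim_inj_image[OF linear_toS sub2 fin2]) (use toS_inj d2_col0 in blast)
  then have b: "cv.dim (d2 0 (Suc i) ` CC d 0 (Suc (Suc i))) = fv.dim (dsum (mons d) (Bs i))"
    unfolding boundary_image by (rule sym)
  have s0: "fv.subspace {0 :: nat set \<Rightarrow> 'k}" by (rule fv.subspace_single_0)
  have s00: "{0} \<subseteq> (fsupp S :: (nat set \<Rightarrow> 'k) set)" for S by (simp add: fsupp_def)
  have d0: "fv.dim {0 :: nat set \<Rightarrow> 'k} = 0" using fv.dim_le_card[of "{0}" "{}"] by simp
  have fs: "finite (strand u)" if "u \<in> mons d" for u using cplx_strand[OF that] by (simp add: cplx_def)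
  have coc: "(cocycles (strand u) q :: (nat set \<Rightarrow> 'k) set) \<subseteq> fsupp (strand u)" for u q
    by (auto simp: cocycles_def fsupp_def layer_def)
  have zd: "fv.dim (dsum (mons d) (Zs i)) = (\<Sum>u\<in>mons d. fv.dim (Zs i u))"
  proof (rule dim_dsum[where S = strand])
    show "fv.subspace (Zs i u)" for u
      unfolding Zs_def by (cases "i \<le> card (keys u)") (simp_all only: if_True if_False s0 subspace_cocycles)
    show "finite (strand u) \<and> Zs i u \<subseteq> fsupp (strand u)" if "u \<in> mons d" for u
      unfolding Zs_def using fs[OF that] coc s00 by (cases "i \<le> card (keys u)") (simp_all only: if_True if_False simp_thms)
  qed (rule finite_mons')
  have bd: "fv.dim (dsum (mons d) (Bs i)) = (\<Sum>u\<in>mons d. fv.dim (Bs i u))"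
  proof (rule dim_dsum[where S = strand])
    show "fv.subspace (Bs i u)" for u
      unfolding Bs_def by (cases "i \<le> card (keys u)") (simp_all only: if_True if_False s0 subspace_coboundaries)
    show "finite (strand u) \<and> Bs i u \<subseteq> fsupp (strand u)" if u: "u \<in> mons d" for u
    proof
      have "coboundaries (strand u) q \<subseteq> (fsupp (strand u) :: (nat set \<Rightarrow> 'k) set)" for q
        using coboundaries_subset_cocycles[OF cplx_strand[OF u], of q, where 'k='k] coc[of u q] by blast
      then show "Bs i u \<subseteq> fsupp (strand u)" 
        unfolding Bs_def using s00 by (cases "i \<le> card (keys u)") (simp_all only: if_True if_False)
    qed (rule fs[OF u])
  qed (rule finite_mons')
  have t: "int (fv.dim (Zs i u)) - int (fv.dim (Bs i u)) = (if i \<le> card (keys u) then hcoh TYPE('k) (strand u) (card (keys u) - i) else 0)" for u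
    by (cases "i \<le> card (keys u)") (simp_all only: Zs_def Bs_def if_True if_False hcoh_def d0 diff_self)
  show ?thesis
    unfolding c b zd bd of_nat_sum sum_subtractf[symmetric] t ..
qed

text \<open>Adding a vertex \<open>l\<close> of multiplicity at least 2 does not change the support of the monomial part, so
  the strand is a cone with apex \<open>l\<close>.\<close>

lemma strand_acyclic:
  assumes u: "u \<in> mons d" and l: "lookup u l \<ge> 2"
  shows "hcoh TYPE('k) (strand u) c = 0"
proof (rule hcoh_acyclic[OF cplx_strand[OF u]])
  fix \<tau> assume t: "\<tau> \<in> strand u"
  have lU: "l \<in> keys u" using l by (simp add: in_keys_iff)
  have s: "\<tau> \<subseteq> keys u" "\<tau> \<union> {l. lookup u l \<ge> 2} \<in> K" using t keys_minus_ind[of \<tau> u] by (auto simp: strand_def)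
  have "insert l \<tau> \<union> {l. lookup u l \<ge> 2} = \<tau> \<union> {l. lookup u l \<ge> 2}"
    "\<tau> - {l} \<union> {l. lookup u l \<ge> 2} = \<tau> \<union> {l. lookup u l \<ge> 2}" using l by auto
  moreover have "insert l \<tau> \<subseteq> keys u" "\<tau> - {l} \<subseteq> keys u" using s lU by auto
  ultimately show "insert l \<tau> \<in> strand u \<and> \<tau> - {l} \<in> strand u"
    using s(2) keys_minus_ind[of "insert l \<tau>" u] keys_minus_ind[of "\<tau> - {l}" u] by (simp add: strand_def)
qed

lemma strand_ind:
  assumes "finite J"
  shows "strand (ind J) = restr K J"
proof -
  have "{l. lookup (ind J) l \<ge> 2} = {}" using assms by (auto simp: lookup_ind split: if_splits)
  then have "\<tau> \<subseteq> J \<Longrightarrow> keys (ind J - ind (J - \<tau>)) = \<tau>" for \<tau>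
    using keys_minus_ind[of \<tau> "ind J"] by (simp add: keys_ind[OF assms])
  then show ?thesis by (auto simp: strand_def restr_def keys_ind[OF assms])
qed

text \<open>Multidegrees with a repeated variable drop out by \<open>strand_acyclic\<close>. The
  square-free ones of degree \<open>2 * j\<close> are the \<open>ind J\<close> with
  \<open>card J = j\<close>, and their strands are full subcomplexes.\<close>

lemma column_sum:
  "(\<Sum>u\<in>mons (2 * j). if i \<le> card (keys u) then hcoh TYPE('k) (strand u) (card (keys u) - i) else 0)
   = (if i \<le> j then betti_sum TYPE('k) K {1..m} (j - i) j else 0)"
proof -
  let ?h = "\<lambda>u. if i \<le> card (keys u) then hcoh TYPE('k) (strand u) (card (keys u) - i) else 0"
  let ?J = "{J. J \<subseteq> {1..m} \<and> card J = j}"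
  have fJ: "finite J" if "J \<in> ?J" for J by (rule finite_subset[of _ "{1..m}"]) (use that in simp_all)
  have "sum ?h (mons (2 * j)) = sum ?h (ind ` ?J)"
  proof (rule sum.mono_neutral_right)
    show "ind ` ?J \<subseteq> mons (2 * j)"
    proof (rule image_subsetI)
      fix J assume J: "J \<in> ?J"
      show "ind J \<in> mons (2 * j)" using J fJ[OF J] by (simp add: mons_def keys_ind mon_degree_ind)
    qed
    show "\<forall>u\<in>mons (2 * j) - ind ` ?J. ?h u = 0"
    proof
      fix u assume u: "u \<in> mons (2 * j) - ind ` ?J"
      show "?h u = 0"
      proof (cases "\<exists>l. lookup u l \<ge> 2")
        case True
        then show ?thesis using strand_acyclic u by auto
      next
        case False
        have "u = ind (keys u)"
        proof (rule poly_mapping_eqI)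
          fix l
          have "\<not> lookup u l \<ge> 2" using False by blast
          then have "lookup u l = 0 \<or> lookup u l = 1" by linarith
          then show "lookup u l = lookup (ind (keys u)) l" by (auto simp: lookup_ind in_keys_iff)
        qed
        note v = this
        have "mon_degree u = 2 * j" "keys u \<subseteq> {1..m}" using u by (simp_all add: mons_def)
        moreover have "mon_degree u = 2 * card (keys u)" using mon_degree_ind[of "keys u"] v finite_keys by metis
        ultimately have "keys u \<in> ?J" by simp
        then have "u \<in> ind ` ?J" by (rule image_eqI[of u ind, OF v])
        then show ?thesis using u by simp
      qed
    qed
  qed (rule finite_mons')
  also have "\<dots> = (\<Sum>J\<in>?J. ?h (ind J))"
  proof -
    have "inj_on ind ?J"
    proof (rule inj_onI)
      fix I J assume I: "I \<in> ?J" and J: "J \<in> ?J" and e: "ind I = ind J"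
      have "I = keys (ind I)" by (rule keys_ind[OF fJ[OF I], symmetric])
      also have "\<dots> = J" unfolding e by (rule keys_ind[OF fJ[OF J]])
      finally show "I = J" .
    qed
    then have "sum ?h (ind ` ?J) = sum (?h \<circ> ind) ?J" by (rule sum.reindex)
    then show ?thesis unfolding o_def .
  qed
  also have "\<dots> = (\<Sum>J\<in>?J. if i \<le> j then hcoh TYPE('k) (restr K J) (j - i) else 0)"
  proof (rule sum.cong)
    fix J assume J: "J \<in> ?J"
    show "?h (ind J) = (if i \<le> j then hcoh TYPE('k) (restr K J) (j - i) else 0)"
      using J by (simp add: keys_ind[OF fJ[OF J]] strand_ind[OF fJ[OF J]])
  qed simp
  finally show ?thesis by (simp add: betti_sum_def)
qed

section \<open>Tor as the homology of the bottom row\<close>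

definition emb :: "(nat \<Rightarrow>\<^sub>0 'k) \<Rightarrow> nat set \<Rightarrow> (nat \<Rightarrow>\<^sub>0 'k mpoly)" where
  "emb z A = (if A = {} then Poly_Mapping.map (single 0) z else 0)"

definition unemb :: "(nat set \<Rightarrow> (nat \<Rightarrow>\<^sub>0 'k mpoly)) \<Rightarrow> (nat \<Rightarrow>\<^sub>0 'k)" where
  "unemb x = Poly_Mapping.map (\<lambda>p. lookup p 0) (x {})"

lemma coef_emb: "coef (emb z A) b t = (if A = {} \<and> t = 0 then lookup z b else 0)"
  by (auto simp: emb_def coef_def Poly_Mapping.map.rep_eq when_def lookup_single)

lemma lookup_unemb: "lookup (unemb x) b = coef (x {}) b 0"
  by (auto simp: unemb_def coef_def Poly_Mapping.map.rep_eq when_def)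

lemma unemb_emb: "unemb (emb z) = z"
  by (rule poly_mapping_eqI) (simp add: lookup_unemb coef_emb)

lemma linear_unemb: "Vector_Spaces.linear cscale pm_scale unemb"
  by (auto simp: Vector_Spaces.linear_iff cv.vector_space_axioms pm.vector_space_axioms
      lookup_unemb lookup_add lookup_pm_scale cscale_def intro!: poly_mapping_eqI)

lemma emb_eq_0_iff: "emb z = 0 \<longleftrightarrow> z = 0"
proof
  assume "emb z = 0"
  then have "unemb (emb z) = 0" by (intro poly_mapping_eqI) (simp add: lookup_unemb)
  then show "z = 0" by (simp add: unemb_emb)
qed (auto intro!: ext coef_eqI simp: coef_emb)

lemma emb_piece: "emb ` tensor_piece R i d = CC d (Suc i) 0"
proof (intro equalityI subsetI)
  fix x assume "x \<in> emb ` tensor_piece R i d"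
  then obtain z where z: "x = emb z" "keys z \<subseteq> {b \<in> gens R i. gdeg R i b = d}" by (auto simp: tensor_piece_def)
  show "x \<in> CC d (Suc i) 0"
    unfolding csup_def
  proof (intro CollectI allI impI)
    fix A b t assume "coef (x A) b t \<noteq> 0"
    then have "A = {}" "t = 0" "b \<in> keys z" by (auto simp: z(1) coef_emb in_keys_iff split: if_splits)
    then show "(A, b, t) \<in> Tc d (Suc i) 0" using z(2) by (auto simp: Tc_def)
  qed
next
  fix x :: "nat set \<Rightarrow> (nat \<Rightarrow>\<^sub>0 'k mpoly)" assume x: "x \<in> CC d (Suc i) 0"
  then have c: "coef (x A) b t \<noteq> 0 \<Longrightarrow> A = {} \<and> b \<in> gens R i \<and> t = 0 \<and> gdeg R i b = d" for A b t
    by (auto simp: csup_def Tc_def)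
  have "coef (x A) b t = coef (emb (unemb x) A) b t" for A b t
    using c[of A b t] by (auto simp: coef_emb lookup_unemb)
  then have "x = emb (unemb x)" by (intro ext coef_eqI)
  moreover have "unemb x \<in> tensor_piece R i d"
    using c by (auto simp: tensor_piece_def in_keys_iff lookup_unemb)
  ultimately show "x \<in> emb ` tensor_piece R i d" by blast
qed

lemma emb_bd: "d1 (Suc i) 0 (emb z) = emb (lin_ext (bd_tensor R (Suc i)) z)"
proof (intro ext coef_eqI)
  fix A c t
  show "coef (d1 (Suc i) 0 (emb z) A) c t = coef (emb (lin_ext (bd_tensor R (Suc i)) z) A) c t"
  proof (cases "A = {} \<and> t = 0")
    case True
    have k: "keys (emb z {}) \<subseteq> keys z"
      by (auto simp: emb_def in_keys_iff Poly_Mapping.map.rep_eq when_def split: if_splits)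
    have "coef (d1 (Suc i) 0 (emb z) A) c t = coef (lin_ext (bd R (Suc i)) (emb z {})) c 0"
      using True by (simp add: d1_def cst_def)
    also have "\<dots> = (\<Sum>b\<in>keys z. lookup (lookup (emb z {}) b * lookup (bd R (Suc i) b) c) 0)"
      by (rule coef_lin_ext[OF finite_keys k])
    also have "\<dots> = (\<Sum>b\<in>keys z. coef (emb z {}) b 0 * coef (bd R (Suc i) b) c 0)"
      unfolding lookup_mult_0 coef_def ..
    also have "\<dots> = (\<Sum>b\<in>keys z. lookup z b * lookup (bd_tensor R (Suc i) b) c)"
      by (rule sum.cong) (auto simp: coef_emb coef_def[of "bd R (Suc i) _"] bd_tensor_def Poly_Mapping.map.rep_eq when_def)
    also have "\<dots> = lookup (lin_ext (bd_tensor R (Suc i)) z) c" by (simp add: lookup_lin_ext)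
    finally show ?thesis using True by (simp add: coef_emb)
  next
    case False
    then have "coef (emb (lin_ext (bd_tensor R (Suc i)) z) A) c t = 0" by (simp only: coef_emb if_False)
    then show ?thesis using False by (auto simp: d1_def cst_def emb_def)
  qed
qed

lemma row_dim:
  "cv.dim (row_cycles (CC d) d1 (Suc i) 0) = pm.dim (tor_cycles R i d)"
  "cv.dim (d1 (Suc i) 0 ` CC d (Suc (Suc i)) 0) = pm.dim (tor_boundaries R i d)"
proof -
  have inj: "x = 0" if "x \<in> emb ` T" "unemb x = 0" for x T
    using that by (auto simp: unemb_emb emb_eq_0_iff)
  have dim: "cv.dim (emb ` T) = pm.dim T" if "cv.subspace (emb ` T)" "fin_span cscale (emb ` T)" for T
  proof -
    have "pm.dim (unemb ` emb ` T) = cv.dim (emb ` T)"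
      by (rule dim_inj_image[OF linear_unemb that]) (rule inj)
    then show ?thesis by (simp add: image_image unemb_emb)
  qed
  have fC: "fin_span cscale (CC d p q)" for p q by (rule fin_span_csup[OF finite_Tc])
  have cyc: "row_cycles (CC d) d1 (Suc i) 0 = {x \<in> CC d (Suc i) 0. d1 i 0 x = 0}" by (simp add: row_cycles_def)
  have z: "d1 i 0 (emb w) = 0 \<longleftrightarrow> i = 0 \<or> lin_ext (bd_tensor R i) w = 0" for w
  proof (cases i)
    case 0
    then show ?thesis by (simp add: d1_def fun_eq_iff)
  next
    case (Suc r)
    then show ?thesis using emb_bd[of r w] by (simp add: emb_eq_0_iff)
  qed
  have "emb ` tor_cycles R i d = {x \<in> emb ` tensor_piece R i d. d1 i 0 x = 0}"
    unfolding tor_cycles_def using z by auto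
  then have e1: "emb ` tor_cycles R i d = row_cycles (CC d) d1 (Suc i) 0" unfolding emb_piece cyc .
  interpret L: Vector_Spaces.linear cscale cscale "d1 i 0" by (rule linear_d1)
  interpret L': Vector_Spaces.linear cscale cscale "d1 (Suc i) 0" by (rule linear_d1)
  have "cv.subspace {x \<in> CC d (Suc i) 0. d1 i 0 x = 0}"
    using subspace_csup[of "Tc d (Suc i) 0"] by (auto simp: cv.subspace_def L.add L.scale L.zero)
  moreover have "fin_span cscale {x \<in> CC d (Suc i) 0. d1 i 0 x = 0}" by (rule fin_span_mono[OF fC]) auto
  ultimately show "cv.dim (row_cycles (CC d) d1 (Suc i) 0) = pm.dim (tor_cycles R i d)"
    using dim[of "tor_cycles R i d"] unfolding e1 cyc by simp
  have "emb ` tor_boundaries R i d = d1 (Suc i) 0 ` emb ` tensor_piece R (Suc i) d"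
    unfolding tor_boundaries_def image_image emb_bd ..
  then have e2: "emb ` tor_boundaries R i d = d1 (Suc i) 0 ` CC d (Suc (Suc i)) 0" unfolding emb_piece .
  have "cv.subspace (d1 (Suc i) 0 ` CC d (Suc (Suc i)) 0)" by (rule L'.subspace_image[OF subspace_csup])
  moreover have "fin_span cscale (d1 (Suc i) 0 ` CC d (Suc (Suc i)) 0)" by (rule fin_span_image[OF linear_d1 fC])
  ultimately show "cv.dim (d1 (Suc i) 0 ` CC d (Suc (Suc i)) 0) = pm.dim (tor_boundaries R i d)"
    using dim[of "tor_boundaries R i d"] unfolding e2 by simp
qed

text \<open>Holds for whichever resolution \<open>R\<close> the locale is instantiated with, hence
  also for the one chosen inside \<open>tor_dim\<close>.\<close>

lemma hochster:
  "int (pm.dim (tor_cycles R i (2 * j))) - int (pm.dim (tor_boundaries R i (2 * j)))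
   = (if i \<le> j then betti_sum TYPE('k) K {1..m} (j - i) j else 0)"
  using resolution_eq_koszul[of "2 * j" i] unfolding row_dim column_dim column_sum .

end

text \<open>The subtraction of naturals in \<open>tor_dim\<close> does not truncate: Hochster's sum
  has nonnegative terms, so the dimension of the boundaries is at most that of the cycles.\<close>

lemma tor_dim_face_ideal:
  assumes cx: "cplx K" and KV: "\<And>I. I \<in> K \<Longrightarrow> I \<subseteq> {1..m}"
  shows "int (tor_dim m (face_ideal m K :: 'k::field mpoly set) i (2 * j))
    = (if i \<le> j then betti_sum TYPE('k) K {1..m} (j - i) j else 0)"
proof -
  have down: "J \<in> K" if "I \<in> K" "J \<subseteq> I" for I J using cx that by (auto simp: cplx_def)
  define R :: "'k free_cplx" where "R = (SOME R. graded_free_resolution m (nonface_part m K) R)"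
  have "graded_free_resolution m (nonface_part m K) R"
    unfolding R_def by (rule someI_ex[OF graded_free_resolution_exists]) (rule down)
  then interpret face_resolution m K R using down KV by unfold_locales
  have ideal: "face_ideal m K = (nonface_part m K :: 'k mpoly set)" by (rule face_ideal_eq) (rule down)
  have "0 \<le> betti_sum TYPE('k) K {1..m} (j - i) j"
    unfolding betti_sum_def by (rule sum_nonneg) (rule hcoh_nonneg[OF cplx_restr[OF cx]])
  then have "int (pm.dim (tor_boundaries R i (2 * j))) \<le> int (pm.dim (tor_cycles R i (2 * j)))"
    using hochster[of i j] by (simp only: split: if_splits)
  then show ?thesis
    using hochster[of i j] unfolding tor_dim_def ideal R_def[symmetric] Let_def by (simp only: of_nat_diff of_nat_le_iff)
qed

text \<open>The cohomological degree is \<open>c = j - i\<close>. Degrees 1 and \<open>n - 1\<close>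
  give the two strands of the Betti table, degree 0 contributes only at \<open>j = 0\<close>, and
  degree \<open>n\<close> only for the full vertex set.\<close>

lemma betti_stacked:
  assumes "stacked n k {1..m} (facet_complex P m F)" and n: "n \<ge> 3" and j: "j \<le> m"
  shows "int (betti TYPE('k::field) P m F i j) =
    (if j < i then 0 else if j = i then (if j = 0 then 1 else 0)
     else if j = i + 1 then linear_strand k j
     else if j + 1 = i + n then linear_strand k (n + k + 1 - j)
     else if j = i + n \<and> j = n + k + 1 then 1 else 0)"
proof -
  have "n \<ge> 2" using n by simp
  note facts = stacked_facts[OF assms(1) this]
  have m: "m = n + k + 1" using facts(3) by simp
  have KV: "I \<subseteq> {1..m}" if "I \<in> facet_complex P m F" for I using that by (simp add: facet_complex_def)
  have J: "j \<le> n + k + 1" using j m by simp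
  note tor = tor_dim_face_ideal[OF facts(1) KV, of i j, where 'k = 'k]
  show ?thesis
  proof (cases "i \<le> j")
    case True
    then obtain c where c: "j = i + c" using le_Suc_ex by blast
    then have "j - i = c" by simp
    then have "int (betti TYPE('k) P m F i j) = betti_sum TYPE('k) (facet_complex P m F) {1..m} c j"
      using True tor by (simp only: betti_def if_True)
    also note betti_sum_stacked[OF assms(1) n J]
    finally show ?thesis using n by (simp add: c)
  next
    case False
    then show ?thesis using tor by (simp add: betti_def)
  qed
qed

theorem theorem3p1:
  fixes P :: "'a::euclidean_space set" and n k m :: nat and F :: "nat \<Rightarrow> 'a set"
  assumes "n \<ge> 3"
    and "is_truncation_polytope n k P"
    and "bij_betw F {1..m} {G. G facet_of P}"
  shows "m = n + k + 1 \<and>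
    (\<forall>i. i + 1 \<le> m \<longrightarrow>
       betti TYPE('k::field) P m F i (i + 1) = i * ((k + 1) choose (i + 1))) \<and>
    (\<forall>i \<le> k + 1.
       betti TYPE('k) P m F i (i + n - 1) = (k + 1 - i) * ((k + 1) choose (k + 2 - i))) \<and>
    (\<forall>i \<le> m. \<forall>j \<le> m. i + 1 < j \<and> j < i + n - 1 \<longrightarrow> betti TYPE('k) P m F i j = 0) \<and>
    betti TYPE('k) P m F 0 0 = 1 \<and>
    betti TYPE('k) P m F (m - n) m = 1 \<and>
    (\<forall>i \<le> m. \<forall>j \<le> m.
       j \<noteq> i + 1 \<and> \<not> (i \<le> k + 1 \<and> j = i + n - 1) \<and> (i, j) \<noteq> (0, 0) \<and> (i, j) \<noteq> (m - n, m)
         \<longrightarrow> betti TYPE('k) P m F i j = 0)"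
proof -
  let ?\<beta> = "betti TYPE('k) P m F"
  obtain \<Delta> where "(int n) simplex \<Delta>" "(vertex_cut ^^ k) \<Delta> P"
    using assms(2) unfolding is_truncation_polytope_def by blast
  then have "stacked n k {1..m} (fcomplex P {1..m} F)"
    using truncation_stacked[of n \<Delta> k P] assms(1,3) by simp
  then have st: "stacked n k {1..m} (facet_complex P m F)"
    unfolding fcomplex_def facet_complex_def .
  have m: "m = n + k + 1" using stacked_facts(3)[OF st] assms(1) by simp
  note \<beta> = betti_stacked[OF st assms(1), where 'k = 'k]
  have strand: "linear_strand k (Suc q) = int (q * ((k + 1) choose (q + 1)))" for q
    by (simp add: linear_strand_def)
  have zero: "?\<beta> i j = 0" if "j \<le> m" "j \<noteq> i + 1" "\<not> (i \<le> k + 1 \<and> j = i + n - 1)"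
    "(i, j) \<noteq> (0, 0)" "(i, j) \<noteq> (m - n, m)" for i j
  proof -
    \<comment> \<open>On the second strand the excluded range \<open>i > k + 1\<close> forces
      \<open>j\<close> to reach \<open>m\<close>, where the strand is evaluated at 0 and
      vanishes.\<close>
    have "n + k + 1 - j = 0" if "j + 1 = i + n"
      using that \<open>\<not> (i \<le> k + 1 \<and> j = i + n - 1)\<close> \<open>j \<le> m\<close> m by linarith
    then have "int (?\<beta> i j) = 0"
      using that m unfolding \<beta>[OF \<open>j \<le> m\<close>] by auto
    then show ?thesis by simp
  qed
  have first: "?\<beta> i (i + 1) = i * ((k + 1) choose (i + 1))" if "i + 1 \<le> m" for i
    using \<beta>[OF that, of i] strand[of i] by (simp del: of_nat_mult binomial_Suc_Suc)
  have second: "?\<beta> i (i + n - 1) = (k + 1 - i) * ((k + 1) choose (k + 2 - i))" if "i \<le> k + 1" for i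
  proof -
    have "i + n - 1 \<le> m" "\<not> i + n - 1 < i" "i + n - 1 \<noteq> i" "i + n - 1 \<noteq> i + 1" "i + n - 1 + 1 = i + n"
      using that m assms(1) by linarith+
    then have "int (?\<beta> i (i + n - 1)) = linear_strand k (n + k + 1 - (i + n - 1))"
      using \<beta>[of "i + n - 1" i] by (simp only: if_False if_True simp_thms)
    \<comment> \<open>The second strand is read from the full vertex set downwards, so its formula
      is the first one with \<open>k + 1 - i\<close> in place of \<open>i\<close>.\<close>
    also have "n + k + 1 - (i + n - 1) = Suc (k + 1 - i)" using that assms(1) by linarith
    also have "linear_strand k (Suc (k + 1 - i)) = int ((k + 1 - i) * ((k + 1) choose (k + 2 - i)))"
      using that by (simp only: strand) (simp add: Suc_diff_le)
    finally show ?thesis by (simp only: of_nat_eq_iff)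
  qed
  have "int (?\<beta> 0 0) = 1" using \<beta>[of 0 0] by simp
  then have b00: "?\<beta> 0 0 = 1" by linarith
  have btop: "?\<beta> (m - n) m = 1"
  proof -
    have "m - n = k + 1" using m by simp
    \<comment> \<open>Here \<open>j - i = n\<close>: this is the fundamental class of the whole
      sphere.\<close>
    moreover have "int (?\<beta> (k + 1) (n + k + 1)) = 1"
      using \<beta>[of "n + k + 1" "k + 1"] m assms(1) by simp
    ultimately show ?thesis using m by simp
  qed
  have mid: "?\<beta> i j = 0" if "i + 1 < j \<and> j < i + n - 1" "j \<le> m" for i j
  proof (rule zero)
    show "(i, j) \<noteq> (m - n, m)" using that m assms(1) by auto
  qed (use that in auto)
  show ?thesis
  proof (intro conjI allI impI)
    show "m = n + k + 1" by (rule m)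
    show "?\<beta> i (i + 1) = i * ((k + 1) choose (i + 1))" if "i + 1 \<le> m" for i by (rule first[OF that])
    show "?\<beta> i (i + n - 1) = (k + 1 - i) * ((k + 1) choose (k + 2 - i))" if "i \<le> k + 1" for i
      by (rule second[OF that])
    show "?\<beta> 0 0 = 1" by (rule b00)
    show "?\<beta> (m - n) m = 1" by (rule btop)
    show "?\<beta> i j = 0" if "i + 1 < j \<and> j < i + n - 1" "j \<le> m" for i j by (rule mid[OF that])
    show "?\<beta> i j = 0" if "j \<le> m" "j \<noteq> i + 1 \<and> \<not> (i \<le> k + 1 \<and> j = i + n - 1) \<and> (i, j) \<noteq> (0, 0) \<and> (i, j) \<noteq> (m - n, m)" for i j
      by (rule zero) (use that in simp_all)
  qed
qed

end
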